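(* Let $\Omega\subset\mathbb{R}^d$ be a non-empty, bounded, open set and let $\Phi_k,\Phi\colon\mathbb{R}^N_+\to[0,\infty)$, $k\in\mathbb{N}$, with $\{\Phi_k\}$ equicoercive. Suppose $\Phi=\lim_k\Phi_k$ pointwise on $\mathbb{R}^N_+$ and $\Phi$ is also the $\Gamma$-limit of $\Phi_k$, and that $\Phi$ satisfies (Φ.3). Then $H^{\Phi,N}(\Omega)=\lim_k H^{\Phi_k,N}(\Omega)$, and for every $p\in[1,\infty)$, $\Lambda^{\Phi,N}_{1,p}(\Omega)=\lim_k\Lambda^{\Phi_k,N}_{1,p}(\Omega)$ and $\mathscr{L}^{\Phi,N}_{1,p}(\Omega)=\lim_k\mathscr{L}^{\Phi_k,N}_{1,p}(\Omega)$.
   Context: All sets are Lebesgue measurable; inclusions/disjointness up to null sets; $|E|$ Lebesgue measure, $P(E)$ perimeter. An $N$-set of $F$ is $(\mathcal E_1,\dots,\mathcal E_N)$ with $\mathcal E_i\subset F$, $|\mathcal E_i|>0$, $|\mathcal E_i\cap\mathcal E_j|=0$ for $i\ne j$; an $N$-cluster if moreover $P(\mathcal E_i)<\infty$. $H^{\Phi,N}(F)=\inf\{\Phi(P(\mathcal E_1)/|\mathcal E_1|,\dots,P(\mathcal E_N)/|\mathcal E_N|)\}$ over $N$-clusters. $BV_0(F)$, $W^{1,p}_0(F)$: functions in $BV(\mathbb{R}^d)$, resp. $W^{1,p}(\mathbb{R}^d)$, vanishing a.e. outside $F$. $\lambda_{1,1}(F)=\inf\{|Du|(\mathbb{R}^d):u\in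 BV_0(F),\|u\|_{L^1}=1\}$; for $p>1$, $\lambda_{1,p}(F)=\inf\{\int|\nabla u|^p:u\in W^{1,p}_0(F),\|u\|_{L^p}=1\}$; $\mathscr{L}^{\Phi,N}_{1,p}(F)=\inf\{\Phi(\lambda_{1,p}(\mathcal E_1),\dots,\lambda_{1,p}(\mathcal E_N))\}$ over $N$-sets. A $(1,N)$-function of $F$ is $u=(u_1,\dots,u_N)$ with $u_i\in BV_0(F)$, $u_i\ge0$, $\|u_i\|_{L^1}=1$, $u_iu_j=0$ a.e. ($i\ne j$), and $[u]_1=(|Du_i|(\mathbb{R}^d))_i$; for $p>1$ a $(p,N)$-function has $u_i\in W^{1,p}_0(F)$, $u_i\ge0$, $\|u_i\|_{L^p}=1$, $u_iu_j=0$ a.e., and $[u]_p^p=(\|\nabla u_i\|_{L^p}^p)_i$; $\Lambda^{\Phi,N}_{1,p}(F)=\inf\Phi([u]_p^p)$ over $(p,N)$-functions ($[u]_1^1:=[u]_1$). $\mathbb{R}^N_+$ with componentwise order; (Φ.3): $v\le w\Rightarrow\Phi(v)\le\Phi(w)$. $\{\Phi_k\}$ is equicoercive if there is $\delta>0$ with $\Phi_k(v)\ge\delta\sum_iv_i$ for all $k$ and $v\in\mathbb{R}^N_+$. $\Phi$ is the $\Gamma$-limit of $\Phi_k$ (w.r.t. the Euclidean distance on $\mathbb{R}^N_+$) if $\Phi(v)\le\liminf_k\Phi_k(v_k)$ whenever $v_k\to v$, and for every $v$ there exist $v_k\to v$ with $\limsup_k\Phi_k(v_k)\le\Phi(v)$.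 *)

theory Defs
  imports "HOL-Analysis.Analysis"
begin

definition C1c :: "('a::euclidean_space \<Rightarrow> 'b::euclidean_space) \<Rightarrow> bool" where
  "C1c f \<longleftrightarrow> (\<forall>x. f differentiable (at x))
     \<and> (\<forall>b\<in>Basis. continuous_on UNIV (\<lambda>x. frechet_derivative f (at x) b))
     \<and> bounded {x. f x \<noteq> 0}"

definition divergence :: "('a::euclidean_space \<Rightarrow> 'a) \<Rightarrow> 'a \<Rightarrow> real" where
  "divergence \<phi> x = (\<Sum>b\<in>Basis. frechet_derivative \<phi> (at x) b \<bullet> b)"

definition TV :: "('a::euclidean_space \<Rightarrow> real) \<Rightarrow> ereal" where
  "TV u = (SUP \<phi> \<in> {\<phi>::'a \<Rightarrow> 'a. C1c \<phi> \<and> (\<forall>x. norm (\<phi> x) \<le> 1)}.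
             ereal (\<integral>x. u x * divergence \<phi> x \<partial>lebesgue))"

definition perimeter :: "'a::euclidean_space set \<Rightarrow> ereal" where
  "perimeter E = TV (indicator E)"

definition BV0 :: "'a::euclidean_space set \<Rightarrow> ('a \<Rightarrow> real) set" where
  "BV0 F = {u. integrable lebesgue u \<and> TV u < \<infinity> \<and> (AE x in lebesgue. x \<notin> F \<longrightarrow> u x = 0)}"

definition weak_grad :: "('a::euclidean_space \<Rightarrow> real) \<Rightarrow> ('a \<Rightarrow> 'a) \<Rightarrow> bool" where
  "weak_grad u g \<longleftrightarrow> (\<forall>\<psi>::'a \<Rightarrow> real. C1c \<psi> \<longrightarrow> (\<forall>b\<in>Basis.
      (\<integral>x. u x * frechet_derivative \<psi> (at x) b \<partial>lebesgue)
        = - (\<integral>x. (g x \<bullet> b) * \<psi> x \<partial>lebesgue)))"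

definition W1p0_grad :: "real \<Rightarrow> 'a::euclidean_space set \<Rightarrow> ('a \<Rightarrow> real) \<Rightarrow> ('a \<Rightarrow> 'a) \<Rightarrow> bool" where
  "W1p0_grad p F u g \<longleftrightarrow>
     u \<in> borel_measurable lebesgue \<and> integrable lebesgue (\<lambda>x. \<bar>u x\<bar> powr p)
     \<and> g \<in> borel_measurable lebesgue \<and> integrable lebesgue (\<lambda>x. norm (g x) powr p)
     \<and> weak_grad u g \<and> (AE x in lebesgue. x \<notin> F \<longrightarrow> u x = 0)"

text \<open>lambda_{1,p}(F), with inf of the empty set = +infinity.\<close>
definition lambda1 :: "real \<Rightarrow> 'a::euclidean_space set \<Rightarrow> ereal" where
  "lambda1 p F = (if p = 1 then
       (INF u \<in> {u. u \<in> BV0 F \<and> (\<integral>x. \<bar>u x\<bar> \<partial>lebesgue) = 1}. TV u)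
     else
       (INF ug \<in> {(u, g). W1p0_grad p F u g \<and> (\<integral>x. \<bar>u x\<bar> powr p \<partial>lebesgue) = 1}.
          ereal (\<integral>x. norm (snd ug x) powr p \<partial>lebesgue)))"

definition Rplus :: "(real^'n) set" where
  "Rplus = {v. \<forall>i. 0 \<le> v $ i}"

definition Nset :: "'a::euclidean_space set \<Rightarrow> ('n::finite \<Rightarrow> 'a set) \<Rightarrow> bool" where
  "Nset F E \<longleftrightarrow> (\<forall>i. E i \<in> sets lebesgue \<and> E i - F \<in> null_sets lebesgue
                     \<and> emeasure lebesgue (E i) > 0)
               \<and> (\<forall>i j. i \<noteq> j \<longrightarrow> E i \<inter> E j \<in> null_sets lebesgue)"

definition Ncluster :: "'a::euclidean_space set \<Rightarrow> ('n::finite \<Rightarrow> 'a set) \<Rightarrow> bool" where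
  "Ncluster F E \<longleftrightarrow> Nset F E \<and> (\<forall>i. perimeter (E i) < \<infinity>)"

definition pN_common :: "('n::finite \<Rightarrow> 'a::euclidean_space \<Rightarrow> real) \<Rightarrow> bool" where
  "pN_common u \<longleftrightarrow> (\<forall>i. AE x in lebesgue. 0 \<le> u i x)
     \<and> (\<forall>i j. i \<noteq> j \<longrightarrow> (AE x in lebesgue. u i x * u j x = 0))"

definition oneN_function :: "'a::euclidean_space set \<Rightarrow> ('n::finite \<Rightarrow> 'a \<Rightarrow> real) \<Rightarrow> bool" where
  "oneN_function F u \<longleftrightarrow> pN_common u
     \<and> (\<forall>i. u i \<in> BV0 F \<and> (\<integral>x. \<bar>u i x\<bar> \<partial>lebesgue) = 1)"

definition pN_function_grad :: "real \<Rightarrow> 'a::euclidean_space set \<Rightarrow> ('n::finite \<Rightarrow> 'a \<Rightarrow> real)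
    \<Rightarrow> ('n \<Rightarrow> 'a \<Rightarrow> 'a) \<Rightarrow> bool" where
  "pN_function_grad p F u g \<longleftrightarrow> pN_common u
     \<and> (\<forall>i. W1p0_grad p F (u i) (g i) \<and> (\<integral>x. \<bar>u i x\<bar> powr p \<partial>lebesgue) = 1)"

definition H_Phi :: "(real^'n::finite \<Rightarrow> real) \<Rightarrow> 'a::euclidean_space set \<Rightarrow> ereal" where
  "H_Phi \<Phi> F = (INF E \<in> {E :: 'n \<Rightarrow> 'a set. Ncluster F E}.
      ereal (\<Phi> (\<chi> i. real_of_ereal (perimeter (E i)) / measure lebesgue (E i))))"

definition Lambda_Phi :: "(real^'n::finite \<Rightarrow> real) \<Rightarrow> real \<Rightarrow> 'a::euclidean_space set \<Rightarrow> ereal" where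
  "Lambda_Phi \<Phi> p F = (if p = 1 then
       (INF u \<in> {u :: 'n \<Rightarrow> 'a \<Rightarrow> real. oneN_function F u}.
          ereal (\<Phi> (\<chi> i. real_of_ereal (TV (u i)))))
     else
       (INF ug \<in> {ug :: ('n \<Rightarrow> 'a \<Rightarrow> real) \<times> ('n \<Rightarrow> 'a \<Rightarrow> 'a). pN_function_grad p F (fst ug) (snd ug)}.
          ereal (\<Phi> (\<chi> i. \<integral>x. norm (snd ug i x) powr p \<partial>lebesgue))))"

text \<open>Only N-sets with all lambda_{1,p}(E_i) finite enter (Phi is defined on R^N_+ only).\<close>
definition Lcal_Phi :: "(real^'n::finite \<Rightarrow> real) \<Rightarrow> real \<Rightarrow> 'a::euclidean_space set \<Rightarrow> ereal" where
  "Lcal_Phi \<Phi> p F = (INF E \<in> {E :: 'n \<Rightarrow> 'a set. Nset F E \<and> (\<forall>i. lambda1 p (E i) < \<infinity>)}.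
      ereal (\<Phi> (\<chi> i. real_of_ereal (lambda1 p (E i)))))"

definition monotone_Phi :: "(real^'n::finite \<Rightarrow> real) \<Rightarrow> bool" where
  "monotone_Phi \<Phi> \<longleftrightarrow> (\<forall>v\<in>Rplus. \<forall>w\<in>Rplus. (\<forall>i. v $ i \<le> w $ i) \<longrightarrow> \<Phi> v \<le> \<Phi> w)"

definition equicoercive :: "(nat \<Rightarrow> real^'n::finite \<Rightarrow> real) \<Rightarrow> bool" where
  "equicoercive \<Phi>k \<longleftrightarrow> (\<exists>\<delta>>0. \<forall>k. \<forall>v\<in>Rplus. \<Phi>k k v \<ge> \<delta> * (\<Sum>i\<in>UNIV. v $ i))"

definition Gamma_limit :: "(nat \<Rightarrow> real^'n::finite \<Rightarrow> real) \<Rightarrow> (real^'n \<Rightarrow> real) \<Rightarrow> bool" where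
  "Gamma_limit \<Phi>k \<Phi> \<longleftrightarrow>
     (\<forall>v\<in>Rplus. \<forall>vk. (\<forall>k. vk k \<in> Rplus) \<and> vk \<longlonglongrightarrow> v \<longrightarrow>
         ereal (\<Phi> v) \<le> liminf (\<lambda>k. ereal (\<Phi>k k (vk k))))
   \<and> (\<forall>v\<in>Rplus. \<exists>vk. (\<forall>k. vk k \<in> Rplus) \<and> vk \<longlonglongrightarrow> v \<and>
         limsup (\<lambda>k. ereal (\<Phi>k k (vk k))) \<le> ereal (\<Phi> v))"

end

theory Submission
  imports Defs "HOL-Complex_Analysis.Great_Picard" "HOL-Library.Diagonal_Subsequence"
begin

text \<open>All three quantities are infima of \<open>\<Phi>\<close> over a set of attainable vectors in the positive orthant.
  If the limit of any convergent sequence of attainable vectors dominates an attainable vector, then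
  the infima converge: the upper bound follows from pointwise convergence, the lower bound from
  equicoercivity, the Gamma-liminf inequality and monotonicity.

  This closedness is a compactness statement for functions of unit \<open>L\<^sup>p\<close> norm on a bounded set whose
  energies converge. The weak definitions of total variation and gradient bound the mean
  oscillation under translations, which gives a subsequence that converges in \<open>L\<^sup>p\<close>; total variation is
  lower semicontinuous as a supremum, and the \<open>L\<^sup>p\<close> norm of the gradient by passing to strongly convergent
  convex combinations. Clusters enter through their normalised indicators, and the limiting sets
  are the supports of the limiting functions.\<close>

subsection \<open>Infima of Gamma-convergent functions\<close>

text \<open>Asking only for domination fits lower semicontinuity: a limit of attainable vectors may
  exceed the energy vector of the limit functions, and monotonicity of \<Phi> closes that gap. The
  constraints, by contrast, must survive exactly: unit norm requires convergence in the mean,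
  disjointness requires convergence almost everywhere.

  The obstacle is that energies are known only through pairings with compactly supported C^1
  functions. Translation differences are therefore estimated by duality too: in the pairing of
  u(h+x) - u(x) with a test function the translation moves to the test function, where it can be
  differentiated, and the test functions then approximate the sign of the difference (p = 1) or its
  signed power of order p - 1 (p > 1). For p > 1 the gradients are merely bounded; uniform convexity
  takes the place of weak compactness. It fails for p = 1, where the energy is instead a supremum of
  continuous functionals, so the two cases separate exactly there.\<close>

lemma tendsto_INF_of_Gamma_limit:
  fixes \<Phi>k :: "nat \<Rightarrow> real^'n::finite \<Rightarrow> real" and \<Phi> :: "real^'n \<Rightarrow> real"
  assumes A: "A \<subseteq> Rplus"
    and closed_below: "\<And>a v. (\<And>k. a k \<in> A) \<Longrightarrow> a \<longlonglongrightarrow> v \<Longrightarrow> \<exists>w\<in>A. \<forall>i. w $ i \<le> v $ i"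
    and coercive: "equicoercive \<Phi>k"
    and pointwise: "\<forall>v\<in>Rplus. (\<lambda>k. \<Phi>k k v) \<longlonglongrightarrow> \<Phi> v"
    and Gamma: "Gamma_limit \<Phi>k \<Phi>"
    and mono: "monotone_Phi \<Phi>"
  shows "(\<lambda>k. INF w\<in>A. ereal (\<Phi>k k w)) \<longlonglongrightarrow> (INF w\<in>A. ereal (\<Phi> w))"
proof -
  let ?I = "\<lambda>k. INF w\<in>A. ereal (\<Phi>k k w)" and ?J = "INF w\<in>A. ereal (\<Phi> w)"
  have upper: "limsup ?I \<le> ?J"
  proof (rule INF_greatest)
    fix w assume w: "w \<in> A"
    have "limsup ?I \<le> limsup (\<lambda>k. ereal (\<Phi>k k w))"
      by (intro Limsup_mono always_eventually allI INF_lower w)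
    also have "\<dots> = ereal (\<Phi> w)"
      using pointwise w A by (intro lim_imp_Limsup) auto
    finally show "limsup ?I \<le> ereal (\<Phi> w)" .
  qed
  obtain \<delta> where \<delta>: "\<delta> > 0" and coer: "\<And>k v. v \<in> Rplus \<Longrightarrow> \<Phi>k k v \<ge> \<delta> * (\<Sum>i\<in>UNIV. v $ i)"
    using coercive unfolding equicoercive_def by blast
  have lower: "?J \<le> liminf ?I"
  proof (rule ccontr)
    assume "\<not> ?J \<le> liminf ?I"
    \<comment> \<open>A real level \<open>c\<close> also covers an infinite infimum, and it supplies
      the finite bound that coercivity turns into compactness.\<close>
    then obtain c where c: "liminf ?I < ereal c" "ereal c < ?J"
      using ereal_dense2 not_le by metis
    have fr: "frequently (\<lambda>k. ?I k < ereal c) sequentially"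
    proof (rule ccontr)
      assume "\<not> ?thesis"
      then have "eventually (\<lambda>k. ereal c \<le> ?I k) sequentially"
        by (simp add: not_frequently not_less)
      then have "ereal c \<le> liminf ?I" by (rule Liminf_bounded)
      with c show False by simp
    qed
    obtain r :: "nat \<Rightarrow> nat" where r: "strict_mono r" "\<And>n. ?I (r n) < ereal c"
    proof -
      have "infinite {k. ?I k < ereal c}"
        using fr by (simp add: frequently_cofinite[symmetric] cofinite_eq_sequentially)
      from infinite_enumerate[OF this] show ?thesis using that by auto
    qed
    have "\<exists>a\<in>A. \<Phi>k (r n) a < c" for n
      using r(2)[of n] by (auto simp: INF_less_iff)
    then obtain a where a: "\<And>n. a n \<in> A" "\<And>n. \<Phi>k (r n) (a n) < c" by metis
    have bnd: "norm (a n) \<le> c / \<delta>" for n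
    proof -
      have aR: "a n \<in> Rplus" using a A by auto
      have "norm (a n) \<le> (\<Sum>i\<in>UNIV. \<bar>a n $ i\<bar>)" by (rule norm_le_l1_cart)
      also have "\<dots> = (\<Sum>i\<in>UNIV. a n $ i)" using aR by (simp add: Rplus_def)
      also have "\<dots> \<le> c / \<delta>"
        using coer[OF aR, of "r n"] a(2)[of n] \<delta> by (simp add: field_simps)
      finally show ?thesis .
    qed
    have "bounded (range a)" using bnd by (auto simp: bounded_iff)
    then obtain v s where s: "strict_mono s" and lim: "(a \<circ> s) \<longlonglongrightarrow> v"
      using bounded_imp_convergent_subsequence by blast
    have vR: "v \<in> Rplus"
    proof -
      have "(\<lambda>n. (a \<circ> s) n $ i) \<longlonglongrightarrow> v $ i" for i using lim by (rule tendsto_vec_nth)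
      moreover have "(a \<circ> s) n $ i \<ge> 0" for n i using a(1)[of "s n"] A by (auto simp: Rplus_def)
      ultimately have "v $ i \<ge> 0" for i by (meson LIMSEQ_le_const)
      then show ?thesis by (simp add: Rplus_def)
    qed
    define q where "q = r \<circ> s"
    have q: "strict_mono q" using r(1) s by (simp add: q_def strict_mono_o)
    then have injq: "inj q" by (rule strict_mono_imp_inj_on)
    \<comment> \<open>The Gamma-liminf inequality concerns full sequences, whereas the
      near-minimisers live only at the indices \<open>q n\<close>. Filling all other indices with
      the limit \<open>v\<close> keeps the convergence.\<close>
    define vk where "vk k = (if k \<in> range q then a (s (inv q k)) else v)" for k
    have vkq: "vk (q n) = a (s n)" for n using injq by (simp add: vk_def)
    have vkR: "vk k \<in> Rplus" for k using vR a A by (auto simp: vk_def)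
    have vklim: "vk \<longlonglongrightarrow> v"
    proof (rule LIMSEQ_I)
      fix e :: real assume e: "e > 0"
      obtain N where N: "\<And>n. n \<ge> N \<Longrightarrow> norm (a (s n) - v) < e"
        using LIMSEQ_D[OF lim e] by auto
      show "\<exists>no. \<forall>n\<ge>no. norm (vk n - v) < e"
      proof (intro exI allI impI)
        fix k assume k: "k \<ge> q N"
        show "norm (vk k - v) < e"
        proof (cases "k \<in> range q")
          case True
          then obtain n where n: "k = q n" by auto
          then have "n \<ge> N" using k q strict_mono_less_eq by blast
          then show ?thesis using N n vkq by simp
        qed (use e in \<open>simp add: vk_def\<close>)
      qed
    qed
    have "ereal (\<Phi> v) \<le> liminf (\<lambda>k. ereal (\<Phi>k k (vk k)))"
      using Gamma vR vkR vklim unfolding Gamma_limit_def by blast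
    also have "\<dots> \<le> liminf ((\<lambda>k. ereal (\<Phi>k k (vk k))) \<circ> q)" by (rule liminf_subseq_mono[OF q])
    also have "\<dots> \<le> ereal c"
    proof -
      have "((\<lambda>k. ereal (\<Phi>k k (vk k))) \<circ> q) n \<le> ereal c" for n
        using a(2)[of "s n"] by (simp add: vkq) (simp add: q_def)
      then have "liminf ((\<lambda>k. ereal (\<Phi>k k (vk k))) \<circ> q) \<le> liminf (\<lambda>k. ereal c)"
        by (intro Liminf_mono always_eventually) simp
      then show ?thesis by (simp add: Liminf_const)
    qed
    finally have "\<Phi> v \<le> c" by simp
    moreover obtain w where w: "w \<in> A" "\<forall>i. w $ i \<le> v $ i"
      using closed_below[of "a \<circ> s" v] a lim by auto
    moreover have "\<Phi> w \<le> \<Phi> v" using mono w vR A unfolding monotone_Phi_def by auto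
    ultimately have "?J \<le> ereal c" by (intro INF_lower2[OF w(1)]) simp
    with c show False by simp
  qed
  show ?thesis
    using lower upper Liminf_le_Limsup[of sequentially ?I]
    by (intro Liminf_eq_Limsup) (auto intro: antisym)
qed

subsection \<open>Pointwise inequalities for p-th powers\<close>

lemma norm_add_powr_le:
  fixes a b :: "'a::real_normed_vector"
  assumes "0 \<le> p"
  shows "norm (a + b) powr p \<le> 2 powr p * (norm a powr p + norm b powr p)"
proof -
  have "norm (a + b) \<le> 2 * max (norm a) (norm b)"
    using norm_triangle_ineq[of a b] by auto
  then have "norm (a + b) powr p \<le> (2 * max (norm a) (norm b)) powr p"
    using assms by (intro powr_mono2) auto
  also have "\<dots> = 2 powr p * max (norm a) (norm b) powr p"
    by (rule powr_mult)
  also have "\<dots> \<le> 2 powr p * (norm a powr p + norm b powr p)"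
    by (intro mult_left_mono) (auto simp: max_def)
  finally show ?thesis .
qed

text \<open>Below the threshold \<eta> the first summand suffices; above it
  \<open>t powr (1 - p)\<close> is at most \<open>\<eta> powr (1 - p)\<close>. On sets of finite
  measure this trades first powers for p-th powers with an arbitrarily small loss, in place of
  Hoelder's inequality and with p = 1 included.\<close>

lemma le_add_powr:
  fixes t \<eta> p :: real
  assumes "0 \<le> t" "0 < \<eta>" "1 \<le> p"
  shows "t \<le> \<eta> + \<eta> powr (1 - p) * t powr p"
proof (cases "t \<le> \<eta>")
  case True
  then show ?thesis by (smt (verit) mult_nonneg_nonneg powr_ge_zero)
next
  case False
  then have t: "t > 0" "t \<ge> \<eta>" using assms by auto
  have "t = t powr (1 - p) * t powr p" using t by (simp add: powr_add[symmetric])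
  also have "\<dots> \<le> \<eta> powr (1 - p) * t powr p"
    using assms t by (intro mult_right_mono powr_mono2') auto
  finally show ?thesis using assms by linarith
qed

text \<open>Young's inequality with the factors 1/p and 1/q rounded up to 1: whichever of
  \<open>y\<close> and \<open>x powr (p - 1)\<close> is larger, one summand alone bounds the
  product.\<close>

lemma mult_le_powr_add:
  fixes x y p :: real
  assumes "0 \<le> x" "0 \<le> y" "1 < p"
  shows "x * y \<le> x powr p + y powr (p / (p - 1))"
proof (cases "y \<le> x powr (p - 1)")
  case True
  then have "x * y \<le> x * x powr (p - 1)" using assms by (intro mult_left_mono) auto
  also have "\<dots> = x powr p" using assms by (cases "x = 0") (auto simp: powr_mult_base)
  finally show ?thesis by (smt (verit) powr_ge_zero)
next
  case False
  then have y: "y > 0" using assms by (smt (verit) powr_ge_zero)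
  have "x = (x powr (p - 1)) powr (1 / (p - 1))" using assms by (simp add: powr_powr)
  also have "\<dots> \<le> y powr (1 / (p - 1))" using False assms by (intro powr_mono2) auto
  finally have "x * y \<le> y powr (1 / (p - 1)) * y" using assms by (intro mult_right_mono) auto
  also have "\<dots> = y powr (p / (p - 1))"
    using y assms by (simp add: powr_mult_base mult.commute) (simp add: field_simps)
  finally show ?thesis by (smt (verit) powr_ge_zero)
qed

text \<open>The graph of the p-th power lies above its tangent at \<open>m\<close>, rearranged so
  that nothing is subtracted. For p = 1 and m = 0 the convention that \<open>0 powr 0\<close> is 0
  makes the left side vanish.\<close>

lemma powr_tangent_le:
  fixes y m p :: real
  assumes "0 \<le> y" "0 \<le> m" "1 \<le> p"
  shows "p * (m powr (p - 1) * y) \<le> y powr p + (p - 1) * m powr p"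
proof (cases "p = 1")
  case True
  then show ?thesis using assms by (cases "m = 0") auto
next
  case False
  then have p: "p > 1" using assms by simp
  have "y * m powr (p - 1) \<le> y powr p / p + (m powr (p - 1)) powr (p / (p - 1)) / (p / (p - 1))"
    using p assms by (intro Youngs_inequality) (auto simp: field_simps)
  also have "(m powr (p - 1)) powr (p / (p - 1)) = m powr p" using p by (simp add: powr_powr)
  finally show ?thesis using p by (simp add: field_simps)
qed

text \<open>Add the tangent inequalities at the midpoint for \<open>x\<close> and for
  \<open>y\<close>; the linear terms combine to a multiple of \<open>m powr p\<close>.\<close>

lemma midpoint_powr_le:
  fixes x y p :: real
  assumes "0 \<le> x" "0 \<le> y" "1 \<le> p"
  shows "((x + y) / 2) powr p \<le> (x powr p + y powr p) / 2"
proof -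
  define m where "m = (x + y) / 2"
  have m: "m \<ge> 0" using assms by (simp add: m_def)
  have "p * (m powr (p - 1) * x) + p * (m powr (p - 1) * y) \<le> x powr p + y powr p + 2 * ((p - 1) * m powr p)"
    using powr_tangent_le[OF assms(1) m assms(3)] powr_tangent_le[OF assms(2) m assms(3)] by simp
  moreover have "p * (m powr (p - 1) * x) + p * (m powr (p - 1) * y) = 2 * p * (m powr (p - 1) * m)"
    by (simp add: m_def field_simps)
  moreover have "m powr (p - 1) * m = m powr p"
    using m by (cases "m = 0") (auto simp: powr_mult_base mult.commute)
  ultimately have "2 * p * m powr p \<le> x powr p + y powr p + 2 * ((p - 1) * m powr p)" by simp
  then show ?thesis unfolding m_def[symmetric] by (simp add: algebra_simps)
qed

lemma norm_midpoint_powr_le: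
  fixes a b :: "'a::real_normed_vector"
  assumes "1 \<le> p"
  shows "norm ((1/2) *\<^sub>R (a + b)) powr p \<le> (norm a powr p + norm b powr p) / 2"
proof -
  have "norm ((1/2) *\<^sub>R (a + b)) powr p \<le> ((norm a + norm b) / 2) powr p"
    using assms norm_triangle_ineq[of a b] by (intro powr_mono2) auto
  also have "\<dots> \<le> (norm a powr p + norm b powr p) / 2"
    using assms by (intro midpoint_powr_le) auto
  finally show ?thesis .
qed

text \<open>The mean value theorem on the two halves of the interval compares the increments, since
  the derivative is strictly increasing for p > 1.\<close>

lemma midpoint_powr_less:
  fixes x y p :: real
  assumes "0 \<le> x" "0 \<le> y" "1 < p" "x \<noteq> y"
  shows "((x + y) / 2) powr p < (x powr p + y powr p) / 2"
proof -
  have *: "((x + y) / 2) powr p < (x powr p + y powr p) / 2" if xy: "0 \<le> x" "x < y" for x y :: real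
  proof -
    define m where "m = (x + y) / 2"
    have m: "x < m" "m < y" using xy by (auto simp: m_def)
    define f where "f t = t powr p" for t :: real
    have der: "(f has_real_derivative p * t powr (p - 1)) (at t)" if "t > 0" for t
      using that unfolding f_def by (auto intro!: derivative_eq_intros)
    have cont: "continuous_on {x..y} f" unfolding f_def
      using assms xy by (intro continuous_on_powr' continuous_on_id continuous_on_const) auto
    have "\<exists>l z. x < z \<and> z < m \<and> DERIV f z :> l \<and> f m - f x = (m - x) * l"
      using m xy by (intro MVT continuous_on_subset[OF cont])
        (auto intro!: real_differentiable_def[THEN iffD2, OF exI] der)
    then obtain l z where z: "x < z" "z < m" "DERIV f z :> l" "f m - f x = (m - x) * l" by blast
    have "\<exists>l z. m < z \<and> z < y \<and> DERIV f z :> l \<and> f y - f m = (y - m) * l"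
      using m xy by (intro MVT continuous_on_subset[OF cont])
        (auto intro!: real_differentiable_def[THEN iffD2, OF exI] der)
    then obtain l' z' where z': "m < z'" "z' < y" "DERIV f z' :> l'" "f y - f m = (y - m) * l'" by blast
    have "l = p * z powr (p - 1)" "l' = p * z' powr (p - 1)"
      using DERIV_unique z z' der xy m by (metis less_trans le_less_trans)+
    moreover have "z powr (p - 1) < z' powr (p - 1)"
      using z z' xy assms by (intro powr_less_mono2) auto
    ultimately have "l < l'" using assms by simp
    then have "(m - x) * l < (m - x) * l'" using m by simp
    moreover have "y - m = m - x" by (simp add: m_def field_simps)
    ultimately have "f m - f x < f y - f m" using z z' by simp
    then show ?thesis by (simp add: f_def m_def)
  qed
  show ?thesis
  proof (cases "x < y")
    case True then show ?thesis using * assms by blast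
  next
    case False then show ?thesis using *[of y x] assms by (simp add: add.commute)
  qed
qed

text \<open>Strictness has two sources. For different norms it is the strict convexity of the power;
  for equal norms it is the triangle inequality, whose equality case in an inner product space would
  force \<open>a = b\<close>.\<close>

lemma norm_midpoint_powr_less:
  fixes a b :: "'a::real_inner"
  assumes "1 < p" "a \<noteq> b"
  shows "norm ((1/2) *\<^sub>R (a + b)) powr p < (norm a powr p + norm b powr p) / 2"
proof (cases "norm a = norm b")
  case False
  have "norm ((1/2) *\<^sub>R (a + b)) powr p \<le> ((norm a + norm b) / 2) powr p"
    using assms norm_triangle_ineq[of a b] by (intro powr_mono2) auto
  also have "\<dots> < (norm a powr p + norm b powr p) / 2"
    using assms False by (intro midpoint_powr_less) auto
  finally show ?thesis .
next
  case True
  have "norm (a + b) \<noteq> norm a + norm b"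
  proof
    assume "norm (a + b) = norm a + norm b"
    then have "norm a *\<^sub>R b = norm b *\<^sub>R a" by (simp add: norm_triangle_eq)
    then show False using True assms(2) by (cases "norm a = 0") auto
  qed
  then have "norm (a + b) < norm a + norm b" using norm_triangle_ineq[of a b] by linarith
  then have "norm ((1/2) *\<^sub>R (a + b)) powr p < norm a powr p"
    using True assms by (intro powr_less_mono2) auto
  then show ?thesis using True by simp
qed

text \<open>Strict convexity together with compactness of the unit sphere; both sides are
  \<open>p\<close>-homogeneous.\<close>

lemma uniform_convexity_powr:
  fixes p \<epsilon> :: real
  assumes p: "1 < p" and \<epsilon>: "0 < \<epsilon>"
  obtains C where "0 \<le> C" "\<And>a b :: 'a::euclidean_space. norm (a - b) powr p \<le>
     \<epsilon> * (norm a powr p + norm b powr p)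
     + C * ((norm a powr p + norm b powr p) / 2 - norm ((1/2) *\<^sub>R (a + b)) powr p)"
proof -
  define \<phi> where "\<phi> z = (norm (fst z) powr p + norm (snd z) powr p) / 2
      - norm ((1/2) *\<^sub>R (fst z + snd z)) powr p" for z :: "'a \<times> 'a"
  define s where "s z = norm (fst z) powr p + norm (snd z) powr p" for z :: "'a \<times> 'a"
  define d where "d z = norm (fst z - snd z) powr p" for z :: "'a \<times> 'a"
  have cpow: "continuous_on UNIV (\<lambda>z. norm (h z) powr p)" if "continuous_on UNIV h"
    for h :: "'a \<times> 'a \<Rightarrow> 'a"
    using that p by (intro continuous_on_powr' continuous_on_norm continuous_on_const) auto
  have cont: "continuous_on UNIV \<phi>" "continuous_on UNIV s" "continuous_on UNIV d"
    unfolding \<phi>_def s_def d_def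
    by (intro continuous_on_diff continuous_on_divide continuous_on_add continuous_on_const cpow
        continuous_on_fst continuous_on_snd continuous_on_scaleR continuous_on_id; simp)+
  \<comment> \<open>Normalised pairs whose components are at least \<epsilon> apart in p-th power: a
    compact set on which the convexity defect \<phi> is positive, hence bounded below by some
    \<open>m\<close>.\<close>
  define K where "K = {z. s z = 1} \<inter> {z. \<epsilon> \<le> d z}"
  have clK: "closed K" unfolding K_def
    by (intro closed_Int closed_Collect_eq closed_Collect_le cont continuous_on_const)
  have s1: "norm (fst z) \<le> 1 \<and> norm (snd z) \<le> 1" if "s z = 1" for z
  proof -
    have "norm (fst z) powr p \<le> 1" "norm (snd z) powr p \<le> 1"
      using that unfolding s_def by (smt (verit) powr_ge_zero)+
    then show ?thesis using p
      by (smt (verit) norm_ge_zero powr_one_eq_one powr_less_mono2)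
  qed
  have "bounded K"
  proof -
    have "K \<subseteq> cball 0 1 \<times> cball 0 1" using s1 by (force simp: K_def)
    then show ?thesis using bounded_Times bounded_cball bounded_subset by blast
  qed
  with clK have cK: "compact K" by (simp add: compact_eq_bounded_closed)
  have \<phi>0: "\<phi> z \<ge> 0" for z
    using norm_midpoint_powr_le[of p "fst z" "snd z"] p by (simp add: \<phi>_def)
  have "\<exists>m>0. \<forall>z\<in>K. m \<le> \<phi> z"
  proof (cases "K = {}")
    case True then show ?thesis by (intro exI[of _ 1]) auto
  next
    case False
    obtain z0 where z0: "z0 \<in> K" "\<forall>z\<in>K. \<phi> z0 \<le> \<phi> z"
      using continuous_attains_inf[OF cK False continuous_on_subset[OF cont(1)]] by auto
    have "fst z0 \<noteq> snd z0" using z0(1) \<epsilon> by (auto simp: K_def d_def)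
    then have "\<phi> z0 > 0" using norm_midpoint_powr_less[OF p] by (simp add: \<phi>_def)
    then show ?thesis using z0 by blast
  qed
  then obtain m where m: "m > 0" "\<And>z. z \<in> K \<Longrightarrow> m \<le> \<phi> z" by blast
  \<comment> \<open>On \<open>K\<close> the distance term is at most \<open>2 powr p\<close>, which
    equals \<open>C * m\<close> and so is at most \<open>C * \<phi> z\<close>; off \<open>K\<close>
    it is below \<epsilon>.\<close>
  define C where "C = 2 powr p / m"
  have C0: "C \<ge> 0" using m by (simp add: C_def)
  have unit: "d z \<le> \<epsilon> + C * \<phi> z" if z: "s z = 1" for z
  proof (cases "\<epsilon> \<le> d z")
    case False
    then show ?thesis using C0 \<phi>0[of z] by (smt (verit) mult_nonneg_nonneg)
  next
    case True
    have "norm (fst z - snd z) \<le> 2" using s1[OF z] norm_triangle_ineq4[of "fst z" "snd z"] by linarith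
    then have "d z \<le> 2 powr p" unfolding d_def using p by (intro powr_mono2) auto
    also have "\<dots> = C * m" using m by (simp add: C_def)
    also have "\<dots> \<le> C * \<phi> z" using m(2)[of z] z True C0 by (intro mult_left_mono) (auto simp: K_def)
    finally show ?thesis using \<epsilon> by simp
  qed
  have hom: "d z \<le> \<epsilon> * s z + C * \<phi> z" for z
  proof (cases "s z = 0")
    case True
    then have "fst z = 0 \<and> snd z = 0" unfolding s_def
      by (smt (verit) norm_eq_zero powr_eq_0_iff powr_ge_zero)
    then show ?thesis using True by (simp add: d_def \<phi>_def)
  next
    case False
    then have spos: "s z > 0" by (smt (verit) s_def powr_ge_zero)
    define t where "t = s z powr (1/p)"
    have t: "t > 0" using spos by (simp add: t_def)
    have tp: "t powr p = s z" using spos p by (simp add: t_def powr_powr)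
    define y where "y = (1/t) *\<^sub>R z"
    have sc: "norm ((1/t) *\<^sub>R x) powr p = norm x powr p / s z" for x :: 'a
      using t by (simp add: powr_divide tp)
    have sy: "s y = 1" unfolding s_def y_def using spos
      by (simp only: fst_scaleR snd_scaleR sc) (simp add: add_divide_distrib[symmetric] s_def)
    have dy: "d y = d z / s z" unfolding d_def y_def
      by (simp only: fst_scaleR snd_scaleR scaleR_diff_right[symmetric] sc)
    have "norm ((1/2) *\<^sub>R (fst y + snd y)) powr p = norm ((1/2) *\<^sub>R (fst z + snd z)) powr p / s z"
      unfolding y_def using sc[of "(1/2) *\<^sub>R (fst z + snd z)"]
      by (simp add: scaleR_add_right mult.commute)
    then have py: "\<phi> y = \<phi> z / s z" unfolding \<phi>_def y_def
      by (simp only: fst_scaleR snd_scaleR sc) (simp add: add_divide_distrib diff_divide_distrib)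
    have "d z / s z \<le> \<epsilon> + C * (\<phi> z / s z)" using unit[OF sy] by (simp add: dy py)
    then show ?thesis using spos by (simp add: field_simps)
  qed
  have "norm (a - b) powr p \<le> \<epsilon> * (norm a powr p + norm b powr p)
     + C * ((norm a powr p + norm b powr p) / 2 - norm ((1/2) *\<^sub>R (a + b)) powr p)" for a b :: 'a
    using hom[of "(a, b)"] by (simp add: d_def s_def \<phi>_def)
  then show ?thesis using that C0 by blast
qed

subsection \<open>Convergence in the mean of order p\<close>

lemma tendsto_norm_powr:
  fixes f :: "nat \<Rightarrow> 'b::real_normed_vector"
  assumes "f \<longlonglongrightarrow> a" "0 < p"
  shows "(\<lambda>n. norm (f n) powr p) \<longlonglongrightarrow> norm a powr p"
  using assms by (intro tendsto_powr' tendsto_norm tendsto_const) auto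

lemma measurable_norm_powr [measurable]:
  fixes f :: "'m \<Rightarrow> 'b::{real_normed_vector, second_countable_topology}"
  assumes [measurable]: "f \<in> borel_measurable M"
  shows "(\<lambda>x. norm (f x) powr p) \<in> borel_measurable M"
  by measurable

lemma nn_integral_powr_Fatou:
  fixes f :: "nat \<Rightarrow> 'm \<Rightarrow> 'b::{real_normed_vector, second_countable_topology}"
  assumes p: "0 < p" and [measurable]: "\<And>n. f n \<in> borel_measurable M"
    and lim: "AE x in M. (\<lambda>n. f n x) \<longlonglongrightarrow> g x"
    and bd: "\<And>n. (\<integral>\<^sup>+x. ennreal (norm (f n x) powr p) \<partial>M) \<le> c n" and c: "c \<longlonglongrightarrow> v"
  shows "(\<integral>\<^sup>+x. ennreal (norm (g x) powr p) \<partial>M) \<le> v"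
proof -
  have "(\<integral>\<^sup>+x. ennreal (norm (g x) powr p) \<partial>M)
      = (\<integral>\<^sup>+x. liminf (\<lambda>n. ennreal (norm (f n x) powr p)) \<partial>M)"
  proof (rule nn_integral_cong_AE, use lim in eventually_elim)
    case (elim x)
    then have "(\<lambda>n. ennreal (norm (f n x) powr p)) \<longlonglongrightarrow> ennreal (norm (g x) powr p)"
      using p by (intro tendsto_ennrealI tendsto_norm_powr)
    then show ?case by (metis lim_imp_Liminf sequentially_bot)
  qed
  also have "\<dots> \<le> liminf (\<lambda>n. \<integral>\<^sup>+x. ennreal (norm (f n x) powr p) \<partial>M)"
    by (intro nn_integral_liminf) measurable
  also have "\<dots> \<le> liminf c" by (intro Liminf_mono always_eventually allI bd)
  also have "\<dots> = v" using c by (intro lim_imp_Liminf) auto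
  finally show ?thesis .
qed

text \<open>Completeness by telescoping a rapidly Cauchy subsequence. The increments are summed
  pointwise, so no triangle inequality for the norm of order p enters and every p > 0 is
  covered.\<close>

lemma nn_integral_powr_Cauchy_converges:
  fixes f :: "nat \<Rightarrow> 'm \<Rightarrow> 'b::{banach, second_countable_topology}"
  assumes p: "0 < p" and meas [measurable]: "\<And>n. f n \<in> borel_measurable M"
    and Cauchy: "\<And>e. 0 < e \<Longrightarrow> \<exists>N. \<forall>m\<ge>N. \<forall>n\<ge>N.
        (\<integral>\<^sup>+x. ennreal (norm (f m x - f n x) powr p) \<partial>M) \<le> ennreal e"
  obtains g r where "g \<in> borel_measurable M" "strict_mono r"
    "AE x in M. (\<lambda>k. f (r k) x) \<longlonglongrightarrow> g x"
    "\<And>e. 0 < e \<Longrightarrow> \<exists>N. \<forall>n\<ge>N. (\<integral>\<^sup>+x. ennreal (norm (f n x - g x) powr p) \<partial>M) \<le> ennreal e"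
proof -
  \<comment> \<open>With these weights, finiteness almost everywhere of the weighted sum forces
    \<open>norm (d k x) \<le> (1/2)^k\<close> from some index on.\<close>
  define w where "w k = (2 ^ k) powr p" for k :: nat
  have w: "w k > 0" for k by (simp add: w_def)
  have "\<exists>N. \<forall>k. \<forall>m\<ge>N k. \<forall>n\<ge>N k. (\<integral>\<^sup>+x. ennreal (norm (f m x - f n x) powr p) \<partial>M)
      \<le> ennreal ((1/2)^k / w k)"
    using Cauchy[of "(1/2)^k / w k" for k] w by (intro choice) (simp add: zero_less_divide_iff)
  then obtain N where N: "\<And>k m n. m \<ge> N k \<Longrightarrow> n \<ge> N k \<Longrightarrow>
      (\<integral>\<^sup>+x. ennreal (norm (f m x - f n x) powr p) \<partial>M) \<le> ennreal ((1/2)^k / w k)" by blast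
  \<comment> \<open>Partial sums of \<open>N\<close> dominate \<open>N k\<close>, and the added
    \<open>k\<close> makes \<open>r\<close> strictly increasing.\<close>
  define r where "r k = (\<Sum>i\<le>k. N i) + k" for k
  have r: "strict_mono r" by (auto simp: strict_mono_Suc_iff r_def)
  have rN: "r k \<ge> N k" for k
  proof -
    have "N k \<le> (\<Sum>i\<le>k. N i)" by (intro member_le_sum) auto
    then show ?thesis by (simp add: r_def)
  qed
  have rN': "r (Suc k) \<ge> N k" for k
    using rN[of k] r by (meson le_trans lessI less_imp_le strict_mono_less)
  define d where "d k x = f (r (Suc k)) x - f (r k) x" for k x
  have [measurable]: "d k \<in> borel_measurable M" for k unfolding d_def by measurable
  have "(\<integral>\<^sup>+x. (\<Sum>k. ennreal (w k * norm (d k x) powr p)) \<partial>M)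
      = (\<Sum>k. \<integral>\<^sup>+x. ennreal (w k * norm (d k x) powr p) \<partial>M)"
    by (intro nn_integral_suminf) measurable
  also have "\<dots> \<le> (\<Sum>k. ennreal ((1/2)^k))"
  proof (intro suminf_le summableI)
    fix k
    have "(\<integral>\<^sup>+x. ennreal (w k * norm (d k x) powr p) \<partial>M)
        = ennreal (w k) * (\<integral>\<^sup>+x. ennreal (norm (d k x) powr p) \<partial>M)"
      using w[of k] by (subst nn_integral_cmult[symmetric]) (auto simp: ennreal_mult)
    also have "\<dots> \<le> ennreal (w k) * ennreal ((1/2)^k / w k)"
      unfolding d_def by (intro mult_left_mono N rN rN') simp
    also have "\<dots> = ennreal ((1/2)^k)"
      using w[of k] by (simp add: ennreal_mult[symmetric])
    finally show "(\<integral>\<^sup>+x. ennreal (w k * norm (d k x) powr p) \<partial>M) \<le> ennreal ((1/2)^k)" .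
  qed
  also have "\<dots> = ennreal (\<Sum>k. (1/2)^k)"
    by (intro suminf_ennreal2) (auto intro: summable_geometric)
  also have "\<dots> < \<infinity>" by simp
  finally have "AE x in M. (\<Sum>k. ennreal (w k * norm (d k x) powr p)) \<noteq> \<infinity>"
    by (intro nn_integral_PInf_AE) auto
  then have conv: "AE x in M. convergent (\<lambda>k. f (r k) x)"
  proof eventually_elim
    case (elim x)
    have "summable (\<lambda>k. w k * norm (d k x) powr p)"
      using elim w by (intro summable_suminf_not_top) (auto simp: less_imp_le)
    then have "(\<lambda>k. w k * norm (d k x) powr p) \<longlonglongrightarrow> 0" by (rule summable_LIMSEQ_zero)
    then have "eventually (\<lambda>k. w k * norm (d k x) powr p < 1) sequentially"
      by (rule order_tendstoD) simp
    then have "eventually (\<lambda>k. norm (d k x) \<le> (1/2)^k) sequentially"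
    proof eventually_elim
      case (elim k)
      have "(2 ^ k * norm (d k x)) powr p < 1" using elim by (simp add: w_def powr_mult)
      then have "2 ^ k * norm (d k x) < 1"
        using p powr_mono2[of p 1 "2 ^ k * norm (d k x)"] by fastforce
      then show ?case by (simp add: field_simps)
    qed
    then have "summable (\<lambda>k. d k x)"
      by (rule summable_comparison_test_ev) (auto intro: summable_geometric)
    then have "convergent (\<lambda>n. \<Sum>k<n. d k x)" by (simp add: summable_iff_convergent)
    then have "convergent (\<lambda>n. (\<Sum>k<n. d k x) + f (r 0) x)"
      by (intro convergent_add convergent_const)
    moreover have "(\<Sum>k<n. d k x) + f (r 0) x = f (r n) x" for n
      unfolding d_def by (subst sum_lessThan_telescope) simp
    ultimately show ?case by simp
  qed
  define g where "g x = lim (\<lambda>k. f (r k) x)" for x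
  have gm [measurable]: "g \<in> borel_measurable M"
    unfolding g_def by (intro borel_measurable_lim_metric) measurable
  have lim: "AE x in M. (\<lambda>k. f (r k) x) \<longlonglongrightarrow> g x"
    using conv by eventually_elim (simp add: g_def convergent_LIMSEQ_iff)
  have "\<exists>N. \<forall>n\<ge>N. (\<integral>\<^sup>+x. ennreal (norm (f n x - g x) powr p) \<partial>M) \<le> ennreal e" if e: "0 < e" for e
  proof -
    obtain N where N: "\<And>m n. m \<ge> N \<Longrightarrow> n \<ge> N \<Longrightarrow>
        (\<integral>\<^sup>+x. ennreal (norm (f m x - f n x) powr p) \<partial>M) \<le> ennreal e" using Cauchy[OF e] by blast
    show ?thesis
    proof (intro exI allI impI)
      fix n assume n: "n \<ge> N"
      show "(\<integral>\<^sup>+x. ennreal (norm (f n x - g x) powr p) \<partial>M) \<le> ennreal e"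
      \<comment> \<open>The index \<open>n\<close> stays fixed and Fatou acts on the other index of
        the Cauchy estimate; the shift by \<open>N\<close> guarantees
        \<open>r (k + N) \<ge> N\<close>.\<close>
      proof (rule nn_integral_powr_Fatou[where f = "\<lambda>k x. f n x - f (r (k + N)) x" and c = "\<lambda>_. ennreal e"])
        show "AE x in M. (\<lambda>k. f n x - f (r (k + N)) x) \<longlonglongrightarrow> f n x - g x"
          using lim by eventually_elim (intro tendsto_diff tendsto_const LIMSEQ_ignore_initial_segment)
        show "(\<integral>\<^sup>+x. ennreal (norm (f n x - f (r (k + N)) x) powr p) \<partial>M) \<le> ennreal e" for k
          using n seq_suble[OF r, of "k + N"] by (intro N) auto
      qed (use p in auto)
    qed
  qed
  with that gm r lim show ?thesis by blast
qed

subsection \<open>Compactly supported test functions\<close>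

lemma C1cI:
  assumes "\<And>x. (f has_derivative f' x) (at x)"
    and "\<And>b. b \<in> Basis \<Longrightarrow> continuous_on UNIV (\<lambda>x. f' x b)"
    and "bounded {x. f x \<noteq> 0}"
  shows "C1c f"
proof -
  have "frechet_derivative f (at x) = f' x" for x
    using frechet_derivative_at[OF assms(1)] by simp
  then show ?thesis using assms unfolding C1c_def differentiable_def by auto
qed

lemma C1c_has_derivative:
  "C1c f \<Longrightarrow> (f has_derivative frechet_derivative f (at x)) (at x)"
  by (simp add: C1c_def frechet_derivative_works)

lemma C1c_continuous_on: "C1c f \<Longrightarrow> continuous_on A f"
  by (meson C1c_has_derivative continuous_at_imp_continuous_on has_derivative_continuous)

lemma C1c_derivative_expand:
  assumes "C1c f"
  shows "frechet_derivative f (at x) h = (\<Sum>b\<in>Basis. (h \<bullet> b) *\<^sub>R frechet_derivative f (at x) b)"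
proof -
  have l: "linear (frechet_derivative f (at x))"
    using C1c_has_derivative[OF assms] has_derivative_linear by blast
  have "frechet_derivative f (at x) h = frechet_derivative f (at x) (\<Sum>b\<in>Basis. (h \<bullet> b) *\<^sub>R b)"
    by (simp add: euclidean_representation)
  then show ?thesis by (simp add: linear_sum[OF l] linear_scale[OF l])
qed

lemma C1c_continuous_on_derivative:
  assumes "C1c f"
  shows "continuous_on A (\<lambda>x. frechet_derivative f (at x) h)"
proof -
  have "continuous_on UNIV (\<lambda>x. frechet_derivative f (at x) h)"
    unfolding C1c_derivative_expand[OF assms, of _ h]
    using assms by (intro continuous_intros) (auto simp: C1c_def)
  then show ?thesis using continuous_on_subset by blast
qed

lemma C1c_support:
  assumes "C1c f"
  obtains R where "0 < R" "\<And>x. R < norm x \<Longrightarrow> f x = 0"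
    "\<And>x h. R < norm x \<Longrightarrow> frechet_derivative f (at x) h = 0"
proof -
  obtain R where R: "0 < R" "\<And>x. f x \<noteq> 0 \<Longrightarrow> norm x \<le> R"
    using assms unfolding C1c_def bounded_pos by blast
  have "frechet_derivative f (at x) h = 0" if x: "R < norm x" for x h
  proof -
    have "(f has_derivative (\<lambda>_. 0)) (at x)"
    proof (rule has_derivative_transform_within_open[of "\<lambda>_. 0"])
      show "open (- cball 0 R :: 'a set)" by auto
    qed (use x R(2) in \<open>force simp: dist_norm\<close>)+
    then show ?thesis using frechet_derivative_at by metis
  qed
  then show ?thesis using that R by (meson not_le)
qed

lemma continuous_compact_support_bounded:
  fixes f :: "'a::euclidean_space \<Rightarrow> 'b::real_normed_vector"
  assumes "continuous_on UNIV f" "\<And>x. R < norm x \<Longrightarrow> f x = 0"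
  obtains B where "0 \<le> B" "\<And>x. norm (f x) \<le> B"
proof -
  have "compact (f ` cball 0 R)"
    using assms(1) by (intro compact_continuous_image) (auto intro: continuous_on_subset)
  then obtain B where B: "\<And>x. norm x \<le> R \<Longrightarrow> norm (f x) \<le> B"
    using compact_imp_bounded[of "f ` cball 0 R"] unfolding bounded_iff by (metis image_eqI mem_cball_0)
  have "norm (f x) \<le> max 0 B" for x
    using B[of x] assms(2)[of x] by (cases "norm x \<le> R") auto
  then show ?thesis using that by (meson max.cobounded1)
qed

lemma C1c_bounded:
  assumes "C1c f"
  obtains B where "0 \<le> B" "\<And>x. norm (f x) \<le> B"
  using C1c_support[OF assms] continuous_compact_support_bounded C1c_continuous_on[OF assms] by metis

lemma C1c_derivative_bounded:
  fixes f :: "'a::euclidean_space \<Rightarrow> 'b::euclidean_space"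
  assumes "C1c f"
  obtains B where "0 \<le> B" "\<And>x h. norm (frechet_derivative f (at x) h) \<le> B * norm h"
proof -
  obtain R where R: "\<And>x h. R < norm x \<Longrightarrow> frechet_derivative f (at x) h = 0"
    using C1c_support[OF assms] by metis
  have "\<exists>B\<ge>0. \<forall>x. norm (frechet_derivative f (at x) b) \<le> B" for b
    using continuous_compact_support_bounded[of "\<lambda>x. frechet_derivative f (at x) b" R]
      C1c_continuous_on_derivative[OF assms] R by metis
  then obtain B where B: "\<And>b. B b \<ge> 0" "\<And>b x. norm (frechet_derivative f (at x) b) \<le> B b" by metis
  have "norm (frechet_derivative f (at x) h) \<le> (\<Sum>b\<in>Basis. B b) * norm h" for x h
  proof -
    have "norm (frechet_derivative f (at x) h) \<le> (\<Sum>b\<in>Basis. norm ((h \<bullet> b) *\<^sub>R frechet_derivative f (at x) b))"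
      unfolding C1c_derivative_expand[OF assms, of x h] by (rule norm_sum)
    also have "\<dots> \<le> (\<Sum>b\<in>Basis. B b * norm h)"
    proof (intro sum_mono)
      fix b :: 'a assume "b \<in> Basis"
      then have "\<bar>h \<bullet> b\<bar> * norm (frechet_derivative f (at x) b) \<le> norm h * B b"
        using B by (intro mult_mono Basis_le_norm) auto
      then show "norm ((h \<bullet> b) *\<^sub>R frechet_derivative f (at x) b) \<le> B b * norm h" by (simp add: mult.commute)
    qed
    finally show ?thesis by (simp add: sum_distrib_right)
  qed
  then show ?thesis using that B by (meson sum_nonneg)
qed

lemma C1c_lipschitz:
  fixes f :: "'a::euclidean_space \<Rightarrow> 'b::euclidean_space"
  assumes f: "C1c f" and B0: "0 \<le> B" and B: "\<And>x h. norm (frechet_derivative f (at x) h) \<le> B * norm h"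
  shows "norm (f x - f y) \<le> B * norm (x - y)"
  by (rule differentiable_bound[where S = UNIV and f' = "\<lambda>x. frechet_derivative f (at x)"])
    (use C1c_has_derivative[OF f] B B0 in \<open>auto intro!: onorm_bound\<close>)

lemma C1c_shift:
  assumes "C1c f"
  shows "C1c (\<lambda>x. f (x - a))"
    and "frechet_derivative (\<lambda>x. f (x - a)) (at x) = frechet_derivative f (at (x - a))"
proof -
  have d: "((\<lambda>x. f (x - a)) has_derivative frechet_derivative f (at (x - a))) (at x)" for x
  proof -
    have "((\<lambda>x. x - a) has_derivative (\<lambda>h. h)) (at x)" by (auto intro!: derivative_eq_intros)
    from has_derivative_compose[OF this C1c_has_derivative[OF assms]] show ?thesis .
  qed
  then show "frechet_derivative (\<lambda>x. f (x - a)) (at x) = frechet_derivative f (at (x - a))"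
    using frechet_derivative_at by metis
  show "C1c (\<lambda>x. f (x - a))"
  proof (rule C1cI[OF d])
    show "continuous_on UNIV (\<lambda>x. frechet_derivative f (at (x - a)) b)" for b
      by (rule continuous_on_compose2[OF C1c_continuous_on_derivative[OF assms, of UNIV b]])
        (auto intro: continuous_intros)
    have "{x. f (x - a) \<noteq> 0} = (\<lambda>x. x + a) ` {x. f x \<noteq> 0}"
      by (force intro: image_eqI[where x = "y - a" for y])
    then show "bounded {x. f (x - a) \<noteq> 0}"
      using assms bounded_translation[of "{x. f x \<noteq> 0}" a] by (simp add: C1c_def add.commute)
  qed
qed

lemma C1c_scaleR_const:
  fixes f :: "'a::euclidean_space \<Rightarrow> real" and v :: "'b::euclidean_space"
  assumes "C1c f"
  shows "C1c (\<lambda>x. f x *\<^sub>R v)"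
    and "frechet_derivative (\<lambda>x. f x *\<^sub>R v) (at x) = (\<lambda>h. frechet_derivative f (at x) h *\<^sub>R v)"
proof -
  have d: "((\<lambda>x. f x *\<^sub>R v) has_derivative (\<lambda>h. frechet_derivative f (at x) h *\<^sub>R v)) (at x)" for x
    by (intro has_derivative_scaleR_left C1c_has_derivative assms)
  then show "frechet_derivative (\<lambda>x. f x *\<^sub>R v) (at x) = (\<lambda>h. frechet_derivative f (at x) h *\<^sub>R v)"
    using frechet_derivative_at by metis
  show "C1c (\<lambda>x. f x *\<^sub>R v)"
  proof (rule C1cI[OF d])
    show "continuous_on UNIV (\<lambda>x. frechet_derivative f (at x) b *\<^sub>R v)" for b
      by (intro continuous_intros C1c_continuous_on_derivative assms)
    show "bounded {x. f x *\<^sub>R v \<noteq> 0}"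
      using assms unfolding C1c_def by (auto elim: bounded_subset)
  qed
qed

text \<open>Fields of constant direction turn the divergences in \<open>TV\<close> into directional
  derivatives of scalar test functions, the only ones that translations call for.\<close>

lemma divergence_scaleR_const:
  fixes f :: "'a::euclidean_space \<Rightarrow> real"
  assumes "C1c f"
  shows "divergence (\<lambda>x. f x *\<^sub>R v) x = frechet_derivative f (at x) v"
proof -
  have "divergence (\<lambda>x. f x *\<^sub>R v) x = (\<Sum>b\<in>Basis. (v \<bullet> b) *\<^sub>R frechet_derivative f (at x) b)"
    unfolding divergence_def C1c_scaleR_const(2)[OF assms] by (simp add: mult.commute)
  then show ?thesis using C1c_derivative_expand[OF assms, of x v] by simp
qed

section \<open>Bump functions and approximation of bounded functions by test functions\<close>

lemma has_real_derivative_max_0_square: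
  "((\<lambda>t::real. (max 0 t)\<^sup>2) has_real_derivative 2 * max 0 t) (at t)"
proof -
  consider "t > 0" | "t < 0" | "t = 0" by linarith
  then show ?thesis
  proof cases
    case 1
    have "((\<lambda>t::real. t\<^sup>2) has_real_derivative 2 * t) (at t)" by (auto intro!: derivative_eq_intros)
    then have "((\<lambda>t::real. (max 0 t)\<^sup>2) has_real_derivative 2 * t) (at t)"
      by (rule DERIV_cong_ev[THEN iffD1, rotated -1])
        (use 1 in \<open>auto intro!: eventually_mono[OF order_tendstoD(1)[OF tendsto_ident_at, of 0]] simp: eventually_nhds_conv_at\<close>)
    then show ?thesis using 1 by simp
  next
    case 2
    have "((\<lambda>t::real. 0) has_real_derivative 0) (at t)" by simp
    then have "((\<lambda>t::real. (max 0 t)\<^sup>2) has_real_derivative 0) (at t)"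
      by (rule DERIV_cong_ev[THEN iffD1, rotated -1])
        (use 2 in \<open>auto intro!: eventually_mono[OF order_tendstoD(2)[OF tendsto_ident_at, of t 0]] simp: eventually_nhds_conv_at\<close>)
    then show ?thesis using 2 by simp
  next
    case 3
    have "(\<lambda>h::real. (max 0 (0 + h))\<^sup>2 / h) \<midarrow>0\<rightarrow> 0"
    proof (rule Lim_null_comparison)
      show "\<forall>\<^sub>F h in at 0. norm ((max 0 (0 + h))\<^sup>2 / h) \<le> \<bar>h\<bar>" for h :: real
        by (intro always_eventually) (auto simp: max_def power2_eq_square)
      show "(\<lambda>h::real. \<bar>h\<bar>) \<midarrow>0\<rightarrow> 0" by (intro tendsto_rabs_zero tendsto_ident_at)
    qed
    then show ?thesis using 3 by (simp add: DERIV_def)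
  qed
qed

lemma real_polynomial_function_C1:
  fixes q :: "'a::euclidean_space \<Rightarrow> real"
  assumes "real_polynomial_function q"
  shows "\<exists>q'. (\<forall>x. (q has_derivative q' x) (at x)) \<and> (\<forall>b. continuous_on UNIV (\<lambda>x. q' x b))"
  using assms
proof induction
  case (linear f)
  then show ?case
    by (intro exI[of _ "\<lambda>_. f"]) (auto intro: bounded_linear_imp_has_derivative)
next
  case (const c)
  then show ?case by (intro exI[of _ "\<lambda>_ _. 0"]) auto
next
  case (add f g)
  then obtain f' g' where "\<And>x. (f has_derivative f' x) (at x)" "\<And>b. continuous_on UNIV (\<lambda>x. f' x b)"
    "\<And>x. (g has_derivative g' x) (at x)" "\<And>b. continuous_on UNIV (\<lambda>x. g' x b)" by blast
  then show ?case
    by (intro exI[of _ "\<lambda>x h. f' x h + g' x h"]) (auto intro!: has_derivative_add continuous_on_add)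
next
  case (mult f g)
  then obtain f' g' where *: "\<And>x. (f has_derivative f' x) (at x)" "\<And>b. continuous_on UNIV (\<lambda>x. f' x b)"
    "\<And>x. (g has_derivative g' x) (at x)" "\<And>b. continuous_on UNIV (\<lambda>x. g' x b)" by blast
  moreover have "continuous_on UNIV f" "continuous_on UNIV g"
    using * by (meson continuous_at_imp_continuous_on has_derivative_continuous)+
  ultimately show ?case
    by (intro exI[of _ "\<lambda>x h. f x * g' x h + f' x h * g x"])
      (auto intro!: has_derivative_mult continuous_intros)
qed

text \<open>Squaring the positive part removes the kink on the sphere of radius \<open>R\<close>, so
  the cutoff is C^1, which is all that \<open>C1c\<close> asks. The factor \<open>q\<close> is left
  free for the Stone-Weierstrass polynomial.\<close>

lemma C1c_bump_times_polynomial: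
  fixes q :: "'a::euclidean_space \<Rightarrow> real"
  assumes "real_polynomial_function q" "0 < R"
  shows "C1c (\<lambda>x. (max 0 (1 - (norm x / R)\<^sup>2))\<^sup>2 * q x)"
proof -
  obtain q' where q': "\<And>x. (q has_derivative q' x) (at x)" "\<And>b. continuous_on UNIV (\<lambda>x. q' x b)"
    using real_polynomial_function_C1[OF assms(1)] by blast
  have cq: "continuous_on UNIV q"
    using q' by (meson continuous_at_imp_continuous_on has_derivative_continuous)
  let ?m = "\<lambda>x::'a. 1 - (norm x / R)\<^sup>2"
  have m: "(?m has_derivative (\<lambda>h. - (2 * (x \<bullet> h) / R\<^sup>2))) (at x)" for x
    unfolding power_divide power2_norm_eq_inner using assms(2)
    by (auto intro!: derivative_eq_intros simp: inner_commute field_simps)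
  have d: "((\<lambda>x. (max 0 (?m x))\<^sup>2) has_derivative (\<lambda>h. - (2 * (x \<bullet> h) / R\<^sup>2) * (2 * max 0 (?m x)))) (at x)" for x
    using has_derivative_compose[OF m has_real_derivative_max_0_square[THEN has_field_derivative_imp_has_derivative]]
    by (simp add: mult.commute)
  show ?thesis
  proof (rule C1cI)
    show "((\<lambda>x. (max 0 (?m x))\<^sup>2 * q x) has_derivative
      (\<lambda>h. (max 0 (?m x))\<^sup>2 * q' x h + - (2 * (x \<bullet> h) / R\<^sup>2) * (2 * max 0 (?m x)) * q x)) (at x)" for x
      by (rule has_derivative_mult[OF d q'(1)])
    show "continuous_on UNIV (\<lambda>x. (max 0 (?m x))\<^sup>2 * q' x b + - (2 * (x \<bullet> b) / R\<^sup>2) * (2 * max 0 (?m x)) * q x)" for b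
      using assms(2) by (intro continuous_intros q' cq) auto
    have "norm x \<le> R" if "(max 0 (?m x))\<^sup>2 * q x \<noteq> 0" for x
    proof (rule ccontr)
      assume "\<not> norm x \<le> R"
      then have "1 < norm x / R" using assms(2) by simp
      then have "1 \<le> (norm x / R)\<^sup>2" by (intro one_le_power) auto
      with that show False by simp
    qed
    then show "bounded {x. (max 0 (?m x))\<^sup>2 * q x \<noteq> 0}" unfolding bounded_iff by blast
  qed
qed

text \<open>Dividing \<open>w\<close> by a bump function before applying Stone--Weierstrass keeps the
  approximants inside a fixed ball.\<close>

lemma C1c_approximation:
  fixes w :: "'a::euclidean_space \<Rightarrow> real"
  assumes wm: "w \<in> borel_measurable lebesgue" and B: "\<And>x. \<bar>w x\<bar> \<le> B" and R: "0 < R"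
    and supp: "\<And>x. R < norm x \<Longrightarrow> w x = 0"
  obtains \<psi> C where "\<And>n::nat. C1c (\<psi> n)" "\<And>n x. \<bar>\<psi> n x\<bar> \<le> C" "\<And>n x. 2 * R < norm x \<Longrightarrow> \<psi> n x = 0"
    "AE x in lebesgue. (\<lambda>n. \<psi> n x) \<longlonglongrightarrow> w x"
    "C \<le> 2 * B + 1"
proof -
  define \<kappa> where "\<kappa> x = (max 0 (1 - (norm x / (2*R))\<^sup>2))\<^sup>2" for x :: 'a
  have \<kappa>c: "continuous_on UNIV \<kappa>" unfolding \<kappa>_def using R by (intro continuous_intros) auto
  have \<kappa>01: "0 \<le> \<kappa> x" "\<kappa> x \<le> 1" for x unfolding \<kappa>_def by (auto intro!: power_le_one)
  \<comment> \<open>The bump has radius \<open>2 * R\<close>, so on the ball of radius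
    \<open>R\<close> that carries \<open>w\<close> it is at least (3/4)^2, which exceeds
    1/2.\<close>
  have \<kappa>big: "1/2 \<le> \<kappa> x" if "norm x \<le> R" for x
  proof -
    have "norm x / (2*R) \<le> 1/2" using that R by (simp add: field_simps)
    then have "(norm x / (2*R))\<^sup>2 \<le> (1/2)\<^sup>2" using R by (intro power_mono) auto
    then have "(norm x / (2*R))\<^sup>2 \<le> 1/4" by (simp only: power2_eq_square)
    then have "3/4 \<le> max 0 (1 - (norm x / (2*R))\<^sup>2)" by (intro max.coboundedI2) linarith
    then have "(3/4)\<^sup>2 \<le> \<kappa> x" unfolding \<kappa>_def by (rule power_mono) simp
    then show ?thesis by (simp add: power2_eq_square)
  qed
  have B0: "0 \<le> B" using B[of 0] by linarith
  define v where "v x = w x / \<kappa> x" for x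
  have vB: "\<bar>v x\<bar> \<le> 2 * B" for x
  proof (cases "norm x \<le> R")
    case True
    have "\<bar>v x\<bar> = \<bar>w x\<bar> / \<kappa> x" using \<kappa>01[of x] by (simp add: v_def)
    also have "\<dots> \<le> B / (1/2)" using B \<kappa>big[OF True] B0 by (intro frac_le) auto
    finally show ?thesis by simp
  next
    case False then show ?thesis using supp[of x] B0 by (simp add: v_def)
  qed
  have vw: "\<kappa> x * v x = w x" for x
    using \<kappa>big[of x] supp[of x] by (cases "norm x \<le> R") (auto simp: v_def)
  have "\<kappa> \<in> borel_measurable lebesgue"
    using borel_measurable_continuous_onI[OF \<kappa>c] by (simp add: measurable_completion)
  then have "v \<in> borel_measurable lebesgue" unfolding v_def using wm by measurable
  then have "v measurable_on UNIV" by (intro lebesgue_measurable_imp_measurable_on) auto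
  then obtain N g where N: "negligible N" and g: "\<And>n. continuous_on UNIV (g n)"
    "\<And>x. x \<notin> N \<Longrightarrow> (\<lambda>n. g n x) \<longlonglongrightarrow> v x" unfolding measurable_on_def by auto
  \<comment> \<open>Clipping the continuous approximants to the range of \<open>v\<close> makes them
    uniformly bounded and leaves their limit unchanged.\<close>
  define c where "c n x = max (- (2*B)) (min (2*B) (g n x))" for n x
  have c1: "continuous_on (cball 0 (2*R)) (c n)" for n unfolding c_def
    by (intro continuous_intros continuous_on_subset[OF g(1)]) auto
  have c2: "(\<lambda>n. c n x) \<longlonglongrightarrow> v x" if "x \<notin> N" for x
  proof -
    have "(\<lambda>n. c n x) \<longlonglongrightarrow> max (- (2*B)) (min (2*B) (v x))" unfolding c_def
      by (intro tendsto_max tendsto_min tendsto_const g that)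
    then show ?thesis using vB[of x] by (simp add: abs_le_iff max_def min_def split: if_splits)
  qed
  have c3: "\<bar>c n x\<bar> \<le> 2 * B" for n x unfolding c_def using B0 by (auto simp: abs_le_iff)
  \<comment> \<open>The approximation error never exceeds 1; this is the summand 1 in the final
    bound \<open>2 * B + 1\<close>.\<close>
  have "\<exists>q. real_polynomial_function q \<and> (\<forall>x\<in>cball 0 (2*R). \<bar>c n x - q x\<bar> < 1 / real (Suc n))" for n
    using Stone_Weierstrass_polynomial_function[OF compact_cball c1, of "1 / real (Suc n)" n]
    by (auto simp: real_polynomial_function_eq)
  then obtain q where q: "\<And>n. real_polynomial_function (q n)"
    "\<And>n x. norm x \<le> 2 * R \<Longrightarrow> \<bar>c n x - q n x\<bar> < 1 / real (Suc n)" by (metis mem_cball_0)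
  define \<psi> where "\<psi> n x = \<kappa> x * q n x" for n x
  have 1: "C1c (\<psi> n)" for n unfolding \<psi>_def \<kappa>_def
    by (rule C1c_bump_times_polynomial[OF q(1)]) (use R in simp)
  have 3: "\<psi> n x = 0" if "2 * R < norm x" for n x
  proof -
    have "1 < norm x / (2*R)" using R that by simp
    then have "1 \<le> (norm x / (2*R))\<^sup>2" by (intro one_le_power) auto
    then show ?thesis by (simp add: \<psi>_def \<kappa>_def)
  qed
  have 2: "\<bar>\<psi> n x\<bar> \<le> 2 * B + 1" for n x
  proof (cases "norm x \<le> 2 * R")
    case True
    have "1 / real (Suc n) \<le> 1" by simp
    then have "\<bar>q n x\<bar> \<le> 2 * B + 1" using q(2)[OF True, of n] c3[of n x] by linarith
    then have "\<kappa> x * \<bar>q n x\<bar> \<le> 1 * (2 * B + 1)" using \<kappa>01[of x] B0 by (intro mult_mono) auto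
    then show ?thesis using \<kappa>01[of x] by (simp add: \<psi>_def abs_mult)
  next
    case False then show ?thesis using 3[of x n] B0 by simp
  qed
  have "AE x in lebesgue. x \<notin> N"
    using N by (intro AE_not_in) (simp add: negligible_iff_null_sets)
  then have 4: "AE x in lebesgue. (\<lambda>n. \<psi> n x) \<longlonglongrightarrow> w x"
  proof eventually_elim
    case (elim x)
    show ?case
    proof (cases "norm x \<le> 2 * R")
      case True
      have "(\<lambda>n. c n x - q n x) \<longlonglongrightarrow> 0"
        using q(2)[OF True] by (intro Lim_null_comparison[OF always_eventually LIMSEQ_inverse_real_of_nat])
          (auto simp: inverse_eq_divide less_imp_le)
      from tendsto_diff[OF c2[OF elim] this] have "(\<lambda>n. q n x) \<longlonglongrightarrow> v x" by simp
      then have "(\<lambda>n. \<psi> n x) \<longlonglongrightarrow> \<kappa> x * v x" unfolding \<psi>_def by (intro tendsto_intros)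
      then show ?thesis by (simp add: vw)
    next
      case False
      then show ?thesis using 3[of x] supp[of x] R by simp
    qed
  qed
  show ?thesis by (rule that[OF 1 2 3 4]) auto
qed

subsection \<open>Translation estimates\<close>

lemma lborel_integral_shift:
  fixes f :: "'a::euclidean_space \<Rightarrow> 'b::{banach, second_countable_topology}"
  assumes "f \<in> borel_measurable borel"
  shows "(\<integral>x. f (c + x) \<partial>lborel) = (\<integral>x. f x \<partial>lborel)"
  using integral_distr[of "(+) c" lborel borel f] assms by (simp add: lborel_distr_plus)

lemma lborel_integrable_shift:
  fixes f :: "'a::euclidean_space \<Rightarrow> 'b::{banach, second_countable_topology}"
  assumes "integrable lborel f"
  shows "integrable lborel (\<lambda>x. f (c + x))"
  using assms by (intro integrable_distr[of "(+) c" lborel borel]) (simp_all add: lborel_distr_plus)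

lemma integrable_mult_bounded:
  fixes u f :: "'m \<Rightarrow> real"
  assumes "integrable M u" "f \<in> borel_measurable M" "\<And>x. \<bar>f x\<bar> \<le> B"
  shows "integrable M (\<lambda>x. u x * f x)"
proof (rule Bochner_Integration.integrable_bound[of M "\<lambda>x. B * u x"])
  show "AE x in M. norm (u x * f x) \<le> norm (B * u x)"
  proof (rule AE_I2)
    fix x
    have "\<bar>u x\<bar> * \<bar>f x\<bar> \<le> \<bar>u x\<bar> * \<bar>B\<bar>" using assms(3)[of x] by (intro mult_left_mono) auto
    then show "norm (u x * f x) \<le> norm (B * u x)" by (simp add: abs_mult mult.commute)
  qed
qed (use assms in auto)

lemma C1c_borel_measurable:
  assumes "C1c \<psi>"
  shows "\<psi> \<in> borel_measurable borel" "(\<lambda>x. frechet_derivative \<psi> (at x) h) \<in> borel_measurable borel"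
  using assms by (auto intro!: borel_measurable_continuous_onI C1c_continuous_on C1c_continuous_on_derivative)

text \<open>All differentiation falls on \<psi>. Its Lipschitz constant dominates the difference
  quotients by a multiple of \<open>\<bar>u x\<bar>\<close>, so the limit may be taken under the
  integral.\<close>

lemma DERIV_integral_C1c_shift:
  fixes u \<psi> :: "'a::euclidean_space \<Rightarrow> real"
  assumes u: "integrable lborel u" and \<psi>: "C1c \<psi>"
  shows "((\<lambda>s. \<integral>x. u x * \<psi> (x - s *\<^sub>R h) \<partial>lborel) has_real_derivative
     - (\<integral>x. u x * frechet_derivative \<psi> (at (x - s *\<^sub>R h)) h \<partial>lborel)) (at s)"
proof -
  let ?D = "\<lambda>x. frechet_derivative \<psi> (at x)"
  obtain B where B: "0 \<le> B" "\<And>x h. norm (?D x h) \<le> B * norm h" using C1c_derivative_bounded[OF \<psi>] by blast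
  obtain B' where B': "0 \<le> B'" "\<And>x. norm (\<psi> x) \<le> B'" using C1c_bounded[OF \<psi>] by blast
  have [measurable]: "\<psi> \<in> borel_measurable borel" "(\<lambda>x. ?D x h) \<in> borel_measurable borel"
    using C1c_borel_measurable[OF \<psi>] by auto
  have [measurable]: "u \<in> borel_measurable borel" using borel_measurable_integrable[OF u] by simp
  have int: "integrable lborel (\<lambda>x. u x * \<psi> (x - t *\<^sub>R h))" for t
    using B' by (intro integrable_mult_bounded[OF u]) auto
  let ?f = "\<lambda>s. \<integral>x. u x * \<psi> (x - s *\<^sub>R h) \<partial>lborel"
  have "(\<lambda>k. (?f (s + k) - ?f s) / k) \<midarrow>0\<rightarrow> - (\<integral>x. u x * ?D (x - s *\<^sub>R h) h \<partial>lborel)"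
  proof (subst tendsto_at_iff_sequentially, intro allI impI)
    fix X :: "nat \<Rightarrow> real" assume X: "\<forall>i. X i \<in> UNIV - {0}" "X \<longlonglongrightarrow> 0"
    let ?q = "\<lambda>i x. u x * ((\<psi> (x - (s + X i) *\<^sub>R h) - \<psi> (x - s *\<^sub>R h)) / X i)"
    have eq: "(?f (s + X i) - ?f s) / X i = (\<integral>x. ?q i x \<partial>lborel)" for i
      by (subst Bochner_Integration.integral_diff[symmetric, OF int int],
          subst integral_divide_zero[symmetric]) (simp add: right_diff_distrib)
    have "(\<lambda>i. \<integral>x. ?q i x \<partial>lborel) \<longlonglongrightarrow> (\<integral>x. u x * (- ?D (x - s *\<^sub>R h) h) \<partial>lborel)"
    proof (rule integral_dominated_convergence[where w = "\<lambda>x. \<bar>u x\<bar> * (B * norm h)"])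
      show "integrable lborel (\<lambda>x. \<bar>u x\<bar> * (B * norm h))" using u by simp
      show "AE x in lborel. norm (?q i x) \<le> \<bar>u x\<bar> * (B * norm h)" for i
      proof (rule AE_I2)
        fix x
        have "\<bar>\<psi> (x - (s + X i) *\<^sub>R h) - \<psi> (x - s *\<^sub>R h)\<bar> \<le> B * norm ((x - (s + X i) *\<^sub>R h) - (x - s *\<^sub>R h))"
          using C1c_lipschitz[OF \<psi> B] by (metis real_norm_def)
        also have "(x - (s + X i) *\<^sub>R h) - (x - s *\<^sub>R h) = - (X i *\<^sub>R h)" by (simp add: algebra_simps)
        finally have "\<bar>(\<psi> (x - (s + X i) *\<^sub>R h) - \<psi> (x - s *\<^sub>R h)) / X i\<bar> \<le> B * norm h"
          using X(1) by (simp add: abs_divide divide_le_eq mult.commute mult.left_commute)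
        then show "norm (?q i x) \<le> \<bar>u x\<bar> * (B * norm h)"
          unfolding real_norm_def abs_mult by (intro mult_left_mono) auto
      qed
      show "AE x in lborel. (\<lambda>i. ?q i x) \<longlonglongrightarrow> u x * (- ?D (x - s *\<^sub>R h) h)"
      proof (rule AE_I2)
        fix x
        have "((\<lambda>t. x - t *\<^sub>R h) has_derivative (\<lambda>k. - (k *\<^sub>R h))) (at s)"
          by (auto intro!: derivative_eq_intros)
        from has_derivative_compose[OF this C1c_has_derivative[OF \<psi>]]
        have "((\<lambda>t. \<psi> (x - t *\<^sub>R h)) has_derivative (\<lambda>k. ?D (x - s *\<^sub>R h) (- (k *\<^sub>R h)))) (at s)" .
        moreover have "linear (?D (x - s *\<^sub>R h))"
          using C1c_has_derivative[OF \<psi>] has_derivative_linear by blast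
        then have "(\<lambda>k. ?D (x - s *\<^sub>R h) (- (k *\<^sub>R h))) = (\<lambda>k. (- ?D (x - s *\<^sub>R h) h) * k)"
          by (simp add: linear_neg linear_scale mult.commute fun_eq_iff)
        ultimately have "((\<lambda>t. \<psi> (x - t *\<^sub>R h)) has_real_derivative - ?D (x - s *\<^sub>R h) h) (at s)"
          unfolding has_field_derivative_def by (simp only:)
        then have "((\<lambda>k. (\<psi> (x - (s + k) *\<^sub>R h) - \<psi> (x - s *\<^sub>R h)) / k) \<circ> X) \<longlonglongrightarrow> - ?D (x - s *\<^sub>R h) h"
          using X unfolding DERIV_def tendsto_at_iff_sequentially by blast
        then show "(\<lambda>i. ?q i x) \<longlonglongrightarrow> u x * (- ?D (x - s *\<^sub>R h) h)"
          by (intro tendsto_mult tendsto_const) (simp add: o_def)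
      qed
    qed auto
    then show "((\<lambda>k. (?f (s + k) - ?f s) / k) \<circ> X) \<longlonglongrightarrow> - (\<integral>x. u x * ?D (x - s *\<^sub>R h) h \<partial>lborel)"
      by (simp add: o_def eq)
  qed
  then show ?thesis by (simp add: DERIV_def)
qed

text \<open>Translating \<open>u\<close> amounts to translating \<psi> the other way, so the pairing
  is an increment over [0,1] of the function differentiated above. The mean value theorem gives its
  derivative at an unknown point, hence the bound is required for every \<open>s\<close>.\<close>

lemma integral_translation_difference_le:
  fixes u \<psi> :: "'a::euclidean_space \<Rightarrow> real"
  assumes u: "integrable lborel u" and \<psi>: "C1c \<psi>"
    and K: "\<And>s. \<bar>\<integral>x. u x * frechet_derivative \<psi> (at (x - s *\<^sub>R h)) h \<partial>lborel\<bar> \<le> K"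
  shows "\<bar>\<integral>x. (u (h + x) - u x) * \<psi> x \<partial>lborel\<bar> \<le> K"
proof -
  let ?f = "\<lambda>s. \<integral>x. u x * \<psi> (x - s *\<^sub>R h) \<partial>lborel"
  obtain B' where B': "0 \<le> B'" "\<And>x. norm (\<psi> x) \<le> B'" using C1c_bounded[OF \<psi>] by blast
  have [measurable]: "\<psi> \<in> borel_measurable borel" using C1c_borel_measurable[OF \<psi>] by auto
  have [measurable]: "u \<in> borel_measurable borel" using borel_measurable_integrable[OF u] by simp
  have int: "integrable lborel (\<lambda>x. u (h + x) * \<psi> x)" "integrable lborel (\<lambda>x. u x * \<psi> x)"
    using B' u by (auto intro!: integrable_mult_bounded lborel_integrable_shift)
  have "(\<integral>x. u (h + x) * \<psi> x \<partial>lborel) = ?f 1"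
    using lborel_integral_shift[of "\<lambda>x. u x * \<psi> (x - h)" h] by simp
  then have eq: "(\<integral>x. (u (h + x) - u x) * \<psi> x \<partial>lborel) = ?f 1 - ?f 0"
    using int by (simp add: left_diff_distrib)
  obtain z where "?f 1 - ?f 0 = (1 - 0) * - (\<integral>x. u x * frechet_derivative \<psi> (at (x - z *\<^sub>R h)) h \<partial>lborel)"
    using MVT2[of 0 1 ?f, OF _ DERIV_integral_C1c_shift[OF u \<psi>]] by auto
  then show ?thesis using K[of z] eq by simp
qed

text \<open>The derivative of the pairing along \<open>h\<close> is, up to a factor, the pairing of
  \<open>u\<close> with the divergence of a field of constant direction \<open>h\<close>, and such
  pairings are controlled by \<open>TV u\<close>.\<close>

lemma TV_translation_bound:
  fixes u :: "'a::euclidean_space \<Rightarrow> real"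
  assumes u: "integrable lborel u" and TV: "TV u \<le> ereal c" and \<psi>: "C1c \<psi>"
    and B: "\<And>x. \<bar>\<psi> x\<bar> \<le> B" and "0 < B"
  shows "\<bar>\<integral>x. (u (h + x) - u x) * \<psi> x \<partial>lborel\<bar> \<le> B * norm h * c"
proof (cases "h = 0")
  case True
  then show ?thesis by simp
next
  case False
  have um [measurable]: "u \<in> borel_measurable borel" using borel_measurable_integrable[OF u] by simp
  show ?thesis
  proof (rule integral_translation_difference_le[OF u \<psi>])
    fix s
    let ?\<psi> = "\<lambda>x. \<psi> (x - s *\<^sub>R h)"
    have \<psi>s: "C1c ?\<psi>" by (rule C1c_shift[OF \<psi>])
    let ?I = "\<integral>x. u x * frechet_derivative \<psi> (at (x - s *\<^sub>R h)) h \<partial>lborel"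
    have "\<sigma> * ?I \<le> B * norm h * c" if \<sigma>: "\<bar>\<sigma>\<bar> = 1" for \<sigma> :: real
    proof -
      \<comment> \<open>The scaling gives the field norm at most 1. Both signs \<sigma> are used
        because a supremum bounds each pairing only from above.\<close>
      define v where "v = (\<sigma> / (B * norm h)) *\<^sub>R h"
      have nv: "norm v = 1 / B" using False \<sigma> \<open>0 < B\<close> by (simp add: v_def)
      let ?\<phi> = "\<lambda>x. ?\<psi> x *\<^sub>R v"
      have "C1c ?\<phi>" by (rule C1c_scaleR_const[OF \<psi>s])
      moreover have "norm (?\<phi> x) \<le> 1" for x
        using B[of "x - s *\<^sub>R h"] \<open>0 < B\<close> by (simp add: nv)
      ultimately have "ereal (\<integral>x. u x * divergence ?\<phi> x \<partial>lebesgue) \<le> TV u"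
        unfolding TV_def by (intro SUP_upper) auto
      also have "\<dots> \<le> ereal c" by (rule TV)
      finally have le: "(\<integral>x. u x * divergence ?\<phi> x \<partial>lebesgue) \<le> c" by simp
      have lin: "linear (frechet_derivative \<psi> (at y))" for y
        using C1c_has_derivative[OF \<psi>] has_derivative_linear by blast
      have div: "divergence ?\<phi> x = (\<sigma> / (B * norm h)) * frechet_derivative \<psi> (at (x - s *\<^sub>R h)) h" for x
        unfolding divergence_scaleR_const[OF \<psi>s] C1c_shift(2)[OF \<psi>] v_def
        by (simp only: linear_scale[OF lin] real_scaleR_def)
      have "(\<integral>x. u x * divergence ?\<phi> x \<partial>lebesgue) = (\<integral>x. u x * divergence ?\<phi> x \<partial>lborel)"
        unfolding div using C1c_borel_measurable(2)[OF \<psi>s, of h]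
        by (intro integral_completion) (simp add: C1c_shift(2)[OF \<psi>])
      also have "\<dots> = (\<sigma> / (B * norm h)) * ?I"
        unfolding div by (subst integral_mult_right_zero[symmetric]) (simp add: mult_ac)
      finally have "\<sigma> * ?I = B * norm h * (\<integral>x. u x * divergence ?\<phi> x \<partial>lebesgue)"
        using False \<open>0 < B\<close> by simp
      then show ?thesis using le \<open>0 < B\<close> by (simp add: mult_left_mono)
    qed
    from this[of 1] this[of "-1"] show "\<bar>?I\<bar> \<le> B * norm h * c" by simp
  qed
qed

text \<open>Hoelder's inequality is replaced by a scaled Young inequality. The parameter
  \<open>t\<close> is left open so that it can later be tuned to absorb the term containing the test
  function.\<close>

lemma weak_grad_translation_bound:
  fixes u :: "'a::euclidean_space \<Rightarrow> real"
  assumes p: "1 < p" and u: "integrable lborel u" and wg: "weak_grad u g"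
    and [measurable]: "g \<in> borel_measurable borel"
    and gi: "integrable lborel (\<lambda>x. norm (g x) powr p)" and \<psi>: "C1c \<psi>" and t: "0 < t"
  shows "\<bar>\<integral>x. (u (h + x) - u x) * \<psi> x \<partial>lborel\<bar>
    \<le> norm h * (t powr p * (\<integral>x. norm (g x) powr p \<partial>lborel)
        + t powr (- (p / (p - 1))) * (\<integral>x. \<bar>\<psi> x\<bar> powr (p / (p - 1)) \<partial>lborel))"
proof (rule integral_translation_difference_le[OF u \<psi>])
  fix s
  have um [measurable]: "u \<in> borel_measurable borel" using borel_measurable_integrable[OF u] by simp
  let ?\<psi> = "\<lambda>x. \<psi> (x - s *\<^sub>R h)" and ?q = "p / (p - 1)"
  have \<psi>s: "C1c ?\<psi>" by (rule C1c_shift[OF \<psi>])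
  have [measurable]: "\<psi> \<in> borel_measurable borel" using C1c_borel_measurable[OF \<psi>] by auto
  have dm [measurable]: "(\<lambda>x. frechet_derivative ?\<psi> (at x) b) \<in> borel_measurable borel" for b
    using C1c_borel_measurable[OF \<psi>s] by auto
  obtain D where D: "\<And>x h. norm (frechet_derivative ?\<psi> (at x) h) \<le> D * norm h"
    by (rule C1c_derivative_bounded[OF \<psi>s]) blast
  have intu: "integrable lborel (\<lambda>x. u x * frechet_derivative ?\<psi> (at x) b)" for b
    using D[of _ b] by (intro integrable_mult_bounded[OF u, of _ "D * norm b"]) auto
  obtain R where R: "\<And>x. R < norm x \<Longrightarrow> \<psi> x = 0" using C1c_support[OF \<psi>] by metis
  obtain B where B: "0 \<le> B" "\<And>x. norm (\<psi> x) \<le> B" using C1c_bounded[OF \<psi>] by blast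
  have intq: "integrable lborel (\<lambda>x. \<bar>\<psi> x\<bar> powr ?q)"
  proof (rule Bochner_Integration.integrable_bound[of _ "\<lambda>x. indicator (cball 0 R) x * B powr ?q"])
    show "integrable lborel (\<lambda>x. indicator (cball 0 R) x * B powr ?q :: real)"
      by (intro integrable_mult_left integrable_real_indicator emeasure_bounded_finite) auto
    show "AE x in lborel. norm (\<bar>\<psi> x\<bar> powr ?q) \<le> norm (indicator (cball 0 R) x * B powr ?q)"
    proof (rule AE_I2)
      fix x
      show "norm (\<bar>\<psi> x\<bar> powr ?q) \<le> norm (indicator (cball 0 R) x * B powr ?q)"
        using R[of x] B(2)[of x] p by (cases "norm x \<le> R") (auto intro!: powr_mono2)
    qed
  qed auto
  have intqs: "integrable lborel (\<lambda>x. \<bar>?\<psi> x\<bar> powr ?q)"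
    using lborel_integrable_shift[OF intq, of "- (s *\<^sub>R h)"] by simp
  have eqq: "(\<integral>x. \<bar>?\<psi> x\<bar> powr ?q \<partial>lborel) = (\<integral>x. \<bar>\<psi> x\<bar> powr ?q \<partial>lborel)"
    using lborel_integral_shift[of "\<lambda>x. \<bar>\<psi> x\<bar> powr ?q" "- (s *\<^sub>R h)"] by simp
  \<comment> \<open>Young's inequality is applied to \<open>t * norm (g x)\<close> and
    \<open>\<bar>?\<psi> x\<bar> / t\<close>, whose product does not depend on
    \<open>t\<close>.\<close>
  have young: "\<bar>g x \<bullet> v\<bar> * \<bar>?\<psi> x\<bar> \<le> norm v * (t powr p * norm (g x) powr p + t powr (- ?q) * \<bar>?\<psi> x\<bar> powr ?q)" for x v
  proof -
    have "\<bar>g x \<bullet> v\<bar> * \<bar>?\<psi> x\<bar> \<le> norm (g x) * norm v * \<bar>?\<psi> x\<bar>"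
      by (intro mult_right_mono Cauchy_Schwarz_ineq2) auto
    also have "\<dots> = norm v * ((t * norm (g x)) * (\<bar>?\<psi> x\<bar> / t))" using t by simp
    also have "\<dots> \<le> norm v * ((t * norm (g x)) powr p + (\<bar>?\<psi> x\<bar> / t) powr ?q)"
      using t p by (intro mult_left_mono mult_le_powr_add) auto
    also have "(\<bar>?\<psi> x\<bar> / t) powr ?q = t powr (- ?q) * \<bar>?\<psi> x\<bar> powr ?q"
      using t by (simp add: powr_divide powr_minus field_simps)
    finally show ?thesis by (simp add: powr_mult)
  qed
  let ?M = "\<lambda>v x. norm v * (t powr p * norm (g x) powr p + t powr (- ?q) * \<bar>?\<psi> x\<bar> powr ?q)"
  have Mi: "integrable lborel (?M v)" for v :: 'a
    by (intro integrable_mult_right Bochner_Integration.integrable_add gi intqs)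
  have intg: "integrable lborel (\<lambda>x. (g x \<bullet> v) * ?\<psi> x)" for v
    by (rule Bochner_Integration.integrable_bound[OF Mi[of v]])
      (use young[of _ v] in \<open>auto simp: abs_mult intro!: AE_I2 order_trans[OF _ abs_ge_self]\<close>)
  have wgb: "(\<integral>x. u x * frechet_derivative ?\<psi> (at x) b \<partial>lborel) = - (\<integral>x. (g x \<bullet> b) * ?\<psi> x \<partial>lborel)"
    if "b \<in> Basis" for b
  proof -
    have "(\<integral>x. u x * frechet_derivative ?\<psi> (at x) b \<partial>lebesgue) = - (\<integral>x. (g x \<bullet> b) * ?\<psi> x \<partial>lebesgue)"
      using wg \<psi>s that unfolding weak_grad_def by blast
    then show ?thesis by (subst (asm) (1 2) integral_completion) auto
  qed
  \<comment> \<open>\<open>weak_grad\<close> speaks of coordinate directions only, so the derivative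
    along \<open>h\<close> is expanded in the basis and reassembled once the gradient has been
    inserted.\<close>
  have "(\<integral>x. u x * frechet_derivative \<psi> (at (x - s *\<^sub>R h)) h \<partial>lborel)
      = (\<integral>x. (\<Sum>b\<in>Basis. (h \<bullet> b) * (u x * frechet_derivative ?\<psi> (at x) b)) \<partial>lborel)"
    unfolding C1c_shift(2)[OF \<psi>, symmetric]
    by (subst C1c_derivative_expand[OF \<psi>s]) (simp add: sum_distrib_left mult_ac)
  also have "\<dots> = (\<Sum>b\<in>Basis. (h \<bullet> b) * (\<integral>x. u x * frechet_derivative ?\<psi> (at x) b \<partial>lborel))"
    using intu by (subst Bochner_Integration.integral_sum) auto
  also have "\<dots> = - (\<Sum>b\<in>Basis. (h \<bullet> b) * (\<integral>x. (g x \<bullet> b) * ?\<psi> x \<partial>lborel))"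
    by (simp add: wgb sum_negf)
  also have "(\<Sum>b\<in>Basis. (h \<bullet> b) * (\<integral>x. (g x \<bullet> b) * ?\<psi> x \<partial>lborel))
      = (\<integral>x. (\<Sum>b\<in>Basis. (h \<bullet> b) * ((g x \<bullet> b) * ?\<psi> x)) \<partial>lborel)"
    using intg by (subst Bochner_Integration.integral_sum) auto
  also have "\<dots> = (\<integral>x. (g x \<bullet> h) * ?\<psi> x \<partial>lborel)"
    by (subst (3) euclidean_inner) (simp add: sum_distrib_left sum_distrib_right mult_ac)
  finally have "\<bar>\<integral>x. u x * frechet_derivative \<psi> (at (x - s *\<^sub>R h)) h \<partial>lborel\<bar> = \<bar>\<integral>x. (g x \<bullet> h) * ?\<psi> x \<partial>lborel\<bar>"
    by simp
  also have "\<dots> \<le> (\<integral>x. \<bar>(g x \<bullet> h) * ?\<psi> x\<bar> \<partial>lborel)" by (rule integral_abs_bound)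
  also have "\<dots> \<le> (\<integral>x. ?M h x \<partial>lborel)"
    using young[of _ h] by (intro integral_mono[OF integrable_abs[OF intg] Mi]) (auto simp: abs_mult)
  also have "\<dots> = norm h * (t powr p * (\<integral>x. norm (g x) powr p \<partial>lborel)
      + t powr (- ?q) * (\<integral>x. \<bar>\<psi> x\<bar> powr ?q \<partial>lborel))"
    using gi intqs by (simp add: eqq)
  finally show "\<bar>\<integral>x. u x * frechet_derivative \<psi> (at (x - s *\<^sub>R h)) h \<partial>lborel\<bar>
    \<le> norm h * (t powr p * (\<integral>x. norm (g x) powr p \<partial>lborel) + t powr (- ?q) * (\<integral>x. \<bar>\<psi> x\<bar> powr ?q \<partial>lborel))" .
qed

lemma translation_difference_support:
  fixes u :: "'a::real_normed_vector \<Rightarrow> real"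
  assumes "\<And>x. R < norm x \<Longrightarrow> u x = 0" "norm h \<le> 1" "R + 1 < norm x"
  shows "u (h + x) - u x = 0"
proof -
  have "R < norm (h + x)" using assms(2,3) norm_diff_ineq[of x h] by (simp add: add.commute)
  then show ?thesis using assms by simp
qed

text \<open>Duality: the sign of the difference is approximated by test functions, and pairing with
  the sign gives the norm. The approximants are bounded by \<open>2 * 1 + 1\<close>, whence the
  factor 3.\<close>

lemma TV_translation_estimate:
  fixes u :: "'a::euclidean_space \<Rightarrow> real"
  assumes u: "integrable lborel u" and TV: "TV u \<le> ereal c" and R: "0 < R"
    and supp: "\<And>x. R < norm x \<Longrightarrow> u x = 0" and h: "norm h \<le> 1"
  shows "(\<integral>x. \<bar>u (h + x) - u x\<bar> \<partial>lborel) \<le> 3 * norm h * c"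
proof -
  have [measurable]: "u \<in> borel_measurable borel" using borel_measurable_integrable[OF u] by simp
  let ?d = "\<lambda>x. u (h + x) - u x"
  have di: "integrable lborel ?d"
    using u by (intro Bochner_Integration.integrable_diff lborel_integrable_shift)
  obtain \<psi> C where \<psi>: "\<And>n::nat. C1c (\<psi> n)" "\<And>n x. \<bar>\<psi> n x\<bar> \<le> C"
    "AE x in lebesgue. (\<lambda>n. \<psi> n x) \<longlonglongrightarrow> sgn (?d x)" "C \<le> 2 * 1 + 1"
  proof (rule C1c_approximation[of "\<lambda>x. sgn (?d x)" 1 "R + 1"])
    show "(\<lambda>x. sgn (?d x)) \<in> borel_measurable lebesgue" by (intro measurable_completion) measurable
    show "sgn (?d x) = 0" if "R + 1 < norm x" for x
      by (subst translation_difference_support[OF supp h that]) auto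
  qed (use R in \<open>auto simp: sgn_if\<close>)
  have [measurable]: "\<psi> n \<in> borel_measurable borel" for n by (rule C1c_borel_measurable[OF \<psi>(1)])
  have "(\<lambda>n. \<integral>x. ?d x * \<psi> n x \<partial>lborel) \<longlonglongrightarrow> (\<integral>x. ?d x * sgn (?d x) \<partial>lborel)"
  proof (rule integral_dominated_convergence[where w = "\<lambda>x. \<bar>?d x\<bar> * C"])
    show "AE x in lborel. (\<lambda>n. ?d x * \<psi> n x) \<longlonglongrightarrow> ?d x * sgn (?d x)"
      using \<psi>(3) unfolding AE_completion_iff by eventually_elim (intro tendsto_intros)
    show "AE x in lborel. norm (?d x * \<psi> n x) \<le> \<bar>?d x\<bar> * C" for n
      using \<psi>(2) by (intro AE_I2) (simp add: abs_mult mult_left_mono)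
  qed (use di in auto)
  moreover have "(\<integral>x. ?d x * \<psi> n x \<partial>lborel) \<le> 3 * norm h * c" for n
  proof -
    have "\<bar>\<psi> n x\<bar> \<le> 3" for x using \<psi>(2)[of n x] \<psi>(4) by linarith
    from TV_translation_bound[OF u TV \<psi>(1) this, where h = h] show ?thesis by (auto simp: abs_le_iff)
  qed
  ultimately have "(\<integral>x. ?d x * sgn (?d x) \<partial>lborel) \<le> 3 * norm h * c"
    by (meson LIMSEQ_le_const2)
  then show ?thesis by (simp add: abs_sgn mult.commute)
qed

text \<open>Testing with the signed power of order p - 1 of the difference makes the integral of its
  p-th power appear on both sides; a suitable Young parameter gives it the factor 1/2 on the right,
  where it is absorbed. Absorption needs a finite integral, so the difference is truncated at a
  level \<open>m\<close>. The resulting bound is free of \<open>m\<close>, and Fatou removes the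
  truncation.\<close>

lemma weak_grad_translation_estimate:
  fixes u :: "'a::euclidean_space \<Rightarrow> real"
  assumes p: "1 < p" and u: "integrable lborel u" and wg: "weak_grad u g"
    and gm: "g \<in> borel_measurable borel"
    and gi: "integrable lborel (\<lambda>x. norm (g x) powr p)" and gc: "(\<integral>x. norm (g x) powr p \<partial>lborel) \<le> c"
    and R: "0 < R" and supp: "\<And>x. R < norm x \<Longrightarrow> u x = 0" and h: "norm h \<le> 1"
  shows "(\<integral>\<^sup>+x. ennreal (\<bar>u (h + x) - u x\<bar> powr p) \<partial>lborel) \<le> ennreal (2 powr p * norm h powr p * c)"
proof (cases "h = 0")
  case True then show ?thesis using p by simp
next
  case False
  have [measurable]: "u \<in> borel_measurable borel" using borel_measurable_integrable[OF u] by simp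
  define d where "d x = u (h + x) - u x" for x
  have [measurable]: "d \<in> borel_measurable borel" unfolding d_def by measurable
  have di: "integrable lborel d" unfolding d_def
    using u by (intro Bochner_Integration.integrable_diff lborel_integrable_shift)
  have dsupp: "d x = 0" if "R + 1 < norm x" for x
    unfolding d_def using translation_difference_support[OF supp h that] .
  define q where "q = p / (p - 1)"
  have q: "q > 1" "(p - 1) * q = p" using p by (auto simp: q_def field_simps)
  have pq: "p / q = p - 1" using p by (simp add: q_def)
  \<comment> \<open>Large values are set to 0 instead of being clipped, so that
    \<open>d x * w x\<close> and \<open>\<bar>w x\<bar> powr q\<close> both equal
    \<open>\<bar>?e m x\<bar> powr p\<close> exactly.\<close>
  let ?e = "\<lambda>m x. if \<bar>d x\<bar> \<le> m then d x else 0"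
  have trunc: "(\<integral>x. \<bar>?e m x\<bar> powr p \<partial>lborel) \<le> 2 powr p * norm h powr p * c"
    and trunc_int: "integrable lborel (\<lambda>x. \<bar>?e m x\<bar> powr p)" if m: "0 < m" for m :: real
  proof -
    define w where "w x = sgn (d x) * \<bar>?e m x\<bar> powr (p - 1)" for x
    have [measurable]: "w \<in> borel_measurable borel" unfolding w_def by measurable
    have dw: "d x * w x = \<bar>?e m x\<bar> powr p" for x
      using p by (auto simp: w_def abs_sgn[symmetric] mult.assoc[symmetric] powr_mult_base)
    have wq: "\<bar>w x\<bar> powr q = \<bar>?e m x\<bar> powr p" for x
      using q by (auto simp: w_def abs_mult powr_powr sgn_if)
    obtain \<psi> C where \<psi>: "\<And>n::nat. C1c (\<psi> n)" "\<And>n x. \<bar>\<psi> n x\<bar> \<le> C" "\<And>n x. 2 * (R + 1) < norm x \<Longrightarrow> \<psi> n x = 0"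
      "AE x in lebesgue. (\<lambda>n. \<psi> n x) \<longlonglongrightarrow> w x"
    proof (rule C1c_approximation[of w "m powr (p - 1)" "R + 1"])
      show "w \<in> borel_measurable lebesgue" by (intro measurable_completion) measurable
      show "w x = 0" if "R + 1 < norm x" for x using dsupp[OF that] by (simp add: w_def)
      show "\<bar>w x\<bar> \<le> m powr (p - 1)" for x
        using p m by (auto simp: w_def abs_mult sgn_if intro!: powr_mono2)
    qed (use R in auto)
    have [measurable]: "\<psi> n \<in> borel_measurable borel" for n by (rule C1c_borel_measurable[OF \<psi>(1)])
    have C0: "0 \<le> C" using \<psi>(2)[of 0 0] by linarith
    have lim1: "(\<lambda>n. \<integral>x. d x * \<psi> n x \<partial>lborel) \<longlonglongrightarrow> (\<integral>x. d x * w x \<partial>lborel)"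
    proof (rule integral_dominated_convergence[where w = "\<lambda>x. \<bar>d x\<bar> * C"])
      show "AE x in lborel. (\<lambda>n. d x * \<psi> n x) \<longlonglongrightarrow> d x * w x"
        using \<psi>(4) unfolding AE_completion_iff by eventually_elim (intro tendsto_intros)
      show "AE x in lborel. norm (d x * \<psi> n x) \<le> \<bar>d x\<bar> * C" for n
        using \<psi>(2) by (intro AE_I2) (simp add: abs_mult mult_left_mono)
    qed (use di in auto)
    have ci: "integrable lborel (\<lambda>x::'a. indicator (cball 0 (2 * (R + 1))) x * C powr q)"
      by (intro integrable_mult_left integrable_real_indicator emeasure_bounded_finite) auto
    have psi_lim: "AE x in lborel. (\<lambda>n. \<bar>\<psi> n x\<bar> powr q) \<longlonglongrightarrow> \<bar>w x\<bar> powr q"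
      using \<psi>(4) unfolding AE_completion_iff
      by eventually_elim (use q tendsto_norm_powr[where p = q] in \<open>simp del: real_norm_def add: real_norm_def[symmetric]\<close>)
    have psi_bd: "AE x in lborel. norm (\<bar>\<psi> n x\<bar> powr q) \<le> indicator (cball 0 (2 * (R + 1))) x * C powr q" for n
    proof (rule AE_I2)
      fix x
      show "norm (\<bar>\<psi> n x\<bar> powr q) \<le> indicator (cball 0 (2 * (R + 1))) x * C powr q"
        using \<psi>(2)[of n x] \<psi>(3)[of x n] q by (cases "norm x \<le> 2 * (R + 1)") (auto intro!: powr_mono2)
    qed
    have lim2: "(\<lambda>n. \<integral>x. \<bar>\<psi> n x\<bar> powr q \<partial>lborel) \<longlonglongrightarrow> (\<integral>x. \<bar>w x\<bar> powr q \<partial>lborel)"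
      by (rule integral_dominated_convergence[OF _ _ ci psi_lim psi_bd]) auto
    have "integrable lborel (\<lambda>x. \<bar>w x\<bar> powr q)"
      by (rule integrable_dominated_convergence[OF _ _ ci psi_lim psi_bd]) auto
    then show "integrable lborel (\<lambda>x. \<bar>?e m x\<bar> powr p)" by (simp only: wq)
    \<comment> \<open>Chosen so that \<open>norm h * t powr (- q)\<close> is 1/2, the coefficient to
      be absorbed. Because p/q = p - 1, the other coefficient becomes
      \<open>2 powr (p - 1) * norm h powr p\<close>, and doubling it yields
      \<open>2 powr p\<close>.\<close>
    define t where "t = (2 * norm h) powr (1 / q)"
    have t: "t > 0" using False by (simp add: t_def)
    have tq: "norm h * t powr (- q) = 1 / 2"
      using False q by (simp add: t_def powr_powr powr_minus field_simps)
    have tp: "norm h * t powr p = 2 powr (p - 1) * norm h powr p"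
    proof -
      have "t powr p = 2 powr (p - 1) * norm h powr (p - 1)"
        unfolding t_def powr_powr using pq by (simp add: powr_mult)
      then show ?thesis using False by (simp add: powr_mult_base mult.left_commute)
    qed
    let ?G = "\<integral>x. norm (g x) powr p \<partial>lborel" and ?I = "\<integral>x. \<bar>?e m x\<bar> powr p \<partial>lborel"
    have "?I \<le> norm h * (t powr p * ?G + t powr (- q) * ?I)"
    proof (rule LIMSEQ_le)
      show "(\<lambda>n. \<integral>x. d x * \<psi> n x \<partial>lborel) \<longlonglongrightarrow> ?I" using lim1 by (simp only: dw)
      show "(\<lambda>n. norm h * (t powr p * ?G + t powr (- q) * (\<integral>x. \<bar>\<psi> n x\<bar> powr q \<partial>lborel)))
          \<longlonglongrightarrow> norm h * (t powr p * ?G + t powr (- q) * ?I)"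
        using lim2[unfolded wq] by (intro tendsto_intros)
      show "\<exists>N. \<forall>n\<ge>N. (\<integral>x. d x * \<psi> n x \<partial>lborel)
          \<le> norm h * (t powr p * ?G + t powr (- q) * (\<integral>x. \<bar>\<psi> n x\<bar> powr q \<partial>lborel))"
        using weak_grad_translation_bound[OF p u wg gm gi \<psi>(1) t, where h = h]
        unfolding d_def q_def by (auto simp: abs_le_iff)
    qed
    also have "\<dots> = (norm h * t powr p) * ?G + (norm h * t powr (- q)) * ?I" by (simp add: algebra_simps)
    also have "\<dots> = 2 powr (p - 1) * norm h powr p * ?G + ?I / 2" by (simp only: tq tp)
    finally have "?I \<le> 2 * 2 powr (p - 1) * norm h powr p * ?G" by simp
    also have "2 * 2 powr (p - 1) = (2::real) powr p" by (simp add: powr_mult_base)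
    also have "2 powr p * norm h powr p * ?G \<le> 2 powr p * norm h powr p * c"
      by (intro mult_left_mono gc) simp
    finally show "?I \<le> 2 powr p * norm h powr p * c" .
  qed
  have "(\<integral>\<^sup>+x. ennreal (norm (d x) powr p) \<partial>lborel) \<le> ennreal (2 powr p * norm h powr p * c)"
  proof (rule nn_integral_powr_Fatou[where f = "\<lambda>n. ?e (real (Suc n))" and c = "\<lambda>_. ennreal (2 powr p * norm h powr p * c)"])
    show "AE x in lborel. (\<lambda>n. ?e (real (Suc n)) x) \<longlonglongrightarrow> d x"
    proof (rule AE_I2)
      fix x
      obtain N where N: "\<bar>d x\<bar> \<le> real N" using real_arch_simple by blast
      have "eventually (\<lambda>n. ?e (real (Suc n)) x = d x) sequentially"
        using eventually_ge_at_top[of N] by eventually_elim (use N in auto)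
      then show "(\<lambda>n. ?e (real (Suc n)) x) \<longlonglongrightarrow> d x" by (rule tendsto_eventually)
    qed
    fix n
    have "(\<integral>\<^sup>+x. ennreal (norm (?e (real (Suc n)) x) powr p) \<partial>lborel)
        = ennreal (\<integral>x. \<bar>?e (real (Suc n)) x\<bar> powr p \<partial>lborel)"
      unfolding real_norm_def by (intro nn_integral_eq_integral trunc_int) auto
    also have "\<dots> \<le> ennreal (2 powr p * norm h powr p * c)"
      using trunc[of "real (Suc n)"] by (intro ennreal_leI) simp
    finally show "(\<integral>\<^sup>+x. ennreal (norm (?e (real (Suc n)) x) powr p) \<partial>lborel)
        \<le> ennreal (2 powr p * norm h powr p * c)" .
  qed (use p in auto)
  then show ?thesis by (simp add: d_def)
qed

subsection \<open>Compactness of Kolmogorov--Riesz type\<close>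

text \<open>Jensen's inequality, obtained by integrating the tangent inequality at the modulus
  \<open>m\<close> of the mean: the terms in \<open>m powr p\<close> combine and leave exactly
  \<open>m powr p * V\<close>. An infinite right-hand side is treated apart.\<close>

lemma powr_mean_le_nn_integral:
  fixes f :: "'m \<Rightarrow> real"
  assumes p: "1 \<le> p" and S: "S \<in> sets M" and V: "emeasure M S = ennreal V" "0 < V"
    and f: "integrable M (\<lambda>x. indicator S x * f x)"
  shows "ennreal (\<bar>(\<integral>x. indicator S x * f x \<partial>M) / V\<bar> powr p)
    \<le> ennreal (1 / V) * (\<integral>\<^sup>+x. ennreal (\<bar>indicator S x * f x\<bar> powr p) \<partial>M)"
proof (cases "(\<integral>\<^sup>+x. ennreal (\<bar>indicator S x * f x\<bar> powr p) \<partial>M) = \<infinity>")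
  case True
  then show ?thesis using V by (simp add: ennreal_mult_top)
next
  case False
  let ?g = "\<lambda>x. \<bar>indicator S x * f x\<bar>"
  have gm [measurable]: "?g \<in> borel_measurable M" using f by auto
  have gp: "integrable M (\<lambda>x. ?g x powr p)"
    using False by (intro integrableI_bounded) (auto simp: top.not_eq_extremum)
  have Si: "integrable M (indicator S :: _ \<Rightarrow> real)" using S V by (intro integrable_real_indicator) auto
  have mS: "measure M S = V" using V by (simp add: measure_def)
  define m where "m = \<bar>(\<integral>x. indicator S x * f x \<partial>M) / V\<bar>"
  have m0: "m \<ge> 0" by (simp add: m_def)
  have "V * m \<le> (\<integral>x. ?g x \<partial>M)"
    using V(2) integral_abs_bound[of M "\<lambda>x. indicator S x * f x"] by (simp add: m_def abs_divide)
  then have "p * (m powr (p - 1) * (V * m)) \<le> p * (m powr (p - 1) * (\<integral>x. ?g x \<partial>M))"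
    using p by (intro mult_left_mono) auto
  also have "\<dots> = (\<integral>x. p * (m powr (p - 1) * ?g x) \<partial>M)" by simp
  also have "\<dots> \<le> (\<integral>x. ?g x powr p + ((p - 1) * m powr p) * indicator S x \<partial>M)"
  proof (rule integral_mono)
    show "integrable M (\<lambda>x. p * (m powr (p - 1) * ?g x))" using f by simp
    show "integrable M (\<lambda>x. ?g x powr p + ((p - 1) * m powr p) * indicator S x)"
      using gp Si by simp
    show "p * (m powr (p - 1) * ?g x) \<le> ?g x powr p + ((p - 1) * m powr p) * indicator S x" for x
      using powr_tangent_le[of "?g x" m p] m0 p by (cases "x \<in> S") auto
  qed
  also have "\<dots> = (\<integral>x. ?g x powr p \<partial>M) + (p - 1) * m powr p * V"
    using gp Si S mS by (simp add: Int_absorb1 sets.sets_into_space)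
  finally have "p * (m powr (p - 1) * m) * V \<le> (\<integral>x. ?g x powr p \<partial>M) + (p - 1) * m powr p * V"
    by (simp add: mult_ac)
  moreover have "m powr (p - 1) * m = m powr p"
    using m0 by (cases "m = 0") (auto simp: powr_mult_base mult.commute)
  ultimately have "p * m powr p * V \<le> (\<integral>x. ?g x powr p \<partial>M) + (p - 1) * m powr p * V" by (simp only:)
  then have "m powr p * V \<le> (\<integral>x. ?g x powr p \<partial>M)" by (simp add: algebra_simps)
  then have "m powr p \<le> (1 / V) * (\<integral>x. ?g x powr p \<partial>M)" using V(2) by (simp add: field_simps)
  then have "ennreal (m powr p) \<le> ennreal ((1 / V) * (\<integral>x. ?g x powr p \<partial>M))" by (rule ennreal_leI)
  also have "\<dots> = ennreal (1 / V) * ennreal (\<integral>x. ?g x powr p \<partial>M)"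
    using V(2) by (intro ennreal_mult) auto
  also have "ennreal (\<integral>x. ?g x powr p \<partial>M) = (\<integral>\<^sup>+x. ennreal (?g x powr p) \<partial>M)"
    by (rule nn_integral_eq_integral[symmetric, OF gp]) auto
  finally show ?thesis by (simp add: m_def)
qed

text \<open>Averaging over small balls moves each \<open>u k\<close> by little in the mean, uniformly in \<open>k\<close>; the averages
  themselves are equicontinuous, so the theorem of Arzela and Ascoli applies to them.\<close>

theorem translation_bound_imp_Cauchy_subsequence:
  fixes u :: "nat \<Rightarrow> 'a::euclidean_space \<Rightarrow> real"
  assumes p: "1 \<le> p" and um [measurable]: "\<And>k. u k \<in> borel_measurable borel"
    and R: "0 < R" and supp: "\<And>k x. R < norm x \<Longrightarrow> u k x = 0"
    and bd: "\<And>k. (\<integral>\<^sup>+x. ennreal (\<bar>u k x\<bar> powr p) \<partial>lborel) \<le> ennreal C" and C: "0 \<le> C"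
    and tr: "\<And>k h. norm h \<le> 1 \<Longrightarrow>
      (\<integral>\<^sup>+x. ennreal (\<bar>u k (h + x) - u k x\<bar> powr p) \<partial>lborel) \<le> ennreal (K * norm h powr p)"
    and K: "0 \<le> K"
  obtains r :: "nat \<Rightarrow> nat" where "strict_mono r" "\<And>e. 0 < e \<Longrightarrow> \<exists>N. \<forall>m\<ge>N. \<forall>n\<ge>N.
      (\<integral>\<^sup>+x. ennreal (norm (u (r m) x - u (r n) x) powr p) \<partial>lborel) \<le> ennreal e"
proof -
  \<comment> \<open>Averages over balls of radius at most 1, and translates by vectors of norm at
    most 1, of functions vanishing outside radius \<open>R\<close> vanish outside radius
    \<open>R + 1\<close>.\<close>
  define S :: "'a set" where "S = cball 0 (R + 1)"
  define W where "W = measure lborel S"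
  have Sm [measurable]: "S \<in> sets borel" by (simp add: S_def)
  have Sfin: "emeasure lborel S < \<infinity>" unfolding S_def by (intro emeasure_bounded_finite) auto
  have WS: "emeasure lborel S = ennreal W" unfolding W_def
    using Sfin by (intro emeasure_eq_ennreal_measure) (auto simp: less_top)
  have W: "0 < W"
    unfolding W_def S_def using R content_cball_pos[of "R + 1" "0::'a"] by simp
  have Si: "integrable lborel (indicator S :: 'a \<Rightarrow> real)"
    using Sfin by (intro integrable_real_indicator) auto
  have upi: "integrable lborel (\<lambda>x. \<bar>u k x\<bar> powr p)" for k
    using bd[of k] by (intro integrableI_bounded) (auto simp: le_less_trans[OF _ ennreal_less_top])
  have up_le: "(\<integral>x. \<bar>u k x\<bar> powr p \<partial>lborel) \<le> C" for k
    using bd[of k] nn_integral_eq_integral[OF upi[of k]] C by simp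
  have ule: "\<bar>u k x\<bar> \<le> indicator S x + \<bar>u k x\<bar> powr p" for k x
    using le_add_powr[of "\<bar>u k x\<bar>" 1 p] p supp[of x k] by (auto simp: S_def indicator_def)
  have ui: "integrable lborel (u k)" for k
    by (rule Bochner_Integration.integrable_bound[OF Bochner_Integration.integrable_add[OF Si upi[of k]]])
      (use ule in \<open>auto intro!: order_trans[OF _ abs_ge_self]\<close>)
  have u1: "(\<integral>x. \<bar>u k x\<bar> \<partial>lborel) \<le> W + C" for k
  proof -
    have "(\<integral>x. \<bar>u k x\<bar> \<partial>lborel) \<le> (\<integral>x. indicator S x + \<bar>u k x\<bar> powr p \<partial>lborel)"
      by (intro integral_mono Bochner_Integration.integrable_add Si upi ule integrable_abs ui)
    also have "\<dots> = W + (\<integral>x. \<bar>u k x\<bar> powr p \<partial>lborel)"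
      using Si upi by (simp add: W_def)
    finally show ?thesis using up_le[of k] by linarith
  qed
  let ?d = "\<lambda>k h x. u k (h + x) - u k x"
  have di: "integrable lborel (?d k h)" for k h
    by (intro Bochner_Integration.integrable_diff lborel_integrable_shift ui)
  have L1: "\<exists>\<delta>>0. \<forall>k h. norm h < \<delta> \<longrightarrow> (\<integral>x. \<bar>?d k h x\<bar> \<partial>lborel) < e" if e: "0 < e" for e
  proof -
    \<comment> \<open>The threshold \<eta> spends e/3 on the set \<open>S\<close>; the radius
      \<delta> is then chosen so that the remaining p-th power term costs at most another
      e/3.\<close>
    define \<eta> where "\<eta> = e / (3 * W)"
    have \<eta>: "\<eta> > 0" using e W by (simp add: \<eta>_def)
    define c where "c = \<eta> powr (1 - p) * K"
    have c: "c \<ge> 0" using K by (simp add: c_def)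
    define \<delta> where "\<delta> = min 1 (e / (3 * (c + 1)))"
    have \<delta>: "\<delta> > 0" "\<delta> \<le> 1" using e c by (auto simp: \<delta>_def)
    have "(\<integral>x. \<bar>?d k h x\<bar> \<partial>lborel) < e" if h: "norm h < \<delta>" for k h
    proof -
      have h1: "norm h \<le> 1" using h \<delta> by linarith
      have fin: "(\<integral>\<^sup>+x. ennreal (\<bar>?d k h x\<bar> powr p) \<partial>lborel) < \<infinity>"
        using tr[OF h1, of k] by (simp add: le_less_trans[OF _ ennreal_less_top])
      have dpi: "integrable lborel (\<lambda>x. \<bar>?d k h x\<bar> powr p)"
        using fin by (intro integrableI_bounded) auto
      have dp: "(\<integral>x. \<bar>?d k h x\<bar> powr p \<partial>lborel) \<le> K * norm h powr p"
        using tr[OF h1, of k] nn_integral_eq_integral[OF dpi] K by simp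
      have le: "\<bar>?d k h x\<bar> \<le> \<eta> * indicator S x + \<eta> powr (1 - p) * \<bar>?d k h x\<bar> powr p" for x
        using le_add_powr[of "\<bar>?d k h x\<bar>" \<eta> p] p \<eta> translation_difference_support[where u = "u k" and x = x, OF supp h1]
        by (cases "x \<in> S") (auto simp: S_def)
      have "(\<integral>x. \<bar>?d k h x\<bar> \<partial>lborel) \<le> (\<integral>x. \<eta> * indicator S x + \<eta> powr (1 - p) * \<bar>?d k h x\<bar> powr p \<partial>lborel)"
        using Si dpi by (intro integral_mono Bochner_Integration.integrable_add le integrable_abs di integrable_mult_right)
      also have "\<dots> = \<eta> * W + \<eta> powr (1 - p) * (\<integral>x. \<bar>?d k h x\<bar> powr p \<partial>lborel)"
        using Si dpi by (simp add: W_def)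
      also have "\<dots> \<le> \<eta> * W + \<eta> powr (1 - p) * (K * norm h powr p)"
        by (intro add_left_mono mult_left_mono dp) simp
      also have "\<dots> = e / 3 + c * norm h powr p" using W by (simp add: \<eta>_def c_def)
      also have "c * norm h powr p \<le> (c + 1) * \<delta>"
      proof (rule mult_mono)
        have "norm h powr p \<le> norm h powr 1" using p h1 by (intro powr_mono') auto
        then show "norm h powr p \<le> \<delta>" using h by simp
      qed (use c in auto)
      also have "(c + 1) * \<delta> \<le> e / 3"
      proof -
        have "(c + 1) * \<delta> \<le> (c + 1) * (e / (3 * (c + 1)))" using c by (intro mult_left_mono) (auto simp: \<delta>_def)
        also have "\<dots> = e / 3" using c by (simp add: field_simps)
        finally show ?thesis .
      qed
      finally show ?thesis using e by linarith
    qed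
    then show ?thesis using \<delta> by blast
  qed
  define \<epsilon> where "\<epsilon> n = 1 / real (Suc n)" for n
  have \<epsilon>: "0 < \<epsilon> n" "\<epsilon> n \<le> 1" for n by (auto simp: \<epsilon>_def)
  define V where "V n = measure lborel (ball (0::'a) (\<epsilon> n))" for n
  have V: "0 < V n" for n unfolding V_def using content_ball_pos[of "\<epsilon> n" "0::'a"] \<epsilon>(1)[of n] by simp
  have EV: "emeasure lborel (ball (0::'a) (\<epsilon> n)) = ennreal (V n)" for n unfolding V_def
    using emeasure_bounded_finite[of "ball (0::'a) (\<epsilon> n)"] by (intro emeasure_eq_ennreal_measure) auto
  let ?b = "\<lambda>n h. indicator (ball (0::'a) (\<epsilon> n)) h :: real"
  define A where "A n k x = (\<integral>h. ?b n h * u k (h + x) \<partial>lborel) / V n" for n k x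
  have us: "integrable lborel (\<lambda>h. u k (h + x))" for k x
    using lborel_integrable_shift[OF ui[of k], of x] by (simp add: add.commute)
  have bi: "integrable lborel (\<lambda>h. ?b n h * f h)" if "integrable lborel f" for n f
    using integrable_mult_bounded[OF that, of "?b n" 1] by (simp add: mult.commute indicator_def)
  have bconst: "integrable lborel (\<lambda>h. ?b n h * c)" for n c
    using EV[of n] by (intro integrable_mult_left integrable_real_indicator) auto
  have [measurable]: "ball (0::'a) (\<epsilon> n) \<in> sets borel" for n by simp
  have shift_meas [measurable]: "(\<lambda>(x, h). u k (h + x)) \<in> borel_measurable (borel \<Otimes>\<^sub>M borel)" for k
    by measurable
  have "(\<lambda>x. \<integral>h. ?b n h * u k (h + x) \<partial>lborel) \<in> borel_measurable borel" for n k
    by (rule lborel.borel_measurable_lebesgue_integral) measurable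
  then have Am [measurable]: "A n k \<in> borel_measurable borel" for n k unfolding A_def by simp
  have A_diff: "A n k x - u k x = (\<integral>h. ?b n h * ?d k h x \<partial>lborel) / V n" for n k x
  proof -
    have "(\<integral>h. ?b n h * ?d k h x \<partial>lborel) = (\<integral>h. ?b n h * u k (h + x) \<partial>lborel) - (\<integral>h. ?b n h * u k x \<partial>lborel)"
      by (simp only: right_diff_distrib Bochner_Integration.integral_diff[OF bi[OF us] bconst])
    also have "(\<integral>h. ?b n h * u k x \<partial>lborel) = V n * u k x" by (simp add: V_def)
    finally show ?thesis using V[of n] by (simp add: A_def diff_divide_distrib)
  qed
  \<comment> \<open>The deviation of an average is the average of translation differences. Jensen
    moves the power inside, and after exchanging the integrals the bound \<open>tr\<close> applies
    to each \<open>h\<close> of the ball.\<close>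
  have A_close: "(\<integral>\<^sup>+x. ennreal (\<bar>A n k x - u k x\<bar> powr p) \<partial>lborel) \<le> ennreal (K * \<epsilon> n powr p)" for n k
  proof -
    have "(\<integral>\<^sup>+x. ennreal (\<bar>A n k x - u k x\<bar> powr p) \<partial>lborel)
      \<le> (\<integral>\<^sup>+x. ennreal (1 / V n) * (\<integral>\<^sup>+h. ennreal (\<bar>?b n h * ?d k h x\<bar> powr p) \<partial>lborel) \<partial>lborel)"
      unfolding A_diff
      by (intro nn_integral_mono powr_mean_le_nn_integral p EV V)
        (auto simp only: right_diff_distrib intro!: Bochner_Integration.integrable_diff bi us bconst, auto)
    also have "\<dots> = ennreal (1 / V n) * (\<integral>\<^sup>+x. (\<integral>\<^sup>+h. ennreal (\<bar>?b n h * ?d k h x\<bar> powr p) \<partial>lborel) \<partial>lborel)"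
      by (intro nn_integral_cmult) measurable
    also have "(\<integral>\<^sup>+x. (\<integral>\<^sup>+h. ennreal (\<bar>?b n h * ?d k h x\<bar> powr p) \<partial>lborel) \<partial>lborel)
       = (\<integral>\<^sup>+h. (\<integral>\<^sup>+x. ennreal (\<bar>?b n h * ?d k h x\<bar> powr p) \<partial>lborel) \<partial>lborel)"
      by (rule lborel_pair.Fubini') measurable
    also have "\<dots> \<le> (\<integral>\<^sup>+h. ennreal (K * \<epsilon> n powr p) * indicator (ball (0::'a) (\<epsilon> n)) h \<partial>lborel)"
    proof (rule nn_integral_mono)
      fix h :: 'a
      show "(\<integral>\<^sup>+x. ennreal (\<bar>?b n h * ?d k h x\<bar> powr p) \<partial>lborel)
        \<le> ennreal (K * \<epsilon> n powr p) * indicator (ball (0::'a) (\<epsilon> n)) h"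
      proof (cases "h \<in> ball 0 (\<epsilon> n)")
        case True
        then have "norm h \<le> 1" "norm h \<le> \<epsilon> n" using \<epsilon>[of n] by auto
        then have "(\<integral>\<^sup>+x. ennreal (\<bar>?d k h x\<bar> powr p) \<partial>lborel) \<le> ennreal (K * \<epsilon> n powr p)"
          using K p by (intro order_trans[OF tr] ennreal_leI mult_left_mono powr_mono2) auto
        then show ?thesis using True by simp
      qed (use p in simp)
    qed
    also have "\<dots> = ennreal (K * \<epsilon> n powr p) * ennreal (V n)"
      by (simp add: nn_integral_cmult_indicator EV)
    also have "ennreal (1 / V n) * \<dots> = ennreal (K * \<epsilon> n powr p)"
      using V[of n] K by (simp add: ennreal_mult[symmetric])
    finally show ?thesis by (simp add: mult_left_mono)
  qed
  have A_bound: "\<bar>A n k x\<bar> \<le> (W + C) / V n" for n k x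
  proof -
    have "\<bar>\<integral>h. ?b n h * u k (h + x) \<partial>lborel\<bar> \<le> (\<integral>h. \<bar>?b n h * u k (h + x)\<bar> \<partial>lborel)"
      by (rule integral_abs_bound)
    also have "\<dots> \<le> (\<integral>h. \<bar>u k (h + x)\<bar> \<partial>lborel)"
      by (intro integral_mono integrable_abs bi us) (auto simp: indicator_def)
    also have "\<dots> = (\<integral>h. \<bar>u k h\<bar> \<partial>lborel)"
      using lborel_integral_shift[of "\<lambda>h. \<bar>u k h\<bar>" x] by (simp add: add.commute)
    also have "\<dots> \<le> W + C" by (rule u1)
    finally show ?thesis using V[of n] by (simp add: A_def abs_divide divide_right_mono)
  qed
  \<comment> \<open>Oscillation of the averages is controlled by translations in the first mean.
    Dividing by \<open>V n\<close> spoils uniformity in \<open>n\<close> but not in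
    \<open>k\<close>, so Arzela-Ascoli is applied to each \<open>n\<close> separately.\<close>
  have A_lip: "\<bar>A n k x - A n k y\<bar> \<le> (\<integral>z. \<bar>?d k (x - y) z\<bar> \<partial>lborel) / V n" for n k x y
  proof -
    have "A n k x - A n k y = (\<integral>h. ?b n h * (u k (h + x) - u k (h + y)) \<partial>lborel) / V n"
      unfolding A_def right_diff_distrib Bochner_Integration.integral_diff[OF bi[OF us] bi[OF us]]
      by (simp add: diff_divide_distrib)
    moreover have "\<bar>\<integral>h. ?b n h * (u k (h + x) - u k (h + y)) \<partial>lborel\<bar> \<le> (\<integral>z. \<bar>?d k (x - y) z\<bar> \<partial>lborel)"
    proof -
      have "\<bar>\<integral>h. ?b n h * (u k (h + x) - u k (h + y)) \<partial>lborel\<bar>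
          \<le> (\<integral>h. \<bar>?b n h * (u k (h + x) - u k (h + y))\<bar> \<partial>lborel)"
        by (rule integral_abs_bound)
      also have "\<dots> \<le> (\<integral>h. \<bar>u k (h + x) - u k (h + y)\<bar> \<partial>lborel)"
        by (intro integral_mono integrable_abs bi Bochner_Integration.integrable_diff us) (auto simp: indicator_def)
      also have "\<dots> = (\<integral>z. \<bar>?d k (x - y) z\<bar> \<partial>lborel)"
        using lborel_integral_shift[of "\<lambda>z. \<bar>?d k (x - y) z\<bar>" y] by (simp add: add.commute)
      finally show ?thesis .
    qed
    ultimately show ?thesis using V[of n] by (simp add: abs_divide divide_right_mono)
  qed
  have A_supp: "A n k x = 0" if "x \<notin> S" for n k x
  proof -
    have "?b n h * u k (h + x) = 0" for h
    proof (cases "h \<in> ball 0 (\<epsilon> n)")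
      case True
      then have "norm h \<le> 1" using \<epsilon>[of n] by auto
      then have "R < norm (h + x)" using that norm_diff_ineq[of x h] by (simp add: S_def add.commute)
      then show ?thesis using supp by simp
    qed simp
    then show ?thesis unfolding A_def by (simp only:) simp
  qed
  \<comment> \<open>A uniform Cauchy condition instead of uniform convergence: it passes to
    subsequences without naming a limit, as the diagonal argument requires.\<close>
  define P where "P n s \<longleftrightarrow> (\<forall>e>0. \<exists>N. \<forall>i\<ge>N. \<forall>j\<ge>N. \<forall>x\<in>S. \<bar>A n (s i) x - A n (s j) x\<bar> < e)"
    for n and s :: "nat \<Rightarrow> nat"
  interpret subseqs P
  proof
    fix n and s :: "nat \<Rightarrow> nat"
    obtain g and k :: "nat \<Rightarrow> nat" where k: "strict_mono k"
      "\<And>e. 0 < e \<Longrightarrow> \<exists>N. \<forall>i x. N \<le> i \<and> x \<in> S \<longrightarrow> norm (A n (s (k i)) x - g x) < e"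
    proof (rule Arzela_Ascoli[of S "\<lambda>i. A n (s i)" "(W + C) / V n"])
      show "compact S" by (simp add: S_def)
      show "norm (A n (s i) x) \<le> (W + C) / V n" for i x using A_bound by simp
      fix x :: 'a and e :: real assume "0 < e"
      then obtain \<delta> where \<delta>: "\<delta> > 0" "\<And>k h. norm h < \<delta> \<Longrightarrow> (\<integral>x. \<bar>?d k h x\<bar> \<partial>lborel) < e * V n"
        using L1[of "e * V n"] V[of n] by auto
      have "norm (A n (s i) x - A n (s i) y) < e" if "norm (x - y) < \<delta>" for i y
      proof -
        have "norm (A n (s i) x - A n (s i) y) \<le> (\<integral>z. \<bar>?d (s i) (x - y) z\<bar> \<partial>lborel) / V n"
          using A_lip by simp
        also have "\<dots> < e" using \<delta>(2)[OF that] V[of n] by (simp add: divide_less_eq)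
        finally show ?thesis .
      qed
      then show "\<exists>d>0. \<forall>i y. y \<in> S \<and> norm (x - y) < d \<longrightarrow> norm (A n (s i) x - A n (s i) y) < e"
        using \<delta>(1) by blast
    qed blast
    have "P n (s \<circ> k)" unfolding P_def
    proof (intro allI impI)
      fix e :: real assume "0 < e"
      then obtain N where N: "\<And>i x. N \<le> i \<Longrightarrow> x \<in> S \<Longrightarrow> norm (A n (s (k i)) x - g x) < e / 2"
        using k(2)[of "e / 2"] by auto
      have "\<bar>A n ((s \<circ> k) i) x - A n ((s \<circ> k) j) x\<bar> < e" if "i \<ge> N" "j \<ge> N" "x \<in> S" for i j x
        using N[OF that(1,3)] N[OF that(2,3)] unfolding o_def real_norm_def by linarith
      then show "\<exists>N. \<forall>i\<ge>N. \<forall>j\<ge>N. \<forall>x\<in>S. \<bar>A n ((s \<circ> k) i) x - A n ((s \<circ> k) j) x\<bar> < e" by blast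
    qed
    then show "\<exists>r'. strict_mono r' \<and> P n (s \<circ> r')" using k(1) by blast
  qed
  define r where "r = diagseq"
  have r: "strict_mono r" unfolding r_def by (rule subseq_diagseq)
  have Pr: "\<exists>N. \<forall>i\<ge>N. \<forall>j\<ge>N. \<forall>x\<in>S. \<bar>A n (r i) x - A n (r j) x\<bar> < e" if e: "0 < e" for n e
  proof -
    \<comment> \<open>The diagonal sequence is certain to inherit the \<open>n\<close>-th property
      only from index \<open>Suc n\<close> on; the shift is undone below by enlarging
      \<open>N\<close>.\<close>
    have "P n (diagseq \<circ> (+) (Suc n))"
    proof (rule diagseq_holds)
      fix r s :: "nat \<Rightarrow> nat" and n assume rs: "strict_mono r" "P n s"
      show "P n (s \<circ> r)" unfolding P_def
      proof (intro allI impI)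
        fix e :: real assume "0 < e"
        then obtain N where N: "\<And>i j x. i \<ge> N \<Longrightarrow> j \<ge> N \<Longrightarrow> x \<in> S \<Longrightarrow> \<bar>A n (s i) x - A n (s j) x\<bar> < e"
          using rs(2) unfolding P_def by blast
        have "r i \<ge> N" if "i \<ge> N" for i using seq_suble[OF rs(1), of i] that by linarith
        then show "\<exists>N. \<forall>i\<ge>N. \<forall>j\<ge>N. \<forall>x\<in>S. \<bar>A n ((s \<circ> r) i) x - A n ((s \<circ> r) j) x\<bar> < e"
          using N by (intro exI[of _ N]) simp
      qed
    qed
    then obtain N where N: "\<And>i j x. i \<ge> N \<Longrightarrow> j \<ge> N \<Longrightarrow> x \<in> S \<Longrightarrow>
        \<bar>A n (r (Suc n + i)) x - A n (r (Suc n + j)) x\<bar> < e"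
      unfolding P_def r_def o_def using e by blast
    have "\<bar>A n (r i) x - A n (r j) x\<bar> < e" if "i \<ge> Suc n + N" "j \<ge> Suc n + N" "x \<in> S" for i j x
      using N[of "i - Suc n" "j - Suc n" x] that by auto
    then show ?thesis by blast
  qed
  have main: "\<exists>N. \<forall>i\<ge>N. \<forall>j\<ge>N. (\<integral>\<^sup>+x. ennreal (norm (u (r i) x - u (r j) x) powr p) \<partial>lborel) \<le> ennreal e"
    if e: "0 < e" for e
  proof -
    define c where "c = (2::real) powr p"
    have c: "c > 0" by (simp add: c_def)
    have "(\<lambda>n. c * (1 + c) * (K * \<epsilon> n powr p)) \<longlonglongrightarrow> c * (1 + c) * (K * 0 powr p)"
      using p unfolding \<epsilon>_def
      by (intro tendsto_mult tendsto_const tendsto_powr' LIMSEQ_inverse_real_of_nat[unfolded inverse_eq_divide]) auto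
    then have "eventually (\<lambda>n. c * (1 + c) * (K * \<epsilon> n powr p) < e / 2) sequentially"
      using e p by (intro order_tendstoD(2)[where y = "c * (1 + c) * (K * 0 powr p)"]) auto
    then obtain n where n: "c * (1 + c) * (K * \<epsilon> n powr p) < e / 2"
      by (auto simp: eventually_sequentially)
    \<comment> \<open>Makes \<open>c * c * \<eta> powr p * W\<close> equal to e/2. The other half of
      \<open>e\<close> pays for the two averaging errors, already made small by the choice of
      \<open>n\<close>.\<close>
    define \<eta> where "\<eta> = (e / (2 * c * c * W)) powr (1 / p)"
    have \<eta>: "\<eta> > 0" using e c W by (simp add: \<eta>_def)
    have \<eta>p: "\<eta> powr p = e / (2 * c * c * W)" using e c W p by (simp add: \<eta>_def powr_powr)
    obtain N where N: "\<And>i j x. i \<ge> N \<Longrightarrow> j \<ge> N \<Longrightarrow> x \<in> S \<Longrightarrow> \<bar>A n (r i) x - A n (r j) x\<bar> < \<eta>"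
      using Pr[OF \<eta>, of n] by blast
    have "(\<integral>\<^sup>+x. ennreal (norm (u (r i) x - u (r j) x) powr p) \<partial>lborel) \<le> ennreal e"
      if ij: "i \<ge> N" "j \<ge> N" for i j
    proof -
      let ?E = "\<lambda>k x. \<bar>A n k x - u k x\<bar> powr p"
      \<comment> \<open>The difference is split as one summand plus a sum of two, so the first
        averaging error carries the factor \<open>c\<close> and the other two terms carry
        \<open>c * c\<close>.\<close>
      have pt: "norm (u (r i) x - u (r j) x) powr p
          \<le> c * ?E (r i) x + (c * c * ?E (r j) x + c * c * \<eta> powr p * indicator S x)" for x
      proof -
        have "norm (u (r i) x - u (r j) x) powr p
          = norm ((u (r i) x - A n (r i) x) + ((A n (r j) x - u (r j) x) + (A n (r i) x - A n (r j) x))) powr p"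
          by simp
        also have "\<dots> \<le> c * (norm (u (r i) x - A n (r i) x) powr p
            + norm ((A n (r j) x - u (r j) x) + (A n (r i) x - A n (r j) x)) powr p)"
          unfolding c_def using p by (intro norm_add_powr_le) auto
        also have "\<dots> \<le> c * (norm (u (r i) x - A n (r i) x) powr p
            + c * (norm (A n (r j) x - u (r j) x) powr p + norm (A n (r i) x - A n (r j) x) powr p))"
          using p c unfolding c_def by (intro mult_left_mono add_left_mono norm_add_powr_le) auto
        also have "norm (A n (r i) x - A n (r j) x) powr p \<le> \<eta> powr p * indicator S x"
          using N[OF ij, of x] A_supp[of x] p by (cases "x \<in> S") (auto intro!: powr_mono2)
        finally show ?thesis using c by (simp add: algebra_simps abs_minus_commute)
      qed
      have "(\<integral>\<^sup>+x. ennreal (norm (u (r i) x - u (r j) x) powr p) \<partial>lborel)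
        \<le> (\<integral>\<^sup>+x. ennreal c * ennreal (?E (r i) x) + (ennreal (c * c) * ennreal (?E (r j) x)
             + ennreal (c * c * \<eta> powr p) * indicator S x) \<partial>lborel)"
      proof (rule nn_integral_mono)
        fix x
        have "ennreal (norm (u (r i) x - u (r j) x) powr p)
          \<le> ennreal (c * ?E (r i) x + (c * c * ?E (r j) x + c * c * \<eta> powr p * indicator S x))"
          by (rule ennreal_leI[OF pt])
        also have "\<dots> = ennreal c * ennreal (?E (r i) x) + (ennreal (c * c) * ennreal (?E (r j) x)
             + ennreal (c * c * \<eta> powr p) * indicator S x)"
          using c by (cases "x \<in> S") (simp_all add: ennreal_mult)
        finally show "ennreal (norm (u (r i) x - u (r j) x) powr p) \<le> \<dots>" .
      qed
      also have "\<dots> = ennreal c * (\<integral>\<^sup>+x. ennreal (?E (r i) x) \<partial>lborel)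
         + (ennreal (c * c) * (\<integral>\<^sup>+x. ennreal (?E (r j) x) \<partial>lborel) + ennreal (c * c * \<eta> powr p) * ennreal W)"
        by (simp add: nn_integral_add nn_integral_cmult nn_integral_cmult_indicator WS)
      also have "\<dots> \<le> ennreal c * ennreal (K * \<epsilon> n powr p)
         + (ennreal (c * c) * ennreal (K * \<epsilon> n powr p) + ennreal (c * c * \<eta> powr p) * ennreal W)"
        by (intro add_mono mult_left_mono A_close) auto
      also have "\<dots> = ennreal (c * (1 + c) * (K * \<epsilon> n powr p) + c * c * \<eta> powr p * W)"
        using c K W by (simp add: ennreal_mult[symmetric] ennreal_plus[symmetric] algebra_simps del: ennreal_plus)
      also have "c * c * \<eta> powr p * W = e / 2" unfolding \<eta>p using c W by (simp add: field_simps)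
      also have "ennreal (c * (1 + c) * (K * \<epsilon> n powr p) + e / 2) \<le> ennreal e"
        using n by (intro ennreal_leI) linarith
      finally show ?thesis .
    qed
    then show ?thesis by blast
  qed
  show ?thesis by (rule that[OF r]) (rule main)
qed

subsection \<open>Strongly convergent midpoint combinations\<close>

text \<open>Dyadic convex combinations of the members from index \<open>n\<close> on. Midpoints
  suffice, because uniform convexity compares two near-minimisers only with their midpoint.\<close>

inductive tail_hull :: "(nat \<Rightarrow> 'm \<Rightarrow> 'b::real_vector) \<Rightarrow> nat \<Rightarrow> ('m \<Rightarrow> 'b) \<Rightarrow> bool"
  for f n where
  base: "n \<le> k \<Longrightarrow> tail_hull f n (f k)"
| midpoint: "tail_hull f n a \<Longrightarrow> tail_hull f n b \<Longrightarrow> tail_hull f n (\<lambda>x. (1/2) *\<^sub>R (a x + b x))"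

lemma tail_hull_antimono: "tail_hull f n a \<Longrightarrow> m \<le> n \<Longrightarrow> tail_hull f m a"
  by (induction rule: tail_hull.induct) (auto intro: tail_hull.intros)

lemma integrable_norm_midpoint_powr:
  fixes a b :: "'m \<Rightarrow> 'b::{real_normed_vector, second_countable_topology}"
  assumes "1 \<le> p" and [measurable]: "a \<in> borel_measurable M" "b \<in> borel_measurable M"
    and "integrable M (\<lambda>x. norm (a x) powr p)" "integrable M (\<lambda>x. norm (b x) powr p)"
  shows "integrable M (\<lambda>x. norm ((1/2) *\<^sub>R (a x + b x)) powr p)"
  by (rule Bochner_Integration.integrable_bound[of M "\<lambda>x. (norm (a x) powr p + norm (b x) powr p) / 2"])
    (use assms norm_midpoint_powr_le[OF assms(1)] in \<open>auto intro!: AE_I2\<close>)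

text \<open>Near-minimisers of the norm over the hulls of the tails form a Cauchy sequence by uniform
  convexity. Tracking the first component shows which combinations are used.\<close>

lemma tail_hull_strong_limit:
  fixes h :: "nat \<Rightarrow> 'm \<Rightarrow> 'c::real_normed_vector \<times> 'b::euclidean_space"
  assumes p: "1 < p" and hm: "\<And>k. (\<lambda>x. snd (h k x)) \<in> borel_measurable M"
    and hi: "\<And>k. integrable M (\<lambda>x. norm (snd (h k x)) powr p)"
    and bd: "\<And>k. (\<integral>x. norm (snd (h k x)) powr p \<partial>M) \<le> c k" and c: "c \<longlonglongrightarrow> v"
  obtains H G where "\<And>n. tail_hull h n (H n)" "G \<in> borel_measurable M"
    "(\<integral>\<^sup>+x. ennreal (norm (G x) powr p) \<partial>M) \<le> ennreal v"
    "\<And>e. 0 < e \<Longrightarrow> \<exists>N. \<forall>n\<ge>N. (\<integral>\<^sup>+x. ennreal (norm (snd (H n x) - G x) powr p) \<partial>M) \<le> ennreal e"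
proof -
  define I where "I a = (\<integral>x. norm (snd (a x)) powr p \<partial>M)" for a :: "'m \<Rightarrow> 'c \<times> 'b"
  have I0: "0 \<le> I a" for a by (simp add: I_def)
  have hull: "(\<lambda>x. snd (a x)) \<in> borel_measurable M \<and> integrable M (\<lambda>x. norm (snd (a x)) powr p)"
    if "tail_hull h n a" for n a
    using that
  proof induction
    case (base k)
    then show ?case using hm hi by simp
  next
    case (midpoint a b)
    then show ?case using integrable_norm_midpoint_powr[of p "\<lambda>x. snd (a x)" M "\<lambda>x. snd (b x)"] p
      by (auto simp: scaleR_add_right)
  qed
  \<comment> \<open>Hulls shrink as \<open>n\<close> grows, so these infima increase; they stay
    below \<open>v\<close> because the hull contains \<open>h k\<close> for all large
    \<open>k\<close>.\<close>
  define d where "d n = Inf (I ` {a. tail_hull h n a})" for n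
  have bdd: "bdd_below (I ` {a. tail_hull h n a})" for n
    using I0 by (intro bdd_belowI2[of _ 0]) auto
  have ne: "{a. tail_hull h n a} \<noteq> {}" for n using tail_hull.base[of n n h] by blast
  have d_le: "d n \<le> I a" if "tail_hull h n a" for n a
    unfolding d_def using that by (intro cINF_lower bdd) simp
  have d_incseq: "incseq d"
    unfolding incseq_def d_def
    by (intro allI impI cInf_superset_mono bdd) (use ne in \<open>auto intro: tail_hull_antimono\<close>)
  have d_le_v: "d n \<le> v" for n
  proof (rule LIMSEQ_le_const[OF c], intro exI allI impI)
    fix k assume "k \<ge> n"
    then have "d n \<le> I (h k)" by (intro d_le tail_hull.base)
    also have "\<dots> \<le> c k" unfolding I_def by (rule bd)
    finally show "d n \<le> c k" .
  qed
  obtain D where D: "d \<longlonglongrightarrow> D" "\<And>n. d n \<le> D"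
    using incseq_convergent[OF d_incseq] d_le_v by metis
  have D_le: "D \<le> v" using D(1) d_le_v by (meson LIMSEQ_le_const2)
  have D0: "0 \<le> D" using D(2)[of 0] cINF_greatest[OF ne[of 0], of 0 I] I0 by (simp add: d_def)
  have "\<exists>a. tail_hull h n a \<and> I a < d n + 1 / real (Suc n)" for n
    using cInf_lessD[of "I ` {a. tail_hull h n a}" "d n + 1 / real (Suc n)"] ne[of n]
    unfolding d_def[symmetric] by auto
  then obtain H where H: "\<And>n. tail_hull h n (H n)" "\<And>n. I (H n) < d n + 1 / real (Suc n)" by metis
  have Hm [measurable]: "(\<lambda>x. snd (H n x)) \<in> borel_measurable M"
    and Hi: "integrable M (\<lambda>x. norm (snd (H n x)) powr p)" for n
    using hull[OF H(1)] by auto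
  have Cauchy: "\<exists>N. \<forall>m\<ge>N. \<forall>n\<ge>N. (\<integral>\<^sup>+x. ennreal (norm (snd (H m x) - snd (H n x)) powr p) \<partial>M) \<le> ennreal e"
    if e: "0 < e" for e
  proof -
    \<comment> \<open>The integrated convexity inequality will end in
      \<open>2 * \<epsilon> * (D + \<tau>) + 2 * C * \<tau>\<close>. This \<epsilon>, and \<tau>
      below once \<open>C\<close> is known, make each summand at most e/2.\<close>
    define \<epsilon> where "\<epsilon> = e / (4 * (D + 1))"
    have \<epsilon>: "\<epsilon> > 0" using e D0 by (simp add: \<epsilon>_def)
    obtain C where C: "0 \<le> C" and uc: "\<And>a b :: 'b. norm (a - b) powr p \<le>
       \<epsilon> * (norm a powr p + norm b powr p)
       + C * ((norm a powr p + norm b powr p) / 2 - norm ((1/2) *\<^sub>R (a + b)) powr p)"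
      using uniform_convexity_powr[OF p \<epsilon>] by metis
    define \<tau> where "\<tau> = min 1 (e / (4 * (C + 1)))"
    have \<tau>: "\<tau> > 0" "\<tau> \<le> 1" using e C by (auto simp: \<tau>_def)
    have "2 * \<epsilon> * (D + \<tau>) \<le> 2 * \<epsilon> * (D + 1)" using \<epsilon> \<tau> by (intro mult_left_mono) auto
    also have "\<dots> = e / 2" using D0 by (simp add: \<epsilon>_def field_simps)
    finally have s1: "2 * \<epsilon> * (D + \<tau>) \<le> e / 2" .
    have "2 * C * \<tau> \<le> 2 * (C + 1) * (e / (4 * (C + 1)))"
      using C \<tau> e by (intro mult_mono) (auto simp: \<tau>_def)
    also have "\<dots> = e / 2" using C by (simp add: field_simps)
    finally have s2: "2 * C * \<tau> \<le> e / 2" .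
    obtain N1 where N1: "\<And>n. n \<ge> N1 \<Longrightarrow> d n > D - \<tau>"
      using order_tendstoD(1)[OF D(1), of "D - \<tau>"] \<tau> by (auto simp: eventually_sequentially)
    obtain N2 where N2: "1 / real (Suc N2) < \<tau>"
      using \<tau>(1) reals_Archimedean by (metis inverse_eq_divide)
    define N where "N = max N1 N2"
    have near: "I (H n) \<le> D + \<tau>" if "n \<ge> N" for n
    proof -
      have "1 / real (Suc n) \<le> 1 / real (Suc N2)" using that by (intro divide_left_mono) (auto simp: N_def)
      then show ?thesis using H(2)[of n] D(2)[of n] N2 by linarith
    qed
    have "(\<integral>\<^sup>+x. ennreal (norm (snd (H m x) - snd (H n x)) powr p) \<partial>M) \<le> ennreal e"
      if mn: "m \<ge> N" "n \<ge> N" for m n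
    proof -
      let ?a = "\<lambda>x. snd (H m x)" and ?b = "\<lambda>x. snd (H n x)"
      let ?mid = "\<lambda>x. (1/2) *\<^sub>R (H m x + H n x)"
      \<comment> \<open>Membership of the midpoint in the hull from \<open>N\<close> on bounds its
        energy below by \<open>d N\<close>, hence by \<open>D - \<tau>\<close>; two near-minimisers
        thus have a small convexity defect.\<close>
      have mid: "tail_hull h N ?mid"
        by (intro tail_hull.midpoint) (use mn H(1) tail_hull_antimono in blast)+
      have midi: "integrable M (\<lambda>x. norm ((1/2) *\<^sub>R (?a x + ?b x)) powr p)"
        using hull[OF mid] by (simp add: scaleR_add_right)
      have Imid: "(\<integral>x. norm ((1/2) *\<^sub>R (?a x + ?b x)) powr p \<partial>M) = I ?mid"
        unfolding I_def by (simp add: scaleR_add_right)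
      let ?rhs = "\<lambda>x. \<epsilon> * (norm (?a x) powr p + norm (?b x) powr p)
         + C * ((norm (?a x) powr p + norm (?b x) powr p) / 2 - norm ((1/2) *\<^sub>R (?a x + ?b x)) powr p)"
      have ri: "integrable M ?rhs"
        by (intro Bochner_Integration.integrable_add Bochner_Integration.integrable_diff
            integrable_mult_right integrable_divide_zero Hi midi)
      have di: "integrable M (\<lambda>x. norm (?a x - ?b x) powr p)"
        by (rule Bochner_Integration.integrable_bound[OF ri]) (use uc in \<open>auto intro!: AE_I2 order_trans[OF _ abs_ge_self]\<close>)
      have "(\<integral>x. norm (?a x - ?b x) powr p \<partial>M) \<le> (\<integral>x. ?rhs x \<partial>M)"
        by (intro integral_mono di ri uc)
      also have "\<dots> = \<epsilon> * (I (H m) + I (H n)) + C * ((I (H m) + I (H n)) / 2 - I ?mid)"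
        using Hi midi by (simp add: Imid[symmetric] I_def)
      also have "\<dots> \<le> \<epsilon> * (2 * (D + \<tau>)) + C * ((2 * (D + \<tau>)) / 2 - (D - \<tau>))"
      proof (intro add_mono mult_left_mono diff_mono divide_right_mono)
        have "I (H m) + I (H n) \<le> (D + \<tau>) + (D + \<tau>)" by (intro add_mono near mn)
        then have "I (H m) + I (H n) \<le> 2 * (D + \<tau>)" by simp
        then show "I (H m) + I (H n) \<le> 2 * (D + \<tau>)" "I (H m) + I (H n) \<le> 2 * (D + \<tau>)" by this+
        show "D - \<tau> \<le> I ?mid" using N1[of N] d_le[OF mid] by (simp add: N_def)
      qed (use \<epsilon> C in auto)
      also have "\<dots> = 2 * \<epsilon> * (D + \<tau>) + 2 * C * \<tau>" by (simp add: algebra_simps)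
      finally have "(\<integral>x. norm (?a x - ?b x) powr p \<partial>M) \<le> e" using s1 s2 by linarith
      then show ?thesis by (subst nn_integral_eq_integral[OF di]) (auto intro: ennreal_leI)
    qed
    then show ?thesis by blast
  qed
  obtain G r where G: "G \<in> borel_measurable M" "strict_mono r"
    "AE x in M. (\<lambda>k. snd (H (r k) x)) \<longlonglongrightarrow> G x"
    "\<And>e. 0 < e \<Longrightarrow> \<exists>N. \<forall>n\<ge>N. (\<integral>\<^sup>+x. ennreal (norm (snd (H n x) - G x) powr p) \<partial>M) \<le> ennreal e"
  proof (rule nn_integral_powr_Cauchy_converges[of p "\<lambda>n x. snd (H n x)" M])
    show "\<exists>N. \<forall>m\<ge>N. \<forall>n\<ge>N. (\<integral>\<^sup>+x. ennreal (norm (snd (H m x) - snd (H n x)) powr p) \<partial>M) \<le> ennreal e"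
      if "0 < e" for e using Cauchy[OF that] .
  qed (use p in simp, rule Hm, erule (2) that, blast)
  have "(\<integral>\<^sup>+x. ennreal (norm (G x) powr p) \<partial>M) \<le> ennreal v"
  proof (rule nn_integral_powr_Fatou[OF _ _ G(3)])
    show "(\<integral>\<^sup>+x. ennreal (norm (snd (H (r n) x)) powr p) \<partial>M) \<le> ennreal (v + 1 / real (Suc n))" for n
    proof -
      have "1 / real (Suc (r n)) \<le> 1 / real (Suc n)"
        using seq_suble[OF G(2), of n] by (intro divide_left_mono) auto
      then have "I (H (r n)) \<le> v + 1 / real (Suc n)" using H(2)[of "r n"] d_le_v[of "r n"] by linarith
      then show ?thesis by (subst nn_integral_eq_integral[OF Hi]) (auto intro: ennreal_leI simp: I_def)
    qed
    have "(\<lambda>n. v + 1 / real (Suc n)) \<longlonglongrightarrow> v + 0"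
      by (intro tendsto_intros LIMSEQ_inverse_real_of_nat[unfolded inverse_eq_divide])
    then show "(\<lambda>n. ennreal (v + 1 / real (Suc n))) \<longlonglongrightarrow> ennreal v" by (intro tendsto_ennrealI) simp
  qed (use p in auto)
  with that H(1) G show ?thesis by blast
qed

subsection \<open>Continuity of pairings\<close>

text \<open>A pointwise stand-in for Minkowski's inequality: the factor of
  \<open>norm b powr p\<close> can be brought arbitrarily close to 1, at the price of a large factor
  on the difference. The cases distinguish whether the difference is small relative to
  \<open>b\<close>.\<close>

lemma powr_le_dominated:
  fixes a b :: "'a::real_normed_vector"
  assumes "0 < \<eta>" "0 \<le> p"
  shows "norm a powr p \<le> (1 + \<eta>) powr p * norm b powr p + (1 + 1 / \<eta>) powr p * norm (a - b) powr p"
proof (cases "norm (a - b) \<le> \<eta> * norm b")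
  case True
  have "norm a \<le> norm b + norm (a - b)" using norm_triangle_ineq[of b "a - b"] by simp
  then have "norm a powr p \<le> ((1 + \<eta>) * norm b) powr p"
    using True assms by (intro powr_mono2) (auto simp: algebra_simps)
  then show ?thesis using assms by (simp add: powr_mult add_increasing2)
next
  case False
  then have "norm b \<le> norm (a - b) / \<eta>" using assms by (simp add: field_simps)
  moreover have "norm a \<le> norm b + norm (a - b)" using norm_triangle_ineq[of b "a - b"] by simp
  ultimately have "norm a powr p \<le> ((1 + 1 / \<eta>) * norm (a - b)) powr p"
    using assms by (intro powr_mono2) (auto simp: algebra_simps)
  then show ?thesis using assms by (simp add: powr_mult add_increasing)
qed

text \<open>No mass is lost under convergence in the mean: with \<eta> fixed the error term tends to
  0, and afterwards the factor \<open>(1 + \<eta>) powr p\<close> is sent to 1.\<close>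

lemma nn_integral_powr_limit_ge:
  fixes f :: "nat \<Rightarrow> 'm \<Rightarrow> 'b::{real_normed_vector, second_countable_topology}"
  assumes p: "0 < p" and [measurable]: "\<And>n. f n \<in> borel_measurable M" "g \<in> borel_measurable M"
    and conv: "\<And>e. 0 < e \<Longrightarrow> \<exists>N. \<forall>n\<ge>N. (\<integral>\<^sup>+x. ennreal (norm (f n x - g x) powr p) \<partial>M) \<le> ennreal e"
    and one: "\<And>n. (\<integral>\<^sup>+x. ennreal (norm (f n x) powr p) \<partial>M) = 1"
  shows "1 \<le> (\<integral>\<^sup>+x. ennreal (norm (g x) powr p) \<partial>M)"
proof -
  let ?I = "\<integral>\<^sup>+x. ennreal (norm (g x) powr p) \<partial>M"
  have step: "1 \<le> ennreal ((1 + \<eta>) powr p) * ?I + ennreal e" if \<eta>: "0 < \<eta>" and e: "0 < e" for \<eta> e :: real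
  proof -
    let ?C = "(1 + 1 / \<eta>) powr p"
    have "0 < 1 + 1 / \<eta>" using \<eta> by (simp add: add_pos_pos)
    then have C: "?C > 0" by simp
    obtain n where n: "(\<integral>\<^sup>+x. ennreal (norm (f n x - g x) powr p) \<partial>M) \<le> ennreal (e / ?C)"
      using conv[of "e / ?C"] e C by auto
    have "1 = (\<integral>\<^sup>+x. ennreal (norm (f n x) powr p) \<partial>M)" by (simp add: one)
    also have "\<dots> \<le> (\<integral>\<^sup>+x. ennreal ((1 + \<eta>) powr p) * ennreal (norm (g x) powr p)
        + ennreal ?C * ennreal (norm (f n x - g x) powr p) \<partial>M)"
    proof (rule nn_integral_mono)
      fix x
      have "ennreal (norm (f n x) powr p) \<le> ennreal ((1 + \<eta>) powr p * norm (g x) powr p + ?C * norm (f n x - g x) powr p)"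
        using powr_le_dominated[OF \<eta>, of p "f n x" "g x"] p by (intro ennreal_leI) auto
      then show "ennreal (norm (f n x) powr p) \<le> ennreal ((1 + \<eta>) powr p) * ennreal (norm (g x) powr p)
        + ennreal ?C * ennreal (norm (f n x - g x) powr p)"
        by (simp add: ennreal_mult)
    qed
    also have "\<dots> = ennreal ((1 + \<eta>) powr p) * ?I
        + ennreal ?C * (\<integral>\<^sup>+x. ennreal (norm (f n x - g x) powr p) \<partial>M)"
      by (simp add: nn_integral_add nn_integral_cmult)
    also have "\<dots> \<le> ennreal ((1 + \<eta>) powr p) * ?I + ennreal ?C * ennreal (e / ?C)"
      by (intro add_left_mono mult_left_mono n) simp
    also have "ennreal ?C * ennreal (e / ?C) = ennreal e" using C e by (simp add: ennreal_mult[symmetric])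
    finally show ?thesis .
  qed
  show ?thesis
  proof (cases "?I = \<infinity>")
    case False
    then obtain i where i: "?I = ennreal i" "0 \<le> i" by (metis ennreal_cases infinity_ennreal_def)
    have le: "1 \<le> (1 + \<eta>) powr p * i + e" if "0 < \<eta>" "0 < e" for \<eta> e
      using step[OF that] i that
      by (simp add: ennreal_mult[symmetric] ennreal_plus[symmetric] del: ennreal_plus)
    \<comment> \<open>The two parameters of \<open>le\<close> are taken equal and sent to 0 from the
      right.\<close>
    have "1 \<le> (1 + 0) powr p * i + (0::real)"
    proof (rule tendsto_le[OF _ _ tendsto_const])
      show "((\<lambda>\<eta>. (1 + \<eta>) powr p * i + \<eta>) \<longlongrightarrow> (1 + 0) powr p * i + 0) (at_right 0)"
        by (intro tendsto_intros) auto
      show "\<forall>\<^sub>F \<eta> in at_right 0. 1 \<le> (1 + \<eta>) powr p * i + \<eta>"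
        using eventually_at_right_less[of 0] by eventually_elim (use le in auto)
    qed simp
    then show ?thesis using i by simp
  qed simp
qed

text \<open>On the ball carrying \<open>w\<close>, the splitting at level \<eta> bounds
  \<open>\<bar>f x\<bar>\<close> by \<eta> plus a multiple of its p-th power. This covers p = 1
  together with p > 1 and needs no dual exponent.\<close>

lemma integrable_mult_compact_support:
  fixes f w :: "'a::euclidean_space \<Rightarrow> real"
  assumes p: "1 \<le> p" and [measurable]: "f \<in> borel_measurable borel" "w \<in> borel_measurable borel"
    and w: "\<And>x. \<bar>w x\<bar> \<le> B" "\<And>x. R < norm x \<Longrightarrow> w x = 0"
    and f: "(\<integral>\<^sup>+x. ennreal (\<bar>f x\<bar> powr p) \<partial>lborel) \<le> ennreal e" and e: "0 \<le> e"
  shows "integrable lborel (\<lambda>x. f x * w x)"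
    and "0 < \<eta> \<Longrightarrow> \<bar>\<integral>x. f x * w x \<partial>lborel\<bar>
      \<le> B * (\<eta> * measure lborel (cball (0::'a) R) + \<eta> powr (1 - p) * e)"
proof -
  have B: "0 \<le> B" using w(1)[of 0] by linarith
  have Si: "integrable lborel (indicator (cball (0::'a) R) :: 'a \<Rightarrow> real)"
    by (intro integrable_real_indicator emeasure_bounded_finite) auto
  have fi: "integrable lborel (\<lambda>x. \<bar>f x\<bar> powr p)"
    using f by (intro integrableI_bounded) (auto simp: le_less_trans[OF _ ennreal_less_top])
  have fe: "(\<integral>x. \<bar>f x\<bar> powr p \<partial>lborel) \<le> e"
    using f nn_integral_eq_integral[OF fi] e by simp
  let ?dom = "\<lambda>\<eta> x. B * (\<eta> * indicator (cball 0 R) x + \<eta> powr (1 - p) * \<bar>f x\<bar> powr p)"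
  have dom: "\<bar>f x * w x\<bar> \<le> ?dom \<eta> x" if "0 < \<eta>" for \<eta> x
  proof (cases "norm x \<le> R")
    case True
    have "\<bar>f x\<bar> * \<bar>w x\<bar> \<le> (\<eta> + \<eta> powr (1 - p) * \<bar>f x\<bar> powr p) * B"
      using le_add_powr[of "\<bar>f x\<bar>" \<eta> p] p that w(1)[of x] by (intro mult_mono) auto
    then show ?thesis using True by (simp add: abs_mult mult.commute)
  next
    case False
    then show ?thesis using w(2)[of x] B by simp
  qed
  have domi: "integrable lborel (?dom \<eta>)" for \<eta>
    by (intro integrable_mult_right Bochner_Integration.integrable_add Si fi)
  show int: "integrable lborel (\<lambda>x. f x * w x)"
    by (rule Bochner_Integration.integrable_bound[OF domi[of 1]])
      (use dom[of 1] in \<open>auto intro!: AE_I2 order_trans[OF _ abs_ge_self]\<close>)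
  assume \<eta>: "0 < \<eta>"
  have "\<bar>\<integral>x. f x * w x \<partial>lborel\<bar> \<le> (\<integral>x. \<bar>f x * w x\<bar> \<partial>lborel)" by (rule integral_abs_bound)
  also have "\<dots> \<le> (\<integral>x. ?dom \<eta> x \<partial>lborel)" by (intro integral_mono integrable_abs int domi dom \<eta>)
  also have "\<dots> = B * (\<eta> * measure lborel (cball (0::'a) R) + \<eta> powr (1 - p) * (\<integral>x. \<bar>f x\<bar> powr p \<partial>lborel))"
    using Si fi by simp
  also have "\<dots> \<le> B * (\<eta> * measure lborel (cball (0::'a) R) + \<eta> powr (1 - p) * e)"
    by (intro mult_left_mono add_left_mono fe B) simp
  finally show "\<bar>\<integral>x. f x * w x \<partial>lborel\<bar>
      \<le> B * (\<eta> * measure lborel (cball (0::'a) R) + \<eta> powr (1 - p) * e)" .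
qed

lemma tendsto_integral_mult_compact_support:
  fixes f :: "nat \<Rightarrow> 'a::euclidean_space \<Rightarrow> real" and w :: "'a \<Rightarrow> real"
  assumes p: "1 \<le> p" and [measurable]: "\<And>n. f n \<in> borel_measurable borel" "g \<in> borel_measurable borel"
      "w \<in> borel_measurable borel"
    and w: "\<And>x. \<bar>w x\<bar> \<le> B" "\<And>x. R < norm x \<Longrightarrow> w x = 0"
    and g: "(\<integral>\<^sup>+x. ennreal (\<bar>g x\<bar> powr p) \<partial>lborel) < \<infinity>"
    and conv: "\<And>e. 0 < e \<Longrightarrow> \<exists>N. \<forall>n\<ge>N. (\<integral>\<^sup>+x. ennreal (\<bar>f n x - g x\<bar> powr p) \<partial>lborel) \<le> ennreal e"
  shows "(\<lambda>n. \<integral>x. f n x * w x \<partial>lborel) \<longlonglongrightarrow> (\<integral>x. g x * w x \<partial>lborel)"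
proof (rule LIMSEQ_I)
  fix e :: real assume e: "0 < e"
  have B: "0 \<le> B" using w(1)[of 0] by linarith
  obtain G where G: "(\<integral>\<^sup>+x. ennreal (\<bar>g x\<bar> powr p) \<partial>lborel) \<le> ennreal G" "0 \<le> G"
    using g by (metis ennreal_cases infinity_ennreal_def order_refl top.not_eq_extremum)
  have gi: "integrable lborel (\<lambda>x. g x * w x)"
    by (rule integrable_mult_compact_support(1)[OF p _ _ w G]) auto
  define W where "W = measure lborel (cball (0::'a) R)"
  have W: "0 \<le> W" by (simp add: W_def)
  \<comment> \<open>The threshold \<eta> is fixed before the accuracy \<open>e'\<close>, since
    \<open>\<eta> powr (1 - p)\<close> may be huge and has to be compensated by
    \<open>e'\<close>.\<close>
  define \<eta> where "\<eta> = e / (3 * (B * W + 1))"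
  have BW: "0 \<le> B * W" using B W by simp
  have \<eta>: "0 < \<eta>" using e BW by (simp add: \<eta>_def)
  define c where "c = B * \<eta> powr (1 - p)"
  have c: "0 \<le> c" using B by (simp add: c_def)
  define e' where "e' = e / (3 * (c + 1))"
  have e': "0 < e'" using e c by (simp add: e'_def)
  obtain N where N: "\<And>n. n \<ge> N \<Longrightarrow> (\<integral>\<^sup>+x. ennreal (\<bar>f n x - g x\<bar> powr p) \<partial>lborel) \<le> ennreal e'"
    using conv[OF e'] by blast
  show "\<exists>no. \<forall>n\<ge>no. norm ((\<integral>x. f n x * w x \<partial>lborel) - (\<integral>x. g x * w x \<partial>lborel)) < e"
  proof (intro exI allI impI)
    fix n assume n: "n \<ge> N"
    note est = integrable_mult_compact_support[where f = "\<lambda>x. f n x - g x" and w = w and B = B and R = R,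
        OF p _ _ w N[OF n] less_imp_le[OF e']]
    have di: "integrable lborel (\<lambda>x. (f n x - g x) * w x)" by (rule est(1)) auto
    have "integrable lborel (\<lambda>x. (f n x - g x) * w x + g x * w x)"
      by (intro Bochner_Integration.integrable_add di gi)
    then have fi: "integrable lborel (\<lambda>x. f n x * w x)" by (simp add: left_diff_distrib)
    have "\<bar>(\<integral>x. f n x * w x \<partial>lborel) - (\<integral>x. g x * w x \<partial>lborel)\<bar> = \<bar>\<integral>x. (f n x - g x) * w x \<partial>lborel\<bar>"
      using fi gi by (simp add: left_diff_distrib)
    also have "\<dots> \<le> B * (\<eta> * W + \<eta> powr (1 - p) * e')" unfolding W_def by (rule est(2)[OF _ _ _ \<eta>]) auto
    also have "\<dots> = (B * W) * \<eta> + c * e'" by (simp add: c_def algebra_simps)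
    also have "\<dots> \<le> (B * W + 1) * \<eta> + (c + 1) * e'" using \<eta> e' by (simp add: algebra_simps)
    also have "(B * W + 1) * \<eta> = e / 3" using BW by (simp add: \<eta>_def field_simps)
    also have "(c + 1) * e' = e / 3" using c by (simp add: e'_def field_simps)
    finally show "norm ((\<integral>x. f n x * w x \<partial>lborel) - (\<integral>x. g x * w x \<partial>lborel)) < e" using e by simp
  qed
qed

subsection \<open>Compactness of admissible functions\<close>

lemma borel_representative:
  fixes g :: "'a::euclidean_space \<Rightarrow> 'b::euclidean_space"
  assumes g: "g \<in> borel_measurable lebesgue"
  obtains g' where "g' \<in> borel_measurable borel" "AE x in lebesgue. g x = g' x"
proof -
  have "\<exists>f\<in>borel_measurable lborel. AE x in lborel. g x \<bullet> b = f x" for b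
    by (rule completion_ex_borel_measurable_real[OF borel_measurable_inner[OF g borel_measurable_const]])
  then have "\<exists>f. \<forall>b. f b \<in> borel_measurable lborel \<and> (AE x in lborel. g x \<bullet> b = f b x)"
    by (intro choice) blast
  then obtain f where "\<And>b. f b \<in> borel_measurable lborel" and f2: "\<And>b. AE x in lborel. g x \<bullet> b = f b x"
    by blast
  then have f1: "f b \<in> borel_measurable borel" for b by simp
  define g' where "g' x = (\<Sum>b\<in>Basis. f b x *\<^sub>R b)" for x
  have m: "g' \<in> borel_measurable borel" unfolding g'_def
    by (intro borel_measurable_sum borel_measurable_scaleR f1 borel_measurable_const)
  have "AE x in lborel. \<forall>b\<in>Basis. g x \<bullet> b = f b x" by (rule AE_finite_allI[OF finite_Basis f2])
  then have "AE x in lborel. g x = g' x"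
  proof eventually_elim
    case (elim x)
    have "g x = (\<Sum>b\<in>Basis. (g x \<bullet> b) *\<^sub>R b)" by (simp add: euclidean_representation)
    also have "\<dots> = g' x" unfolding g'_def using elim by (intro sum.cong) auto
    finally show ?case .
  qed
  then have "AE x in lebesgue. g x = g' x" by (rule AE_completion)
  with m show ?thesis by (rule that)
qed

lemma C1c_divergence_measurable:
  assumes "C1c \<phi>"
  shows "divergence \<phi> \<in> borel_measurable borel"
  unfolding divergence_def[abs_def] using C1c_continuous_on_derivative[OF assms]
  by (intro borel_measurable_continuous_onI continuous_intros)

lemma C1c_divergence_bounded_support:
  fixes \<phi> :: "'a::euclidean_space \<Rightarrow> 'a"
  assumes "C1c \<phi>"
  obtains B R where "\<And>x. \<bar>divergence \<phi> x\<bar> \<le> B" "\<And>x. R < norm x \<Longrightarrow> divergence \<phi> x = 0"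
proof -
  obtain R where R: "\<And>x h. R < norm x \<Longrightarrow> frechet_derivative \<phi> (at x) h = 0"
    using C1c_support[OF assms] by metis
  have z: "divergence \<phi> x = 0" if "R < norm x" for x using R[OF that] by (simp add: divergence_def)
  have "continuous_on UNIV (divergence \<phi>)"
    unfolding divergence_def[abs_def] using C1c_continuous_on_derivative[OF assms]
    by (intro continuous_intros)
  from continuous_compact_support_bounded[OF this z] show ?thesis using that z by (metis real_norm_def)
qed

lemma TV_cong_AE:
  fixes u u' :: "'a::euclidean_space \<Rightarrow> real"
  assumes [measurable]: "u \<in> borel_measurable lebesgue" "u' \<in> borel_measurable lebesgue"
    and eq: "AE x in lebesgue. u x = u' x"
  shows "TV u = TV u'"
proof -
  have "(\<integral>x. u x * divergence \<phi> x \<partial>lebesgue) = (\<integral>x. u' x * divergence \<phi> x \<partial>lebesgue)" if "C1c \<phi>" for \<phi>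
  proof (rule integral_cong_AE)
    have [measurable]: "divergence \<phi> \<in> borel_measurable lebesgue"
      using C1c_divergence_measurable[OF that] by (simp add: measurable_completion)
    show "(\<lambda>x. u x * divergence \<phi> x) \<in> borel_measurable lebesgue"
      "(\<lambda>x. u' x * divergence \<phi> x) \<in> borel_measurable lebesgue" by measurable
    show "AE x in lebesgue. u x * divergence \<phi> x = u' x * divergence \<phi> x"
      using eq by eventually_elim simp
  qed
  then show ?thesis unfolding TV_def by (intro SUP_cong) auto
qed

lemma TV_nonneg: "0 \<le> TV u"
proof -
  have d: "((\<lambda>x::'a. 0::'a) has_derivative (\<lambda>_. 0)) (at x)" for x by simp
  have "frechet_derivative (\<lambda>x::'a. 0::'a) (at x) = (\<lambda>_. 0)" for x
    using frechet_derivative_at[OF d] by simp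
  moreover have "C1c (\<lambda>x::'a. 0::'a)" by (rule C1cI[OF d]) auto
  ultimately show ?thesis
    unfolding TV_def by (intro SUP_upper2[of "\<lambda>_. 0"]) (auto simp: divergence_def zero_ereal_def[symmetric])
qed

lemma weak_grad_cong_AE:
  fixes u u' :: "'a::euclidean_space \<Rightarrow> real"
  assumes [measurable]: "u \<in> borel_measurable lebesgue" "u' \<in> borel_measurable lebesgue"
      "g \<in> borel_measurable lebesgue" "g' \<in> borel_measurable lebesgue"
    and eq: "AE x in lebesgue. u x = u' x" "AE x in lebesgue. g x = g' x" and wg: "weak_grad u g"
  shows "weak_grad u' g'"
  unfolding weak_grad_def
proof (intro allI impI ballI)
  fix \<psi> :: "'a \<Rightarrow> real" and b :: 'a assume \<psi>: "C1c \<psi>" and b: "b \<in> Basis"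
  have [measurable]: "\<psi> \<in> borel_measurable lebesgue" "(\<lambda>x. frechet_derivative \<psi> (at x) b) \<in> borel_measurable lebesgue"
    using C1c_borel_measurable[OF \<psi>] by (simp_all add: measurable_completion)
  have "(\<integral>x. u' x * frechet_derivative \<psi> (at x) b \<partial>lebesgue) = (\<integral>x. u x * frechet_derivative \<psi> (at x) b \<partial>lebesgue)"
    by (rule integral_cong_AE) (measurable, use eq(1) in eventually_elim, simp)
  also have "\<dots> = - (\<integral>x. (g x \<bullet> b) * \<psi> x \<partial>lebesgue)" using wg \<psi> b unfolding weak_grad_def by blast
  also have "(\<integral>x. (g x \<bullet> b) * \<psi> x \<partial>lebesgue) = (\<integral>x. (g' x \<bullet> b) * \<psi> x \<partial>lebesgue)"
    by (rule integral_cong_AE) (measurable, use eq(2) in eventually_elim, simp)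
  finally show "(\<integral>x. u' x * frechet_derivative \<psi> (at x) b \<partial>lebesgue) = - (\<integral>x. (g' x \<bullet> b) * \<psi> x \<partial>lebesgue)" .
qed

lemma weak_grad_lborel_iff:
  fixes u :: "'a::euclidean_space \<Rightarrow> real"
  assumes [measurable]: "u \<in> borel_measurable borel" "g \<in> borel_measurable borel"
  shows "weak_grad u g \<longleftrightarrow> (\<forall>\<psi>. C1c \<psi> \<longrightarrow> (\<forall>b\<in>Basis.
      (\<integral>x. u x * frechet_derivative \<psi> (at x) b \<partial>lborel) = - (\<integral>x. (g x \<bullet> b) * \<psi> x \<partial>lborel)))"
proof -
  have "(\<integral>x. u x * frechet_derivative \<psi> (at x) b \<partial>lebesgue) = (\<integral>x. u x * frechet_derivative \<psi> (at x) b \<partial>lborel)"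
    "(\<integral>x. (g x \<bullet> b) * \<psi> x \<partial>lebesgue) = (\<integral>x. (g x \<bullet> b) * \<psi> x \<partial>lborel)"
    if "C1c \<psi>" for \<psi> :: "'a \<Rightarrow> real" and b
  proof -
    note [measurable] = C1c_borel_measurable[OF that]
    show "(\<integral>x. u x * frechet_derivative \<psi> (at x) b \<partial>lebesgue) = (\<integral>x. u x * frechet_derivative \<psi> (at x) b \<partial>lborel)"
      by (rule integral_completion) simp
    show "(\<integral>x. (g x \<bullet> b) * \<psi> x \<partial>lebesgue) = (\<integral>x. (g x \<bullet> b) * \<psi> x \<partial>lborel)"
      by (rule integral_completion) simp
  qed
  note eqs = this
  show ?thesis unfolding weak_grad_def
    by (intro iff_allI imp_cong ball_cong refl) (simp only: eqs)
qed

lemma integrable_powr_compact_supportI: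
  fixes f w :: "'a::euclidean_space \<Rightarrow> real"
  assumes "1 \<le> p" "f \<in> borel_measurable borel" "w \<in> borel_measurable borel"
    and "\<And>x. \<bar>w x\<bar> \<le> B" "\<And>x. R < norm x \<Longrightarrow> w x = 0" and f: "integrable lborel (\<lambda>x. \<bar>f x\<bar> powr p)"
  shows "integrable lborel (\<lambda>x. f x * w x)"
proof (rule integrable_mult_compact_support(1)[where f = f and w = w and B = B and R = R and p = p])
  show "(\<integral>\<^sup>+x. ennreal (\<bar>f x\<bar> powr p) \<partial>lborel) \<le> ennreal (\<integral>x. \<bar>f x\<bar> powr p \<partial>lborel)"
    by (simp add: nn_integral_eq_integral[OF f])
  show "0 \<le> (\<integral>x. \<bar>f x\<bar> powr p \<partial>lborel)" by simp
qed (fact assms)+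

lemma integrable_C1c_pairings:
  fixes u \<psi> :: "'a::euclidean_space \<Rightarrow> real" and g :: "'a \<Rightarrow> 'a"
  assumes p: "1 \<le> p" and [measurable]: "u \<in> borel_measurable borel" "g \<in> borel_measurable borel"
    and ui: "integrable lborel (\<lambda>x. \<bar>u x\<bar> powr p)" and gi: "integrable lborel (\<lambda>x. norm (g x) powr p)"
    and \<psi>: "C1c \<psi>" and b: "b \<in> Basis"
  shows "integrable lborel (\<lambda>x. u x * frechet_derivative \<psi> (at x) b)"
    and "integrable lborel (\<lambda>x. (g x \<bullet> b) * \<psi> x)"
proof -
  note [measurable] = C1c_borel_measurable[OF \<psi>]
  obtain D where D: "\<And>x h. norm (frechet_derivative \<psi> (at x) h) \<le> D * norm h"
    using C1c_derivative_bounded[OF \<psi>] by blast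
  obtain B where B: "\<And>x. norm (\<psi> x) \<le> B" using C1c_bounded[OF \<psi>] by blast
  obtain R where R: "\<And>x. R < norm x \<Longrightarrow> \<psi> x = 0" "\<And>x h. R < norm x \<Longrightarrow> frechet_derivative \<psi> (at x) h = 0"
    using C1c_support[OF \<psi>] by metis
  show "integrable lborel (\<lambda>x. u x * frechet_derivative \<psi> (at x) b)"
  proof (rule integrable_powr_compact_supportI[where p = p and B = "D * norm b" and R = R, OF p])
    show "\<bar>frechet_derivative \<psi> (at x) b\<bar> \<le> D * norm b" for x using D[of x b] by simp
    show "R < norm x \<Longrightarrow> frechet_derivative \<psi> (at x) b = 0" for x by (rule R(2))
  qed (rule C1c_borel_measurable(2)[OF \<psi>] | fact)+
  have "\<bar>g x \<bullet> b\<bar> powr p \<le> norm (g x) powr p" for x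
    using p by (intro powr_mono2 Basis_le_norm b) auto
  then have "integrable lborel (\<lambda>x. \<bar>g x \<bullet> b\<bar> powr p)"
    by (intro Bochner_Integration.integrable_bound[OF gi] AE_I2) simp_all
  moreover have "(\<lambda>x. g x \<bullet> b) \<in> borel_measurable borel"
    by (intro borel_measurable_inner borel_measurable_const) fact
  ultimately show "integrable lborel (\<lambda>x. (g x \<bullet> b) * \<psi> x)"
    using integrable_powr_compact_supportI[OF p _ C1c_borel_measurable(1)[OF \<psi>] B[unfolded real_norm_def] R(1)]
    by blast
qed

lemma weak_grad_midpoint:
  fixes u v :: "'a::euclidean_space \<Rightarrow> real"
  assumes p: "1 \<le> p"
    and [measurable]: "u \<in> borel_measurable borel" "g \<in> borel_measurable borel"
      "v \<in> borel_measurable borel" "h \<in> borel_measurable borel"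
    and ui: "integrable lborel (\<lambda>x. \<bar>u x\<bar> powr p)" and gi: "integrable lborel (\<lambda>x. norm (g x) powr p)"
    and vi: "integrable lborel (\<lambda>x. \<bar>v x\<bar> powr p)" and hi: "integrable lborel (\<lambda>x. norm (h x) powr p)"
    and wg: "weak_grad u g" "weak_grad v h"
  shows "weak_grad (\<lambda>x. (1/2) * (u x + v x)) (\<lambda>x. (1/2) *\<^sub>R (g x + h x))"
proof -
  have m: "(\<lambda>x. (1/2) * (u x + v x)) \<in> borel_measurable borel"
    "(\<lambda>x. (1/2) *\<^sub>R (g x + h x)) \<in> borel_measurable borel" by measurable
  show ?thesis unfolding weak_grad_lborel_iff[OF m]
  proof (intro allI impI ballI)
    fix \<psi> :: "'a \<Rightarrow> real" and b :: 'a assume \<psi>: "C1c \<psi>" and b: "b \<in> Basis"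
    note i1 = integrable_C1c_pairings[OF p _ _ ui gi \<psi> b] and i2 = integrable_C1c_pairings[OF p _ _ vi hi \<psi> b]
    have i: "integrable lborel (\<lambda>x. u x * frechet_derivative \<psi> (at x) b)" "integrable lborel (\<lambda>x. (g x \<bullet> b) * \<psi> x)"
      "integrable lborel (\<lambda>x. v x * frechet_derivative \<psi> (at x) b)" "integrable lborel (\<lambda>x. (h x \<bullet> b) * \<psi> x)"
      by (rule i1 i2; simp)+
    have e: "(\<integral>x. u x * frechet_derivative \<psi> (at x) b \<partial>lborel) = - (\<integral>x. (g x \<bullet> b) * \<psi> x \<partial>lborel)"
      "(\<integral>x. v x * frechet_derivative \<psi> (at x) b \<partial>lborel) = - (\<integral>x. (h x \<bullet> b) * \<psi> x \<partial>lborel)"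
      using wg \<psi> b by (simp_all add: weak_grad_lborel_iff)
    have "(\<integral>x. (1/2) * (u x + v x) * frechet_derivative \<psi> (at x) b \<partial>lborel)
        = (1/2) * ((\<integral>x. u x * frechet_derivative \<psi> (at x) b \<partial>lborel) + (\<integral>x. v x * frechet_derivative \<psi> (at x) b \<partial>lborel))"
      unfolding mult.assoc distrib_right integral_mult_right_zero Bochner_Integration.integral_add[OF i(1,3)] ..
    moreover have "(\<integral>x. (((1/2) *\<^sub>R (g x + h x)) \<bullet> b) * \<psi> x \<partial>lborel)
        = (1/2) * ((\<integral>x. (g x \<bullet> b) * \<psi> x \<partial>lborel) + (\<integral>x. (h x \<bullet> b) * \<psi> x \<partial>lborel))"
      unfolding inner_scaleR_left inner_add_left mult.assoc distrib_right integral_mult_right_zero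
        Bochner_Integration.integral_add[OF i(2,4)] ..
    ultimately show "(\<integral>x. (1/2) * (u x + v x) * frechet_derivative \<psi> (at x) b \<partial>lborel)
        = - (\<integral>x. (((1/2) *\<^sub>R (g x + h x)) \<bullet> b) * \<psi> x \<partial>lborel)"
      by (simp only: e minus_add_distrib[symmetric] mult_minus_right)
  qed
qed

text \<open>Borel representatives: Fubini and translations are only available over \<open>lborel\<close>.\<close>

definition competitor :: "real \<Rightarrow> real \<Rightarrow> ('a::euclidean_space \<Rightarrow> real) \<Rightarrow> real \<Rightarrow> bool" where
  "competitor p R u c \<longleftrightarrow> u \<in> borel_measurable borel \<and> (\<forall>x. R < norm x \<longrightarrow> u x = 0)
     \<and> (\<integral>\<^sup>+x. ennreal (\<bar>u x\<bar> powr p) \<partial>lborel) = 1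
     \<and> (if p = 1 then TV u \<le> ereal c
        else \<exists>g. g \<in> borel_measurable borel \<and> weak_grad u g
          \<and> integrable lborel (\<lambda>x. norm (g x) powr p) \<and> (\<integral>x. norm (g x) powr p \<partial>lborel) \<le> c)"

lemma competitor_nonneg:
  fixes u :: "'a::euclidean_space \<Rightarrow> real"
  assumes "competitor p R u c"
  shows "0 \<le> c"
proof (cases "p = 1")
  case True
  then have "TV u \<le> ereal c" using assms by (simp add: competitor_def)
  with TV_nonneg[of u] have "0 \<le> ereal c" by (rule order_trans)
  then show ?thesis by simp
next
  case False
  then obtain g :: "'a \<Rightarrow> 'a" where "(\<integral>x. norm (g x) powr p \<partial>lborel) \<le> c"
    using assms by (auto simp: competitor_def)
  moreover have "0 \<le> (\<integral>x. norm (g x) powr p \<partial>lborel)" by simp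
  ultimately show ?thesis by linarith
qed

lemma competitor_integrable:
  fixes u :: "'a::euclidean_space \<Rightarrow> real"
  assumes p: "1 \<le> p" and u: "competitor p R u c"
  shows "integrable lborel (\<lambda>x. \<bar>u x\<bar> powr p)" "integrable lborel u"
proof -
  have [measurable]: "u \<in> borel_measurable borel" using u by (simp add: competitor_def)
  show i: "integrable lborel (\<lambda>x. \<bar>u x\<bar> powr p)"
    using u by (intro integrableI_bounded) (auto simp: competitor_def)
  have "integrable lborel (\<lambda>x. u x * indicator (cball 0 R) x)"
    by (rule integrable_powr_compact_supportI[OF p _ _ _ _ i, where B = 1 and R = R]) (auto simp: indicator_def)
  moreover have "u x * indicator (cball 0 R) x = u x" for x
    using u by (cases "norm x \<le> R") (auto simp: competitor_def)
  ultimately show "integrable lborel u" by simp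
qed

text \<open>The constant \<open>3 * 2 powr p\<close> dominates both the factor 3 from total
  variation and the factor \<open>2 powr p\<close> from weak gradients, so a single compactness
  theorem serves all exponents.\<close>

lemma competitor_translation_bound:
  fixes u :: "'a::euclidean_space \<Rightarrow> real"
  assumes p: "1 \<le> p" and R: "0 < R" and u: "competitor p R u c" and h: "norm h \<le> 1"
  shows "(\<integral>\<^sup>+x. ennreal (\<bar>u (h + x) - u x\<bar> powr p) \<partial>lborel) \<le> ennreal (3 * 2 powr p * c * norm h powr p)"
proof (cases "p = 1")
  case True
  have ui: "integrable lborel u" by (rule competitor_integrable[OF p u])
  have di: "integrable lborel (\<lambda>x. \<bar>u (h + x) - u x\<bar>)"
    by (intro integrable_abs Bochner_Integration.integrable_diff lborel_integrable_shift ui)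
  have "(\<integral>x. \<bar>u (h + x) - u x\<bar> \<partial>lborel) \<le> 3 * norm h * c"
    using u True by (intro TV_translation_estimate[OF ui _ R _ h]) (auto simp: competitor_def)
  also have "\<dots> \<le> 3 * 2 * c * norm h" using competitor_nonneg[OF u] by (simp add: mult_ac mult_right_mono)
  finally show ?thesis using True by (simp add: nn_integral_eq_integral[OF di] ennreal_leI)
next
  case False
  then obtain g where g: "g \<in> borel_measurable borel" "weak_grad u g"
     "integrable lborel (\<lambda>x. norm (g x) powr p)" "(\<integral>x. norm (g x) powr p \<partial>lborel) \<le> c"
    using u by (auto simp: competitor_def)
  have "(\<integral>\<^sup>+x. ennreal (\<bar>u (h + x) - u x\<bar> powr p) \<partial>lborel) \<le> ennreal (2 powr p * norm h powr p * c)"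
    using p False u by (intro weak_grad_translation_estimate[OF _ competitor_integrable(2)[OF p u] g(2,1,3,4) R _ h])
      (auto simp: competitor_def)
  also have "\<dots> \<le> ennreal (3 * 2 powr p * c * norm h powr p)"
    using competitor_nonneg[OF u] by (intro ennreal_leI) (simp add: mult_ac)
  finally show ?thesis .
qed

text \<open>By convexity of the p-th power, closeness to \<open>u\<close> is preserved under
  midpoints with no loss in the radius. Passing to combinations therefore does not disturb the
  convergence of the functions themselves.\<close>

lemma tail_hull_fst_close:
  fixes h :: "nat \<Rightarrow> 'm \<Rightarrow> real \<times> 'b::real_normed_vector"
  assumes p: "1 \<le> p" and hm: "\<And>k. (\<lambda>x. fst (h k x)) \<in> borel_measurable M" and [measurable]: "u \<in> borel_measurable M"
    and close: "\<And>k. n \<le> k \<Longrightarrow> (\<integral>\<^sup>+x. ennreal (\<bar>fst (h k x) - u x\<bar> powr p) \<partial>M) \<le> ennreal e"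
    and e: "0 \<le> e" and a: "tail_hull h n a"
  shows "(\<lambda>x. fst (a x)) \<in> borel_measurable M
    \<and> (\<integral>\<^sup>+x. ennreal (\<bar>fst (a x) - u x\<bar> powr p) \<partial>M) \<le> ennreal e"
  using a
proof induction
  case (base k)
  then show ?case using hm close by simp
next
  case (midpoint a b)
  then have [measurable]: "(\<lambda>x. fst (a x)) \<in> borel_measurable M" "(\<lambda>x. fst (b x)) \<in> borel_measurable M" by auto
  let ?A = "\<lambda>x. \<bar>fst (a x) - u x\<bar> powr p" and ?B = "\<lambda>x. \<bar>fst (b x) - u x\<bar> powr p"
  have "(\<integral>\<^sup>+x. ennreal (\<bar>fst ((1/2) *\<^sub>R (a x + b x)) - u x\<bar> powr p) \<partial>M)
     \<le> (\<integral>\<^sup>+x. ennreal (1/2) * ennreal (?A x) + ennreal (1/2) * ennreal (?B x) \<partial>M)"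
  proof (rule nn_integral_mono)
    fix x
    have eq: "fst ((1/2) *\<^sub>R (a x + b x)) - u x = (1/2) *\<^sub>R ((fst (a x) - u x) + (fst (b x) - u x))"
      by (simp add: field_simps)
    have "\<bar>fst ((1/2) *\<^sub>R (a x + b x)) - u x\<bar> powr p \<le> (?A x + ?B x) / 2"
      using norm_midpoint_powr_le[OF p, of "fst (a x) - u x" "fst (b x) - u x"]
      unfolding eq real_norm_def .
    then have "ennreal (\<bar>fst ((1/2) *\<^sub>R (a x + b x)) - u x\<bar> powr p) \<le> ennreal ((1/2) * ?A x + (1/2) * ?B x)"
      by (intro ennreal_leI) simp
    also have "\<dots> = ennreal (1/2) * ennreal (?A x) + ennreal (1/2) * ennreal (?B x)"
      by (simp only: ennreal_mult[symmetric] ennreal_plus[symmetric] mult_nonneg_nonneg powr_ge_zero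
          zero_le_divide_1_iff zero_le_numeral)
    finally show "ennreal (\<bar>fst ((1/2) *\<^sub>R (a x + b x)) - u x\<bar> powr p)
      \<le> ennreal (1/2) * ennreal (?A x) + ennreal (1/2) * ennreal (?B x)" .
  qed
  also have "\<dots> = ennreal (1/2) * (\<integral>\<^sup>+x. ennreal (?A x) \<partial>M) + ennreal (1/2) * (\<integral>\<^sup>+x. ennreal (?B x) \<partial>M)"
    by (simp add: nn_integral_add nn_integral_cmult)
  also have "\<dots> \<le> ennreal (1/2) * ennreal e + ennreal (1/2) * ennreal e"
    using midpoint by (intro add_mono mult_left_mono) auto
  also have "\<dots> = ennreal ((1/2) * e + (1/2) * e)"
    using e by (simp only: ennreal_mult[symmetric] ennreal_plus[symmetric] mult_nonneg_nonneg
        zero_le_divide_1_iff zero_le_numeral)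
  finally show ?case by simp
qed

lemma nn_integral_one_imp_integral_one:
  fixes f :: "'m \<Rightarrow> real"
  assumes "f \<in> borel_measurable M" "\<And>x. 0 \<le> f x" "(\<integral>\<^sup>+x. ennreal (f x) \<partial>M) = 1"
  shows "integrable M f" "(\<integral>x. f x \<partial>M) = 1"
proof -
  show i: "integrable M f" using assms by (intro integrableI_bounded) auto
  have "ennreal (\<integral>x. f x \<partial>M) = 1" using assms nn_integral_eq_integral[OF i] by simp
  then show "(\<integral>x. f x \<partial>M) = 1" by (simp add: ennreal_eq_1)
qed

section \<open>Lower semicontinuity of the energies\<close>

lemma TV_limit_le:
  fixes u :: "nat \<Rightarrow> 'a::euclidean_space \<Rightarrow> real"
  assumes um: "\<And>n. u n \<in> borel_measurable borel" and wm: "w \<in> borel_measurable borel"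
    and w: "(\<integral>\<^sup>+x. ennreal (\<bar>w x\<bar> powr 1) \<partial>lborel) < \<infinity>"
    and conv: "\<And>e. 0 < e \<Longrightarrow> \<exists>N. \<forall>n\<ge>N. (\<integral>\<^sup>+x. ennreal (\<bar>u n x - w x\<bar> powr 1) \<partial>lborel) \<le> ennreal e"
    and TV: "\<And>n. TV (u n) \<le> ereal (c n)" and c: "c \<longlonglongrightarrow> v"
  shows "TV w \<le> ereal v"
  unfolding TV_def
proof (rule SUP_least)
  fix \<phi> :: "'a \<Rightarrow> 'a" assume "\<phi> \<in> {\<phi>. C1c \<phi> \<and> (\<forall>x. norm (\<phi> x) \<le> 1)}"
  then have \<phi>: "C1c \<phi>" "\<And>x. norm (\<phi> x) \<le> 1" by auto
  have dm: "divergence \<phi> \<in> borel_measurable borel" by (rule C1c_divergence_measurable[OF \<phi>(1)])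
  obtain B R where BR: "\<And>x. \<bar>divergence \<phi> x\<bar> \<le> B" "\<And>x. R < norm x \<Longrightarrow> divergence \<phi> x = 0"
    by (rule C1c_divergence_bounded_support[OF \<phi>(1)]) blast
  have leb: "(\<integral>x. f x * divergence \<phi> x \<partial>lebesgue) = (\<integral>x. f x * divergence \<phi> x \<partial>lborel)"
    if "f \<in> borel_measurable borel" for f
    using that dm by (intro integral_completion) (simp add: borel_measurable_times)
  have "(\<lambda>n. \<integral>x. u n x * divergence \<phi> x \<partial>lborel) \<longlonglongrightarrow> (\<integral>x. w x * divergence \<phi> x \<partial>lborel)"
    by (rule tendsto_integral_mult_compact_support[OF order_refl um wm dm BR w conv])
  moreover have "(\<integral>x. u n x * divergence \<phi> x \<partial>lborel) \<le> c n" for n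
  proof -
    have "ereal (\<integral>x. u n x * divergence \<phi> x \<partial>lebesgue) \<le> TV (u n)"
      unfolding TV_def using \<phi> by (intro SUP_upper) auto
    also note TV
    finally show ?thesis by (simp add: leb[OF um])
  qed
  ultimately have "(\<integral>x. w x * divergence \<phi> x \<partial>lborel) \<le> v"
    using c by (intro LIMSEQ_le) auto
  then show "ereal (\<integral>x. w x * divergence \<phi> x \<partial>lebesgue) \<le> ereal v" by (simp add: leb[OF wm])
qed

text \<open>Both sides of the identity defining \<open>weak_grad\<close> are pairings with bounded,
  compactly supported functions, hence continuous under convergence in the mean of order p.\<close>

lemma weak_grad_limit:
  fixes u :: "nat \<Rightarrow> 'a::euclidean_space \<Rightarrow> real" and g :: "nat \<Rightarrow> 'a \<Rightarrow> 'a"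
  assumes p: "1 \<le> p"
    and um: "\<And>n. u n \<in> borel_measurable borel" and wm: "w \<in> borel_measurable borel"
    and gm: "\<And>n. g n \<in> borel_measurable borel" and Gm: "G \<in> borel_measurable borel"
    and w: "(\<integral>\<^sup>+x. ennreal (\<bar>w x\<bar> powr p) \<partial>lborel) < \<infinity>"
    and G: "(\<integral>\<^sup>+x. ennreal (norm (G x) powr p) \<partial>lborel) < \<infinity>"
    and uconv: "\<And>e. 0 < e \<Longrightarrow> \<exists>N. \<forall>n\<ge>N. (\<integral>\<^sup>+x. ennreal (\<bar>u n x - w x\<bar> powr p) \<partial>lborel) \<le> ennreal e"
    and gconv: "\<And>e. 0 < e \<Longrightarrow> \<exists>N. \<forall>n\<ge>N. (\<integral>\<^sup>+x. ennreal (norm (g n x - G x) powr p) \<partial>lborel) \<le> ennreal e"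
    and wg: "\<And>n. weak_grad (u n) (g n)"
  shows "weak_grad w G"
  unfolding weak_grad_lborel_iff[OF wm Gm]
proof (intro allI impI ballI)
  fix \<psi> :: "'a \<Rightarrow> real" and b :: 'a assume \<psi>: "C1c \<psi>" and b: "b \<in> Basis"
  note m = C1c_borel_measurable[OF \<psi>]
  obtain D where D: "\<And>x h. norm (frechet_derivative \<psi> (at x) h) \<le> D * norm h"
    using C1c_derivative_bounded[OF \<psi>] by blast
  obtain B where B: "\<And>x. norm (\<psi> x) \<le> B" using C1c_bounded[OF \<psi>] by blast
  obtain R where R: "\<And>x. R < norm x \<Longrightarrow> \<psi> x = 0" "\<And>x h. R < norm x \<Longrightarrow> frechet_derivative \<psi> (at x) h = 0"
    using C1c_support[OF \<psi>] by metis
  have D': "\<bar>frechet_derivative \<psi> (at x) b\<bar> \<le> D * norm b" for x using D[of x b] by simp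
  have comp: "\<bar>y \<bullet> b\<bar> powr p \<le> norm y powr p" for y :: 'a
    using p by (intro powr_mono2 Basis_le_norm b) auto
  have l1: "(\<lambda>n. \<integral>x. u n x * frechet_derivative \<psi> (at x) b \<partial>lborel)
      \<longlonglongrightarrow> (\<integral>x. w x * frechet_derivative \<psi> (at x) b \<partial>lborel)"
    by (rule tendsto_integral_mult_compact_support[OF p um wm m(2) D' R(2) w uconv])
  have l2: "(\<lambda>n. \<integral>x. (g n x \<bullet> b) * \<psi> x \<partial>lborel) \<longlonglongrightarrow> (\<integral>x. (G x \<bullet> b) * \<psi> x \<partial>lborel)"
  proof (rule tendsto_integral_mult_compact_support[where p = p and B = B and R = R])
    show "(\<integral>\<^sup>+x. ennreal (\<bar>G x \<bullet> b\<bar> powr p) \<partial>lborel) < \<infinity>"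
      by (rule le_less_trans[OF nn_integral_mono G]) (intro ennreal_leI comp)
    show "\<exists>N. \<forall>n\<ge>N. (\<integral>\<^sup>+x. ennreal (\<bar>g n x \<bullet> b - G x \<bullet> b\<bar> powr p) \<partial>lborel) \<le> ennreal e" if e: "0 < e" for e
    proof -
      obtain N where N: "\<And>n. n \<ge> N \<Longrightarrow> (\<integral>\<^sup>+x. ennreal (norm (g n x - G x) powr p) \<partial>lborel) \<le> ennreal e"
        using gconv[OF e] by blast
      show ?thesis
      proof (intro exI allI impI)
        fix n assume "n \<ge> N"
        show "(\<integral>\<^sup>+x. ennreal (\<bar>g n x \<bullet> b - G x \<bullet> b\<bar> powr p) \<partial>lborel) \<le> ennreal e"
          unfolding inner_diff_left[symmetric]
          by (rule order_trans[OF nn_integral_mono N[OF \<open>n \<ge> N\<close>]]) (intro ennreal_leI comp)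
      qed
    qed
    show "\<bar>\<psi> x\<bar> \<le> B" for x using B[of x] by simp
    show "(\<lambda>x. g n x \<bullet> b) \<in> borel_measurable borel" "(\<lambda>x. G x \<bullet> b) \<in> borel_measurable borel" for n
      by (rule borel_measurable_inner[OF gm borel_measurable_const] borel_measurable_inner[OF Gm borel_measurable_const])+
  qed (fact p m R)+
  have "(\<integral>x. u n x * frechet_derivative \<psi> (at x) b \<partial>lborel) = - (\<integral>x. (g n x \<bullet> b) * \<psi> x \<partial>lborel)" for n
    using wg[of n] \<psi> b unfolding weak_grad_lborel_iff[OF um gm] by blast
  with l1 have "(\<lambda>n. - (\<integral>x. (g n x \<bullet> b) * \<psi> x \<partial>lborel))
      \<longlonglongrightarrow> (\<integral>x. w x * frechet_derivative \<psi> (at x) b \<partial>lborel)" by simp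
  with tendsto_minus[OF l2]
  show "(\<integral>x. w x * frechet_derivative \<psi> (at x) b \<partial>lborel) = - (\<integral>x. (G x \<bullet> b) * \<psi> x \<partial>lborel)"
    by (rule LIMSEQ_unique[rotated])
qed

text \<open>The hull is formed from pairs, so every combination of gradients comes with the same
  combination of functions, and linearity keeps the one a weak gradient of the other.\<close>

lemma tail_hull_weak_grad:
  fixes u :: "nat \<Rightarrow> 'a::euclidean_space \<Rightarrow> real" and g :: "nat \<Rightarrow> 'a \<Rightarrow> 'a"
  assumes p: "1 \<le> p"
    and um: "\<And>n. u n \<in> borel_measurable borel" and gm: "\<And>n. g n \<in> borel_measurable borel"
    and ui: "\<And>n. integrable lborel (\<lambda>x. \<bar>u n x\<bar> powr p)"
    and gi: "\<And>n. integrable lborel (\<lambda>x. norm (g n x) powr p)"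
    and wg: "\<And>n. weak_grad (u n) (g n)"
    and a: "tail_hull (\<lambda>k x. (u k x, g k x)) n a"
  shows "(\<lambda>x. fst (a x)) \<in> borel_measurable borel \<and> (\<lambda>x. snd (a x)) \<in> borel_measurable borel
    \<and> integrable lborel (\<lambda>x. \<bar>fst (a x)\<bar> powr p) \<and> integrable lborel (\<lambda>x. norm (snd (a x)) powr p)
    \<and> weak_grad (\<lambda>x. fst (a x)) (\<lambda>x. snd (a x))"
  using a
proof induction
  case (base k)
  then show ?case using um gm ui gi wg by simp
next
  case (midpoint a b)
  then have a: "(\<lambda>x. fst (a x)) \<in> borel_measurable borel" "(\<lambda>x. snd (a x)) \<in> borel_measurable borel"
      "integrable lborel (\<lambda>x. \<bar>fst (a x)\<bar> powr p)" "integrable lborel (\<lambda>x. norm (snd (a x)) powr p)"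
      "weak_grad (\<lambda>x. fst (a x)) (\<lambda>x. snd (a x))"
    and b: "(\<lambda>x. fst (b x)) \<in> borel_measurable borel" "(\<lambda>x. snd (b x)) \<in> borel_measurable borel"
      "integrable lborel (\<lambda>x. \<bar>fst (b x)\<bar> powr p)" "integrable lborel (\<lambda>x. norm (snd (b x)) powr p)"
      "weak_grad (\<lambda>x. fst (b x)) (\<lambda>x. snd (b x))" by auto
  have f: "fst ((1/2) *\<^sub>R (a x + b x)) = (1/2) *\<^sub>R (fst (a x) + fst (b x))"
    and s: "snd ((1/2) *\<^sub>R (a x + b x)) = (1/2) *\<^sub>R (snd (a x) + snd (b x))" for x by simp_all
  have "weak_grad (\<lambda>x. (1/2) *\<^sub>R (fst (a x) + fst (b x))) (\<lambda>x. (1/2) *\<^sub>R (snd (a x) + snd (b x)))"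
    using weak_grad_midpoint[OF p a(1,2) b(1,2) a(3,4) b(3,4) a(5) b(5)] by simp
  moreover have "integrable lborel (\<lambda>x. \<bar>(1/2) *\<^sub>R (fst (a x) + fst (b x))\<bar> powr p)"
    using integrable_norm_midpoint_powr[OF p, of "\<lambda>x. fst (a x)" lborel "\<lambda>x. fst (b x)"] a b by simp
  moreover have "integrable lborel (\<lambda>x. norm ((1/2) *\<^sub>R (snd (a x) + snd (b x))) powr p)"
    using integrable_norm_midpoint_powr[OF p, of "\<lambda>x. snd (a x)" lborel "\<lambda>x. snd (b x)"] a b by simp
  moreover have "(\<lambda>x. (1/2) *\<^sub>R (fst (a x) + fst (b x))) \<in> borel_measurable borel"
    "(\<lambda>x. (1/2) *\<^sub>R (snd (a x) + snd (b x))) \<in> borel_measurable borel"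
    by (intro borel_measurable_scaleR borel_measurable_add borel_measurable_const a b)+
  ultimately show ?case unfolding f s by blast
qed

text \<open>The \<open>g n\<close> need not converge. Midpoint combinations of the tails make the
  gradients converge strongly, while the functions still tend to \<open>w\<close> and the energy
  bound \<open>v\<close> is kept; so the strong limit is a weak gradient of
  \<open>w\<close>.\<close>

lemma weak_grad_lower_semicontinuous:
  fixes u :: "nat \<Rightarrow> 'a::euclidean_space \<Rightarrow> real" and g :: "nat \<Rightarrow> 'a \<Rightarrow> 'a"
  assumes p: "1 < p"
    and um: "\<And>n. u n \<in> borel_measurable borel" and gm: "\<And>n. g n \<in> borel_measurable borel"
    and wm: "w \<in> borel_measurable borel"
    and ui: "\<And>n. integrable lborel (\<lambda>x. \<bar>u n x\<bar> powr p)"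
    and gi: "\<And>n. integrable lborel (\<lambda>x. norm (g n x) powr p)"
    and wg: "\<And>n. weak_grad (u n) (g n)"
    and w: "(\<integral>\<^sup>+x. ennreal (\<bar>w x\<bar> powr p) \<partial>lborel) < \<infinity>"
    and conv: "\<And>e. 0 < e \<Longrightarrow> \<exists>N. \<forall>n\<ge>N. (\<integral>\<^sup>+x. ennreal (\<bar>u n x - w x\<bar> powr p) \<partial>lborel) \<le> ennreal e"
    and bd: "\<And>n. (\<integral>x. norm (g n x) powr p \<partial>lborel) \<le> c n" and c: "c \<longlonglongrightarrow> v"
  obtains G where "G \<in> borel_measurable borel" "weak_grad w G"
    "integrable lborel (\<lambda>x. norm (G x) powr p)" "(\<integral>x. norm (G x) powr p \<partial>lborel) \<le> v"
proof -
  have p1: "1 \<le> p" using p by simp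
  let ?h = "\<lambda>k x. (u k x, g k x)"
  obtain H G where H: "\<And>n. tail_hull ?h n (H n)" and G: "G \<in> borel_measurable lborel"
    "(\<integral>\<^sup>+x. ennreal (norm (G x) powr p) \<partial>lborel) \<le> ennreal v"
    "\<And>e. 0 < e \<Longrightarrow> \<exists>N. \<forall>n\<ge>N. (\<integral>\<^sup>+x. ennreal (norm (snd (H n x) - G x) powr p) \<partial>lborel) \<le> ennreal e"
  proof (rule tail_hull_strong_limit[of p ?h lborel c v])
    show "(\<lambda>x. snd (u k x, g k x)) \<in> borel_measurable lborel" for k using gm by simp
    show "integrable lborel (\<lambda>x. norm (snd (u k x, g k x)) powr p)" for k using gi by simp
    show "(\<integral>x. norm (snd (u k x, g k x)) powr p \<partial>lborel) \<le> c k" for k using bd by simp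
    show "1 < p" "c \<longlonglongrightarrow> v" by fact+
  next
    fix H G assume "\<And>n. tail_hull ?h n (H n)" "G \<in> borel_measurable lborel"
      "(\<integral>\<^sup>+x. ennreal (norm (G x) powr p) \<partial>lborel) \<le> ennreal v"
      "\<And>e. 0 < e \<Longrightarrow> \<exists>N. \<forall>n\<ge>N. (\<integral>\<^sup>+x. ennreal (norm (snd (H n x) - G x) powr p) \<partial>lborel) \<le> ennreal e"
    then show thesis by (rule that)
  qed
  have Gm: "G \<in> borel_measurable borel" using G(1) by simp
  note hull = tail_hull_weak_grad[OF p1 um gm ui gi wg H]
  have Gfin: "(\<integral>\<^sup>+x. ennreal (norm (G x) powr p) \<partial>lborel) < \<infinity>"
    using G(2) by (rule le_less_trans) simp
  have wgG: "weak_grad w G"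
  proof (rule weak_grad_limit[where u = "\<lambda>n x. fst (H n x)" and g = "\<lambda>n x. snd (H n x)" and p = p])
    show "\<exists>N. \<forall>n\<ge>N. (\<integral>\<^sup>+x. ennreal (\<bar>fst (H n x) - w x\<bar> powr p) \<partial>lborel) \<le> ennreal e" if e: "0 < e" for e
    proof -
      obtain N where N: "\<And>n. n \<ge> N \<Longrightarrow> (\<integral>\<^sup>+x. ennreal (\<bar>u n x - w x\<bar> powr p) \<partial>lborel) \<le> ennreal e"
        using conv[OF e] by blast
      have "(\<integral>\<^sup>+x. ennreal (\<bar>fst (H n x) - w x\<bar> powr p) \<partial>lborel) \<le> ennreal e" if n: "n \<ge> N" for n
      proof (rule conjunct2[OF tail_hull_fst_close[where h = ?h and n = N]])
        show "(\<lambda>x. fst (u k x, g k x)) \<in> borel_measurable lborel" for k using um by simp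
        show "w \<in> borel_measurable lborel" using wm by simp
        show "(\<integral>\<^sup>+x. ennreal (\<bar>fst (u k x, g k x) - w x\<bar> powr p) \<partial>lborel) \<le> ennreal e" if "N \<le> k" for k
          using N[OF that] by simp
        show "tail_hull ?h N (H n)" using H[of n] n by (rule tail_hull_antimono)
      qed (use p1 e in simp_all)
      then show ?thesis by blast
    qed
    show "(\<lambda>x. fst (H n x)) \<in> borel_measurable borel" "(\<lambda>x. snd (H n x)) \<in> borel_measurable borel"
      "weak_grad (\<lambda>x. fst (H n x)) (\<lambda>x. snd (H n x))" for n
      using hull[of n] by blast+
  qed (fact p1 wm Gm w Gfin G(3))+
  have Gi: "integrable lborel (\<lambda>x. norm (G x) powr p)"
    using Gfin by (intro integrableI_bounded measurable_norm_powr G(1)) simp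
  have "0 \<le> c n" for n by (rule order_trans[OF Bochner_Integration.integral_nonneg bd]) simp
  then have v: "0 \<le> v" using LIMSEQ_le_const[OF c] by blast
  have "(\<integral>x. norm (G x) powr p \<partial>lborel) \<le> v"
    using G(2) v nn_integral_eq_integral[OF Gi] by simp
  with Gm wgG Gi show ?thesis by (rule that)
qed

theorem competitor_compactness:
  fixes u :: "nat \<Rightarrow> 'a::euclidean_space \<Rightarrow> real"
  assumes p: "1 \<le> p" and R: "0 < R" and comp: "\<And>k. competitor p R (u k) (c k)" and c: "c \<longlonglongrightarrow> v"
  obtains r :: "nat \<Rightarrow> nat" and w where "strict_mono r" "competitor p R w v"
    "AE x in lborel. (\<lambda>k. u (r k) x) \<longlonglongrightarrow> w x"
proof -
  have um: "u k \<in> borel_measurable borel" and us: "\<And>x. R < norm x \<Longrightarrow> u k x = 0"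
    and u1: "(\<integral>\<^sup>+x. ennreal (\<bar>u k x\<bar> powr p) \<partial>lborel) = 1" for k
    using comp[of k] by (simp_all add: competitor_def)
  obtain C where C: "\<And>k. \<bar>c k\<bar> \<le> C"
    using convergent_imp_Bseq[OF convergentI[OF c]] unfolding Bseq_def by auto
  have C0: "0 \<le> C" using C[of 0] by linarith
  obtain s :: "nat \<Rightarrow> nat" where s: "strict_mono s" and sC: "\<And>e. 0 < e \<Longrightarrow> \<exists>N. \<forall>m\<ge>N. \<forall>n\<ge>N.
      (\<integral>\<^sup>+x. ennreal (norm (u (s m) x - u (s n) x) powr p) \<partial>lborel) \<le> ennreal e"
  proof (rule translation_bound_imp_Cauchy_subsequence[where u = u and p = p and R = R and C = 1
        and K = "3 * 2 powr p * C"])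
    fix k :: nat and h :: 'a assume h: "norm h \<le> 1"
    have "3 * 2 powr p * c k * norm h powr p \<le> 3 * 2 powr p * C * norm h powr p"
      using C[of k] by (intro mult_right_mono mult_left_mono) auto
    then show "(\<integral>\<^sup>+x. ennreal (\<bar>u k (h + x) - u k x\<bar> powr p) \<partial>lborel) \<le> ennreal (3 * 2 powr p * C * norm h powr p)"
      by (rule order_trans[OF competitor_translation_bound[OF p R comp h] ennreal_leI])
  next
    fix r :: "nat \<Rightarrow> nat" assume "strict_mono r" "\<And>e. 0 < e \<Longrightarrow> \<exists>N. \<forall>m\<ge>N. \<forall>n\<ge>N.
      (\<integral>\<^sup>+x. ennreal (norm (u (r m) x - u (r n) x) powr p) \<partial>lborel) \<le> ennreal e"
    then show thesis by (rule that)
  next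
    show "u k x = 0" if "R < norm x" for k x using us[OF that] .
  qed (use p R C0 um u1 in simp_all)
  obtain w0 t where w0: "w0 \<in> borel_measurable lborel" and t: "strict_mono t"
    and AE0: "AE x in lborel. (\<lambda>k. u (s (t k)) x) \<longlonglongrightarrow> w0 x"
    and conv0: "\<And>e. 0 < e \<Longrightarrow> \<exists>N. \<forall>n\<ge>N. (\<integral>\<^sup>+x. ennreal (norm (u (s n) x - w0 x) powr p) \<partial>lborel) \<le> ennreal e"
  proof (rule nn_integral_powr_Cauchy_converges[of p "\<lambda>n. u (s n)" lborel])
    show "\<exists>N. \<forall>m\<ge>N. \<forall>n\<ge>N. (\<integral>\<^sup>+x. ennreal (norm (u (s m) x - u (s n) x) powr p) \<partial>lborel) \<le> ennreal e"
      if "0 < e" for e by (rule sC[OF that])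
  next
    fix g r assume "g \<in> borel_measurable lborel" "strict_mono r"
      "AE x in lborel. (\<lambda>k. u (s (r k)) x) \<longlonglongrightarrow> g x"
      "\<And>e. 0 < e \<Longrightarrow> \<exists>N. \<forall>n\<ge>N. (\<integral>\<^sup>+x. ennreal (norm (u (s n) x - g x) powr p) \<partial>lborel) \<le> ennreal e"
    then show thesis by (rule that)
  qed (use p um in simp_all)
  define r where "r = s \<circ> t"
  have r: "strict_mono r" unfolding r_def using s t by (rule strict_mono_o)
  \<comment> \<open>\<open>w0\<close> is determined only almost everywhere, but a
    \<open>competitor\<close> must vanish at every point outside the ball.\<close>
  define w where "w = (\<lambda>x. indicator (cball 0 R) x * w0 x)"
  have w_def': "w x = (if norm x \<le> R then w0 x else 0)" for x by (simp add: w_def)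
  have w0m: "w0 \<in> borel_measurable borel" using w0 by simp
  have wm: "w \<in> borel_measurable borel" unfolding w_def
    by (intro borel_measurable_times borel_measurable_indicator w0m) simp
  have lim: "AE x in lborel. (\<lambda>k. u (r k) x) \<longlonglongrightarrow> w x"
    using AE0
  proof eventually_elim
    case (elim x)
    then show ?case using us[of x] by (cases "norm x \<le> R") (simp_all add: w_def' r_def)
  qed
  have conv: "\<exists>N. \<forall>n\<ge>N. (\<integral>\<^sup>+x. ennreal (norm (u (r n) x - w x) powr p) \<partial>lborel) \<le> ennreal e" if e: "0 < e" for e
  proof -
    obtain N where N: "\<And>n. n \<ge> N \<Longrightarrow> (\<integral>\<^sup>+x. ennreal (norm (u (s n) x - w0 x) powr p) \<partial>lborel) \<le> ennreal e"
      using conv0[OF e] by blast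
    have "(\<integral>\<^sup>+x. ennreal (norm (u (r n) x - w x) powr p) \<partial>lborel) \<le> ennreal e" if n: "n \<ge> N" for n
    proof -
      have "t n \<ge> N" using seq_suble[OF t, of n] n by linarith
      have "norm (u (r n) x - w x) powr p \<le> norm (u (s (t n)) x - w0 x) powr p" for x
        using us[of x "r n"] p by (cases "norm x \<le> R") (simp_all add: w_def' r_def)
      then have "(\<integral>\<^sup>+x. ennreal (norm (u (r n) x - w x) powr p) \<partial>lborel)
          \<le> (\<integral>\<^sup>+x. ennreal (norm (u (s (t n)) x - w0 x) powr p) \<partial>lborel)"
        by (intro nn_integral_mono ennreal_leI)
      also have "\<dots> \<le> ennreal e" by (rule N[OF \<open>t n \<ge> N\<close>])
      finally show ?thesis .
    qed
    then show ?thesis by blast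
  qed
  \<comment> \<open>Fatou yields only the upper bound. The lower one, which excludes loss of mass,
    comes from convergence in the mean.\<close>
  have w1: "(\<integral>\<^sup>+x. ennreal (\<bar>w x\<bar> powr p) \<partial>lborel) = 1"
  proof (rule antisym)
    have "(\<integral>\<^sup>+x. ennreal (norm (w x) powr p) \<partial>lborel) \<le> 1"
      by (rule nn_integral_powr_Fatou[where f = "\<lambda>n. u (r n)" and c = "\<lambda>_. 1"])
        (use p um u1 lim in simp_all)
    then show "(\<integral>\<^sup>+x. ennreal (\<bar>w x\<bar> powr p) \<partial>lborel) \<le> 1" by simp
    have "1 \<le> (\<integral>\<^sup>+x. ennreal (norm (w x) powr p) \<partial>lborel)"
    proof (rule nn_integral_powr_limit_ge[where f = "\<lambda>n. u (r n)"])
      show "\<exists>N. \<forall>n\<ge>N. (\<integral>\<^sup>+x. ennreal (norm (u (r n) x - w x) powr p) \<partial>lborel) \<le> ennreal e" if "0 < e" for e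
        by (rule conv[OF that])
    qed (use p um wm u1 in simp_all)
    then show "1 \<le> (\<integral>\<^sup>+x. ennreal (\<bar>w x\<bar> powr p) \<partial>lborel)" by simp
  qed
  then have wfin: "(\<integral>\<^sup>+x. ennreal (\<bar>w x\<bar> powr p) \<partial>lborel) < \<infinity>" by simp
  have cr: "(\<lambda>n. c (r n)) \<longlonglongrightarrow> v" using LIMSEQ_subseq_LIMSEQ[OF c r] by (simp add: o_def)
  have conv': "\<exists>N. \<forall>n\<ge>N. (\<integral>\<^sup>+x. ennreal (\<bar>u (r n) x - w x\<bar> powr p) \<partial>lborel) \<le> ennreal e" if "0 < e" for e
    using conv[OF that] by simp
  have "competitor p R w v"
  proof (cases "p = 1")
    case True
    have "TV w \<le> ereal v"
    proof (rule TV_limit_le[where u = "\<lambda>n. u (r n)"])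
      show "\<exists>N. \<forall>n\<ge>N. (\<integral>\<^sup>+x. ennreal (\<bar>u (r n) x - w x\<bar> powr 1) \<partial>lborel) \<le> ennreal e" if "0 < e" for e
        using conv'[OF that] True by simp
      show "TV (u (r n)) \<le> ereal (c (r n))" for n using comp[of "r n"] True by (simp add: competitor_def)
    qed (use um wm wfin cr True in simp_all)
    then show ?thesis using True wm w1 by (simp add: competitor_def w_def')
  next
    case False
    then have p': "1 < p" using p by simp
    have "\<exists>g. g \<in> borel_measurable borel \<and> weak_grad (u k) g
          \<and> integrable lborel (\<lambda>x. norm (g x) powr p) \<and> (\<integral>x. norm (g x) powr p \<partial>lborel) \<le> c k" for k
      using comp[of k] False by (simp add: competitor_def)
    then obtain g where g: "\<And>k. g k \<in> borel_measurable borel" "\<And>k. weak_grad (u k) (g k)"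
      "\<And>k. integrable lborel (\<lambda>x. norm (g k x) powr p)" "\<And>k. (\<integral>x. norm (g k x) powr p \<partial>lborel) \<le> c k"
      by metis
    obtain G where "G \<in> borel_measurable borel" "weak_grad w G"
      "integrable lborel (\<lambda>x. norm (G x) powr p)" "(\<integral>x. norm (G x) powr p \<partial>lborel) \<le> v"
    proof (rule weak_grad_lower_semicontinuous[where u = "\<lambda>n. u (r n)" and g = "\<lambda>n. g (r n)"
          and w = w and p = p and c = "\<lambda>n. c (r n)" and v = v])
      show "integrable lborel (\<lambda>x. \<bar>u (r n) x\<bar> powr p)" for n
        by (rule competitor_integrable(1)[OF p comp])
      show "\<exists>N. \<forall>n\<ge>N. (\<integral>\<^sup>+x. ennreal (\<bar>u (r n) x - w x\<bar> powr p) \<partial>lborel) \<le> ennreal e" if "0 < e" for e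
        by (rule conv'[OF that])
    next
      fix G assume "G \<in> borel_measurable borel" "weak_grad w G"
        "integrable lborel (\<lambda>x. norm (G x) powr p)" "(\<integral>x. norm (G x) powr p \<partial>lborel) \<le> v"
      then show thesis by (rule that)
    qed (rule p' um g wm wfin cr)+
    then show ?thesis using False wm w1 unfolding competitor_def by (auto simp: w_def')
  qed
  with r show ?thesis using lim by (rule that)
qed

text \<open>The energy is recorded as an upper bound \<open>c\<close>, since no more than that
  survives a limit; the gradient is hidden because the limit obtains a new one.\<close>

definition admissible :: "real \<Rightarrow> 'a::euclidean_space set \<Rightarrow> ('a \<Rightarrow> real) \<Rightarrow> real \<Rightarrow> bool" where
  "admissible p F u c \<longleftrightarrow> (if p = 1 then u \<in> BV0 F \<and> TV u \<le> ereal c \<and> (\<integral>x. \<bar>u x\<bar> \<partial>lebesgue) = 1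
     else \<exists>g. W1p0_grad p F u g \<and> (\<integral>x. norm (g x) powr p \<partial>lebesgue) \<le> c \<and> (\<integral>x. \<bar>u x\<bar> powr p \<partial>lebesgue) = 1)"

lemma admissible_measurable: "admissible p F u c \<Longrightarrow> u \<in> borel_measurable lebesgue"
  by (auto simp: admissible_def BV0_def W1p0_grad_def split: if_splits)

lemma admissible_vanishes: "admissible p F u c \<Longrightarrow> AE x in lebesgue. x \<notin> F \<longrightarrow> u x = 0"
  by (auto simp: admissible_def BV0_def W1p0_grad_def split: if_splits)

lemma admissible_integral:
  assumes "admissible p F u c"
  shows "integrable lebesgue (\<lambda>x. \<bar>u x\<bar> powr p)" "(\<integral>x. \<bar>u x\<bar> powr p \<partial>lebesgue) = 1"
  using assms by (auto simp: admissible_def BV0_def W1p0_grad_def split: if_splits)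

text \<open>Energies and norms are taken over the whole space, so the set enters only through the
  vanishing condition. Functions can thus be moved freely between a chamber, the ambient set and
  their own support.\<close>

lemma admissible_support:
  fixes u :: "'a::euclidean_space \<Rightarrow> real"
  assumes "admissible p F u c" "AE x in lebesgue. x \<notin> E \<longrightarrow> u x = 0"
  shows "admissible p E u c"
  using assms by (auto simp: admissible_def BV0_def W1p0_grad_def split: if_splits)

lemma competitor_of_admissible:
  fixes u :: "'a::euclidean_space \<Rightarrow> real"
  assumes adm: "admissible p F u c" and F: "\<And>x. x \<in> F \<Longrightarrow> norm x \<le> R"
  obtains u' where "competitor p R u' c" "AE x in lebesgue. u x = u' x"
proof -
  note um = admissible_measurable[OF adm]
  obtain u0 where u0: "u0 \<in> borel_measurable borel" "AE x in lebesgue. u x = u0 x"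
    by (rule borel_representative[OF um])
  define u' where "u' = (\<lambda>x. indicator (cball 0 R) x * u0 x)"
  have u'_def': "u' x = (if norm x \<le> R then u0 x else 0)" for x by (simp add: u'_def)
  have u'm: "u' \<in> borel_measurable borel" unfolding u'_def
    by (intro borel_measurable_times borel_measurable_indicator u0(1)) simp
  have u'l: "u' \<in> borel_measurable lebesgue" using u'm by (simp add: measurable_completion)
  have eq: "AE x in lebesgue. u x = u' x"
    using u0(2) admissible_vanishes[OF adm]
  proof eventually_elim
    case (elim x)
    then show ?case using F[of x] by (auto simp: u'_def')
  qed
  have "(\<integral>\<^sup>+x. ennreal (\<bar>u' x\<bar> powr p) \<partial>lborel) = (\<integral>\<^sup>+x. ennreal (\<bar>u' x\<bar> powr p) \<partial>lebesgue)"
    by (rule nn_integral_completion[symmetric])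
  also have "\<dots> = (\<integral>\<^sup>+x. ennreal (\<bar>u x\<bar> powr p) \<partial>lebesgue)"
    by (rule nn_integral_cong_AE) (use eq in eventually_elim, simp)
  also have "\<dots> = 1"
    using admissible_integral[OF adm] by (subst nn_integral_eq_integral) auto
  finally have one: "(\<integral>\<^sup>+x. ennreal (\<bar>u' x\<bar> powr p) \<partial>lborel) = 1" .
  have "competitor p R u' c"
  proof (cases "p = 1")
    case True
    then have "TV u' \<le> ereal c" using adm TV_cong_AE[OF um u'l eq] by (simp add: admissible_def)
    then show ?thesis using True u'm one by (simp add: competitor_def u'_def')
  next
    case False
    then obtain g where g: "g \<in> borel_measurable lebesgue" "integrable lebesgue (\<lambda>x. norm (g x) powr p)"
      "weak_grad u g" "(\<integral>x. norm (g x) powr p \<partial>lebesgue) \<le> c"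
      using adm by (auto simp: admissible_def W1p0_grad_def)
    obtain g' where g': "g' \<in> borel_measurable borel" "AE x in lebesgue. g x = g' x"
      by (rule borel_representative[OF g(1)])
    have g'l: "g' \<in> borel_measurable lebesgue" using g'(1) by (simp add: measurable_completion)
    have pm: "(\<lambda>x. norm (g' x) powr p) \<in> borel_measurable lborel"
      using g'(1) by (intro measurable_norm_powr) simp
    have ae: "AE x in lebesgue. norm (g x) powr p = norm (g' x) powr p"
      using g'(2) by eventually_elim simp
    have "integrable lebesgue (\<lambda>x. norm (g' x) powr p)"
      using g(2) integrable_cong_AE[OF measurable_norm_powr[OF g(1)] measurable_norm_powr[OF g'l] ae] by blast
    then have i: "integrable lborel (\<lambda>x. norm (g' x) powr p)" using integrable_completion[OF pm] by blast
    have "(\<integral>x. norm (g' x) powr p \<partial>lborel) = (\<integral>x. norm (g x) powr p \<partial>lebesgue)"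
      unfolding integral_cong_AE[OF measurable_norm_powr[OF g(1)] measurable_norm_powr[OF g'l] ae]
      by (rule integral_completion[OF pm, symmetric])
    with g(4) have "(\<integral>x. norm (g' x) powr p \<partial>lborel) \<le> c" by simp
    moreover have "weak_grad u' g'" by (rule weak_grad_cong_AE[OF um u'l g(1) g'l eq g'(2) g(3)])
    ultimately show ?thesis
      using False u'm one i g'(1) unfolding competitor_def by (auto simp: u'_def')
  qed
  then show ?thesis using eq by (rule that)
qed

lemma admissible_of_competitor:
  fixes u :: "'a::euclidean_space \<Rightarrow> real"
  assumes p: "1 \<le> p" and u: "competitor p R u c" and F: "AE x in lebesgue. x \<notin> F \<longrightarrow> u x = 0"
  shows "admissible p F u c"
proof -
  have um: "u \<in> borel_measurable lborel" using u by (simp add: competitor_def)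
  have ul: "u \<in> borel_measurable lebesgue" by (rule measurable_completion[OF um])
  have apm: "(\<lambda>x. \<bar>u x\<bar> powr p) \<in> borel_measurable lborel"
    using measurable_norm_powr[OF um, of p] by simp
  have one: "(\<integral>\<^sup>+x. ennreal (\<bar>u x\<bar> powr p) \<partial>lborel) = 1" using u by (simp add: competitor_def)
  have i: "integrable lebesgue (\<lambda>x. \<bar>u x\<bar> powr p)" "(\<integral>x. \<bar>u x\<bar> powr p \<partial>lebesgue) = 1"
    using nn_integral_one_imp_integral_one[OF apm _ one]
    by (simp_all add: integrable_completion[OF apm] integral_completion[OF apm])
  show ?thesis
  proof (cases "p = 1")
    case True
    have "integrable lebesgue u"
      using competitor_integrable(2)[OF p u] by (simp add: integrable_completion[OF um])
    moreover have TV: "TV u \<le> ereal c" using u True by (simp add: competitor_def)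
    moreover have "TV u < \<infinity>" using TV by (rule le_less_trans) simp
    ultimately show ?thesis using True i F by (simp add: admissible_def BV0_def)
  next
    case False
    then obtain g where g: "g \<in> borel_measurable borel" "weak_grad u g"
      "integrable lborel (\<lambda>x. norm (g x) powr p)" "(\<integral>x. norm (g x) powr p \<partial>lborel) \<le> c"
      using u by (auto simp: competitor_def)
    have gm: "g \<in> borel_measurable lborel" using g(1) by simp
    note pm = measurable_norm_powr[OF gm, of p]
    have "W1p0_grad p F u g"
      unfolding W1p0_grad_def using ul i(1) g F measurable_completion[OF gm]
      by (simp add: integrable_completion[OF pm])
    moreover have "(\<integral>x. norm (g x) powr p \<partial>lebesgue) \<le> c" using g(4) by (simp add: integral_completion[OF pm])
    ultimately show ?thesis using False i(2) unfolding admissible_def by auto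
  qed
qed

theorem admissible_compactness:
  fixes u :: "nat \<Rightarrow> 'a::euclidean_space \<Rightarrow> real"
  assumes p: "1 \<le> p" and F: "bounded F" and adm: "\<And>k. admissible p F (u k) (c k)" and c: "c \<longlonglongrightarrow> v"
  obtains r :: "nat \<Rightarrow> nat" and w where "strict_mono r" "admissible p F w v"
    "AE x in lebesgue. (\<lambda>k. u (r k) x) \<longlonglongrightarrow> w x"
proof -
  obtain R where R: "0 < R" "\<And>x. x \<in> F \<Longrightarrow> norm x \<le> R" using F unfolding bounded_pos by blast
  have "\<exists>u'. competitor p R u' (c k) \<and> (AE x in lebesgue. u k x = u' x)" for k
    using competitor_of_admissible[OF adm R(2)] by metis
  then obtain u' where u': "\<And>k. competitor p R (u' k) (c k)" "\<And>k. AE x in lebesgue. u k x = u' k x" by metis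
  obtain r :: "nat \<Rightarrow> nat" and w where r: "strict_mono r" and w: "competitor p R w v"
    and lim: "AE x in lborel. (\<lambda>k. u' (r k) x) \<longlonglongrightarrow> w x"
    by (rule competitor_compactness[OF p R(1) u'(1) c])
  have "AE x in lebesgue. \<forall>k. u k x = u' k x" using u'(2) by (simp add: AE_all_countable)
  with AE_completion[OF lim] have lim': "AE x in lebesgue. (\<lambda>k. u (r k) x) \<longlonglongrightarrow> w x"
    by eventually_elim simp
  have "AE x in lebesgue. \<forall>k. x \<notin> F \<longrightarrow> u k x = 0"
    unfolding AE_all_countable using admissible_vanishes[OF adm] by blast
  with lim' have "AE x in lebesgue. x \<notin> F \<longrightarrow> w x = 0"
  proof eventually_elim
    case (elim x)
    show ?case
    proof
      assume "x \<notin> F"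
      with elim have "(\<lambda>k::nat. 0) \<longlonglongrightarrow> w x" by simp
      then show "w x = 0" by (simp add: LIMSEQ_const_iff)
    qed
  qed
  then have "admissible p F w v" by (rule admissible_of_competitor[OF p w])
  with r show ?thesis using lim' by (rule that)
qed

section \<open>Finite families and the supports of their limits\<close>

lemma admissible_family_compactness:
  fixes u :: "nat \<Rightarrow> 'n::finite \<Rightarrow> 'a::euclidean_space \<Rightarrow> real" and c :: "nat \<Rightarrow> real^'n"
  assumes p: "1 \<le> p" and F: "bounded F" and adm: "\<And>k i. admissible p F (u k i) (c k $ i)" and c: "c \<longlonglongrightarrow> v"
  obtains r :: "nat \<Rightarrow> nat" and w where "strict_mono r" "\<And>i. admissible p F (w i) (v $ i)"
    "\<And>i. AE x in lebesgue. (\<lambda>k. u (r k) i x) \<longlonglongrightarrow> w i x"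
proof -
  \<comment> \<open>Generalised from \<open>UNIV\<close> to a finite \<open>S\<close>, so that the
    components are treated one at a time, each on a subsequence of the previous one.\<close>
  have "\<exists>(r :: nat \<Rightarrow> nat) w. strict_mono r \<and> (\<forall>i\<in>S. admissible p F (w i) (v $ i)
      \<and> (AE x in lebesgue. (\<lambda>k. u (r k) i x) \<longlonglongrightarrow> w i x))" if "finite S" for S :: "'n set"
    using that
  proof induction
    case empty
    show ?case by (intro exI[of _ id]) (simp add: strict_mono_def)
  next
    case (insert j S)
    then obtain r :: "nat \<Rightarrow> nat" and w where r: "strict_mono r"
      and w: "\<And>i. i \<in> S \<Longrightarrow> admissible p F (w i) (v $ i)"
        "\<And>i. i \<in> S \<Longrightarrow> AE x in lebesgue. (\<lambda>k. u (r k) i x) \<longlonglongrightarrow> w i x" by blast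
    have "(\<lambda>k. c (r k)) \<longlonglongrightarrow> v" using LIMSEQ_subseq_LIMSEQ[OF c r] by (simp add: o_def)
    then have "(\<lambda>k. c (r k) $ j) \<longlonglongrightarrow> v $ j" by (rule tendsto_vec_nth)
    then obtain s :: "nat \<Rightarrow> nat" and y where s: "strict_mono s" and y: "admissible p F y (v $ j)"
      "AE x in lebesgue. (\<lambda>k. u (r (s k)) j x) \<longlonglongrightarrow> y x"
      by (rule admissible_compactness[OF p F adm])
    have old: "AE x in lebesgue. (\<lambda>k. u (r (s k)) i x) \<longlonglongrightarrow> w i x" if "i \<in> S" for i
      using w(2)[OF that]
    proof eventually_elim
      case (elim x)
      from LIMSEQ_subseq_LIMSEQ[OF this s] show ?case by (simp add: o_def)
    qed
    have "strict_mono (r \<circ> s)" using r s by (rule strict_mono_o)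
    moreover have "\<forall>i\<in>insert j S. admissible p F ((w(j := y)) i) (v $ i)
      \<and> (AE x in lebesgue. (\<lambda>k. u ((r \<circ> s) k) i x) \<longlonglongrightarrow> (w(j := y)) i x)"
      using y w(1) old by (auto simp: o_def)
    ultimately show ?case by blast
  qed
  from this[of UNIV] that show ?thesis by auto
qed

text \<open>Countably many null sets are discarded at once, after which the product vanishes
  pointwise in the limit. This is how disjointness of the chambers survives.\<close>

lemma AE_limit_product_zero:
  fixes u v :: "nat \<Rightarrow> 'a \<Rightarrow> real"
  assumes "\<And>k. AE x in M. u k x * v k x = 0"
    and "AE x in M. (\<lambda>k. u (r k) x) \<longlonglongrightarrow> a x" "AE x in M. (\<lambda>k. v (r k) x) \<longlonglongrightarrow> b x"
  shows "AE x in M. a x * b x = 0"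
proof -
  have "AE x in M. \<forall>k. u k x * v k x = 0" unfolding AE_all_countable using assms(1) by blast
  with assms(2,3) show ?thesis
  proof eventually_elim
    case (elim x)
    from tendsto_mult[OF elim(1,2)] elim(3) have "(\<lambda>k::nat. 0) \<longlonglongrightarrow> a x * b x" by simp
    then show ?case by (simp add: LIMSEQ_const_iff)
  qed
qed

text \<open>Unit norm excludes a null support, so no chamber disappears in the limit.\<close>

lemma admissible_support_set:
  fixes w :: "'a::euclidean_space \<Rightarrow> real"
  assumes adm: "admissible p F w c"
  shows "{x. w x \<noteq> 0} \<in> sets lebesgue" "{x. w x \<noteq> 0} - F \<in> null_sets lebesgue"
    "0 < emeasure lebesgue {x. w x \<noteq> 0}"
proof -
  note wm = admissible_measurable[OF adm]
  have "{x \<in> space lebesgue. w x \<noteq> 0} \<in> sets lebesgue" using wm by measurable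
  then show m: "{x. w x \<noteq> 0} \<in> sets lebesgue" by simp
  from admissible_vanishes[OF adm] have "AE x in lebesgue. x \<notin> {x. w x \<noteq> 0} - F" by eventually_elim auto
  then obtain N where N: "N \<in> null_sets lebesgue" "{x \<in> space lebesgue. x \<in> {x. w x \<noteq> 0} - F} \<subseteq> N"
    by (auto simp: eventually_ae_filter)
  then show "{x. w x \<noteq> 0} - F \<in> null_sets lebesgue"
    by (intro null_sets_completion_subset[OF _ N(1)]) auto
  show "0 < emeasure lebesgue {x. w x \<noteq> 0}"
  proof (rule ccontr)
    assume "\<not> ?thesis"
    then have "{x. w x \<noteq> 0} \<in> null_sets lebesgue" using m by auto
    then have "AE x in lebesgue. x \<notin> {x. w x \<noteq> 0}" by (rule AE_not_in)
    then have "AE x in lebesgue. \<bar>w x\<bar> powr p = 0" by eventually_elim simp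
    then have "(\<integral>x. \<bar>w x\<bar> powr p \<partial>lebesgue) = 0" by (rule integral_eq_zero_AE)
    with admissible_integral(2)[OF adm] show False by simp
  qed
qed

lemma disjoint_support_sets:
  fixes a b :: "'a::euclidean_space \<Rightarrow> real"
  assumes [measurable]: "a \<in> borel_measurable lebesgue" "b \<in> borel_measurable lebesgue"
    and "AE x in lebesgue. a x * b x = 0"
  shows "{x. a x \<noteq> 0} \<inter> {x. b x \<noteq> 0} \<in> null_sets lebesgue"
proof -
  have "{x \<in> space lebesgue. a x \<noteq> 0 \<and> b x \<noteq> 0} \<in> sets lebesgue" by measurable
  then have m: "{x. a x \<noteq> 0} \<inter> {x. b x \<noteq> 0} \<in> sets lebesgue" by (simp add: Collect_conj_eq)
  have "AE x in lebesgue. x \<notin> {x. a x \<noteq> 0} \<inter> {x. b x \<noteq> 0}"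
    using assms(3) by eventually_elim auto
  then show ?thesis using AE_iff_null_sets[OF m] by simp
qed

lemma TV_cmult_le:
  fixes u :: "'a::euclidean_space \<Rightarrow> real"
  assumes c: "0 \<le> c" and TV: "TV u \<le> ereal t"
  shows "TV (\<lambda>x. c * u x) \<le> ereal (c * t)"
  unfolding TV_def
proof (rule SUP_least)
  fix \<phi> :: "'a \<Rightarrow> 'a" assume \<phi>: "\<phi> \<in> {\<phi>. C1c \<phi> \<and> (\<forall>x. norm (\<phi> x) \<le> 1)}"
  have "ereal (\<integral>x. u x * divergence \<phi> x \<partial>lebesgue) \<le> TV u"
    unfolding TV_def by (rule SUP_upper[OF \<phi>])
  also note TV
  finally have "(\<integral>x. u x * divergence \<phi> x \<partial>lebesgue) \<le> t" by simp
  then show "ereal (\<integral>x. c * u x * divergence \<phi> x \<partial>lebesgue) \<le> ereal (c * t)"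
    using c by (simp add: mult.assoc mult_left_mono)
qed

lemma real_of_ereal_TV: "TV u < \<infinity> \<Longrightarrow> ereal (real_of_ereal (TV u)) = TV u"
  using TV_nonneg[of u] by (intro ereal_real') auto

subsection \<open>The three infima\<close>

text \<open>By homogeneity of total variation, the ratio of perimeter to volume is the energy of the
  indicator scaled to unit mass. The volume is finite because \<open>E\<close> lies in a ball up to
  a null set.\<close>

lemma cluster_normalised_admissible:
  fixes E :: "'a::euclidean_space set"
  assumes F: "bounded F" and Em: "E \<in> sets lebesgue" and EF: "E - F \<in> null_sets lebesgue"
    and pos: "0 < emeasure lebesgue E" and per: "perimeter E < \<infinity>"
  shows "0 < measure lebesgue E"
    and "admissible 1 F (\<lambda>x. (1 / measure lebesgue E) * indicator E x)
      (real_of_ereal (perimeter E) / measure lebesgue E)"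
proof -
  let ?m = "measure lebesgue E"
  obtain R where R: "\<And>x. x \<in> F \<Longrightarrow> norm x \<le> R" using F unfolding bounded_iff by blast
  have aeF: "AE x in lebesgue. x \<notin> E - F" by (rule AE_not_in[OF EF])
  have "emeasure lebesgue E \<le> emeasure lebesgue (cball (0::'a) R)"
    by (rule emeasure_mono_AE) (use aeF R in \<open>auto elim: eventually_mono\<close>)
  also have "\<dots> = emeasure lborel (cball (0::'a) R)" by simp
  also have "\<dots> < \<infinity>" by (rule emeasure_bounded_finite) simp
  finally have fin: "emeasure lebesgue E < \<infinity>" .
  then have em: "emeasure lebesgue E = ennreal ?m" by (intro emeasure_eq_ennreal_measure) auto
  with pos show m: "0 < ?m" by (simp add: ennreal_less_zero_iff)
  have ii: "integrable lebesgue (indicator E :: 'a \<Rightarrow> real)" using Em fin by (intro integrable_real_indicator) auto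
  have TV: "TV (\<lambda>x. (1 / ?m) * indicator E x) \<le> ereal ((1 / ?m) * real_of_ereal (perimeter E))"
    using m real_of_ereal_TV[of "indicator E"] per by (intro TV_cmult_le) (auto simp: perimeter_def)
  have "TV (\<lambda>x. (1 / ?m) * indicator E x) < \<infinity>" using TV by (rule le_less_trans) simp
  moreover have "AE x in lebesgue. x \<notin> F \<longrightarrow> (1 / ?m) * indicator E x = 0"
    using aeF by eventually_elim auto
  moreover have "(\<integral>x. \<bar>(1 / ?m) * indicator E x\<bar> \<partial>lebesgue) = 1"
    using m Em by (simp add: abs_mult)
  ultimately show "admissible 1 F (\<lambda>x. (1 / ?m) * indicator E x) (real_of_ereal (perimeter E) / ?m)"
    using TV ii by (simp add: admissible_def BV0_def)
qed

text \<open>Wherever the limit \<open>w\<close> of the normalised indicators is nonzero, it is the limit of the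
  reciprocal volumes; so \<open>w\<close> takes a single nonzero value. In particular the volumes cannot
  degenerate.\<close>

lemma normalised_indicator_limit:
  fixes w :: "'a::euclidean_space \<Rightarrow> real"
  assumes adm: "admissible 1 F w c"
    and lim: "AE x in lebesgue. (\<lambda>k. (1 / m k) * indicator (E k) x) \<longlonglongrightarrow> w x"
    and m: "\<And>k. 0 < m k"
  shows "perimeter {x. w x \<noteq> 0} < \<infinity>"
    and "real_of_ereal (perimeter {x. w x \<noteq> 0}) / measure lebesgue {x. w x \<noteq> 0} \<le> c"
proof -
  let ?S = "{x. w x \<noteq> 0}"
  let ?good = "\<lambda>x. (\<lambda>k. (1 / m k) * indicator (E k) x) \<longlonglongrightarrow> w x"
  note S = admissible_support_set[OF adm]
  have recip: "(\<lambda>k. 1 / m k) \<longlonglongrightarrow> w x" if g: "?good x" and nz: "w x \<noteq> 0" for x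
  proof -
    have "eventually (\<lambda>k. (1 / m k) * indicator (E k) x \<noteq> 0) sequentially"
      using g nz by (rule tendsto_imp_eventually_ne)
    then have "eventually (\<lambda>k. (1 / m k) * indicator (E k) x = 1 / m k) sequentially"
      by eventually_elim (auto simp: indicator_def split: if_splits)
    with g show ?thesis by (rule Lim_transform_eventually)
  qed
  have "\<exists>x. ?good x \<and> w x \<noteq> 0"
  proof (rule ccontr)
    assume "\<not> ?thesis"
    with lim have "AE x in lebesgue. x \<notin> ?S" by (auto elim: eventually_mono)
    then have "?S \<in> null_sets lebesgue" using AE_iff_null_sets[OF S(1)] by simp
    with S(3) show False by auto
  qed
  then obtain x0 where x0: "?good x0" "w x0 \<noteq> 0" by blast
  have w0: "0 < w x0"
  proof -
    have "0 \<le> w x0" using m by (intro LIMSEQ_le_const[OF recip[OF x0]]) (auto simp: less_imp_le)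
    with x0 show ?thesis by simp
  qed
  have weq: "AE x in lebesgue. w x = w x0 * indicator ?S x"
    using lim
  proof eventually_elim
    case (elim x)
    show ?case
    proof (cases "w x = 0")
      case False
      then have "w x = w x0" using recip[OF elim False] recip[OF x0] LIMSEQ_unique by blast
      then show ?thesis using False by simp
    qed simp
  qed
  note wm = admissible_measurable[OF adm]
  have Sm: "(indicator ?S :: 'a \<Rightarrow> real) \<in> borel_measurable lebesgue" using S(1) by simp
  have "1 = (\<integral>x. \<bar>w x\<bar> \<partial>lebesgue)" using adm by (simp add: admissible_def)
  also have "\<dots> = (\<integral>x. w x0 * indicator ?S x \<partial>lebesgue)"
  proof (rule integral_cong_AE)
    show "AE x in lebesgue. \<bar>w x\<bar> = w x0 * indicator ?S x"
      using weq
    proof eventually_elim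
      case (elim x)
      then show ?case using w0 by (cases "w x = 0") simp_all
    qed
  qed (use wm Sm in \<open>auto intro: borel_measurable_times\<close>)
  also have "\<dots> = w x0 * measure lebesgue ?S" using S(1) by simp
  \<comment> \<open>Unit mass identifies the single nonzero value of \<open>w\<close> as the
    reciprocal volume of its support, so \<open>w\<close> is again a normalised indicator.\<close>
  finally have vol: "w x0 * measure lebesgue ?S = 1" by simp
  have "TV (indicator ?S) = TV (\<lambda>x. (1 / w x0) * w x)"
  proof (rule TV_cong_AE[OF Sm])
    show "(\<lambda>x. (1 / w x0) * w x) \<in> borel_measurable lebesgue" using wm by simp
    show "AE x in lebesgue. indicator ?S x = (1 / w x0) * w x"
      using weq
    proof eventually_elim
      case (elim x)
      then show ?case using w0 by (cases "w x = 0") simp_all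
    qed
  qed
  also have "\<dots> \<le> ereal ((1 / w x0) * c)"
    using w0 adm by (intro TV_cmult_le) (auto simp: admissible_def)
  finally have TV: "perimeter ?S \<le> ereal ((1 / w x0) * c)" by (simp add: perimeter_def)
  then show fin: "perimeter ?S < \<infinity>" by (rule le_less_trans) simp
  have "ereal (real_of_ereal (perimeter ?S)) \<le> ereal ((1 / w x0) * c)"
    using TV real_of_ereal_TV fin unfolding perimeter_def by metis
  then have "real_of_ereal (perimeter ?S) \<le> (1 / w x0) * c" by simp
  also have "\<dots> = c * measure lebesgue ?S" using vol w0 by (simp add: field_simps)
  finally show "real_of_ereal (perimeter ?S) / measure lebesgue ?S \<le> c"
    using vol w0 by (cases "measure lebesgue ?S = 0") (auto simp: divide_le_eq measure_nonneg order.strict_iff_order)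
qed

lemma H_Phi_converges:
  fixes \<Omega> :: "'a::euclidean_space set"
    and \<Phi>k :: "nat \<Rightarrow> real^'n::finite \<Rightarrow> real" and \<Phi> :: "real^'n \<Rightarrow> real"
  assumes bnd: "bounded \<Omega>" and hyps: "equicoercive \<Phi>k" "\<forall>v\<in>Rplus. (\<lambda>k. \<Phi>k k v) \<longlonglongrightarrow> \<Phi> v"
    "Gamma_limit \<Phi>k \<Phi>" "monotone_Phi \<Phi>"
  shows "(\<lambda>k. H_Phi (\<Phi>k k) \<Omega>) \<longlonglongrightarrow> H_Phi \<Phi> \<Omega>"
proof -
  let ?f = "\<lambda>E :: 'n \<Rightarrow> 'a set. (\<chi> i. real_of_ereal (perimeter (E i)) / measure lebesgue (E i)) :: real^'n"
  let ?A = "?f ` {E. Ncluster \<Omega> E}"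
  have "(\<lambda>k. INF w\<in>?A. ereal (\<Phi>k k w)) \<longlonglongrightarrow> (INF w\<in>?A. ereal (\<Phi> w))"
  proof (rule tendsto_INF_of_Gamma_limit[OF _ _ hyps])
    show "?A \<subseteq> Rplus"
      by (auto simp: Rplus_def perimeter_def intro!: divide_nonneg_nonneg real_of_ereal_pos TV_nonneg)
    fix a :: "nat \<Rightarrow> real^'n" and v assume a: "\<And>k. a k \<in> ?A" and av: "a \<longlonglongrightarrow> v"
    have "\<exists>E. Ncluster \<Omega> E \<and> a k = ?f E" for k using a[of k] by blast
    then obtain E where E: "\<And>k. Ncluster \<Omega> (E k)" "\<And>k. a k = ?f (E k)" by metis
    have Ei: "E k i \<in> sets lebesgue" "E k i - \<Omega> \<in> null_sets lebesgue" "0 < emeasure lebesgue (E k i)"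
      "perimeter (E k i) < \<infinity>" for k i
      using E(1)[of k] by (simp_all add: Ncluster_def Nset_def del: emeasure_completion)
    note norm = cluster_normalised_admissible[OF bnd Ei]
    define u where "u k i x = (1 / measure lebesgue (E k i)) * indicator (E k i) x" for k i x
    have adm: "admissible 1 \<Omega> (u k i) (a k $ i)" for k i
      using norm(2)[of k i] by (simp add: E(2) u_def[abs_def])
    obtain r :: "nat \<Rightarrow> nat" and w where w: "\<And>i. admissible 1 \<Omega> (w i) (v $ i)"
      "\<And>i. AE x in lebesgue. (\<lambda>k. u (r k) i x) \<longlonglongrightarrow> w i x"
      using admissible_family_compactness[OF order_refl bnd adm av] by metis
    define S where "S i = {x. w i x \<noteq> 0}" for i
    note lim = normalised_indicator_limit[OF w(1) w(2)[unfolded u_def] norm(1)]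
    have "Nset \<Omega> S" unfolding Nset_def S_def
    proof (intro conjI allI impI)
      fix i j :: 'n assume ij: "i \<noteq> j"
      have "AE x in lebesgue. u k i x * u k j x = 0" for k
      proof -
        have "E k i \<inter> E k j \<in> null_sets lebesgue"
          using E(1)[of k] ij by (auto simp: Ncluster_def Nset_def)
        from AE_not_in[OF this] show ?thesis by eventually_elim (auto simp: u_def indicator_def)
      qed
      from AE_limit_product_zero[where u = "\<lambda>k. u k i" and v = "\<lambda>k. u k j", OF this w(2) w(2)] have "AE x in lebesgue. w i x * w j x = 0" .
      then show "{x. w i x \<noteq> 0} \<inter> {x. w j x \<noteq> 0} \<in> null_sets lebesgue"
        by (intro disjoint_support_sets admissible_measurable[OF w(1)])
    qed (rule admissible_support_set[OF w(1)])+
    then have "Ncluster \<Omega> S" unfolding Ncluster_def using lim(1) by (simp add: S_def)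
    moreover have "\<forall>i. ?f S $ i \<le> v $ i" using lim(2) by (simp add: S_def)
    ultimately show "\<exists>w\<in>?A. \<forall>i. w $ i \<le> v $ i" by blast
  qed
  then show ?thesis unfolding H_Phi_def image_image .
qed

section \<open>Infima over families of functions\<close>

lemma Lambda_Phi_converges:
  fixes \<Omega> :: "'a::euclidean_space set"
    and \<Phi>k :: "nat \<Rightarrow> real^'n::finite \<Rightarrow> real" and \<Phi> :: "real^'n \<Rightarrow> real"
  assumes bnd: "bounded \<Omega>" and hyps: "equicoercive \<Phi>k" "\<forall>v\<in>Rplus. (\<lambda>k. \<Phi>k k v) \<longlonglongrightarrow> \<Phi> v"
    "Gamma_limit \<Phi>k \<Phi>" "monotone_Phi \<Phi>" and p: "1 \<le> p"
  shows "(\<lambda>k. Lambda_Phi (\<Phi>k k) p \<Omega>) \<longlonglongrightarrow> Lambda_Phi \<Phi> p \<Omega>"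
proof -
  \<comment> \<open>Sign and disjointness do not involve the exponent, so one argument serves both p
    = 1 and p > 1.\<close>
  have common: "pN_common w"
    if u: "\<And>k. pN_common (u k)" and w: "\<And>i. AE x in lebesgue. (\<lambda>k. u (r k) i x) \<longlonglongrightarrow> w i x"
    for u :: "nat \<Rightarrow> 'n \<Rightarrow> 'a \<Rightarrow> real" and r :: "nat \<Rightarrow> nat" and w
    unfolding pN_common_def
  proof (intro conjI allI impI)
    fix i :: 'n
    have "AE x in lebesgue. \<forall>k. 0 \<le> u k i x"
      unfolding AE_all_countable using u by (auto simp: pN_common_def)
    with w[of i] show "AE x in lebesgue. 0 \<le> w i x"
    proof eventually_elim
      case (elim x)
      then show ?case by (intro LIMSEQ_le_const[OF elim(1)]) auto
    qed
    fix j assume "i \<noteq> j"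
    then have "AE x in lebesgue. u k i x * u k j x = 0" for k using u[of k] by (auto simp: pN_common_def)
    from AE_limit_product_zero[where u = "\<lambda>k. u k i" and v = "\<lambda>k. u k j", OF this w w] show "AE x in lebesgue. w i x * w j x = 0" .
  qed
  show ?thesis
  proof (cases "p = 1")
    case True
    let ?f = "\<lambda>u :: 'n \<Rightarrow> 'a \<Rightarrow> real. (\<chi> i. real_of_ereal (TV (u i))) :: real^'n"
    let ?A = "?f ` {u. oneN_function \<Omega> u}"
    have "(\<lambda>k. INF w\<in>?A. ereal (\<Phi>k k w)) \<longlonglongrightarrow> (INF w\<in>?A. ereal (\<Phi> w))"
    proof (rule tendsto_INF_of_Gamma_limit[OF _ _ hyps])
      show "?A \<subseteq> Rplus" by (auto simp: Rplus_def intro!: real_of_ereal_pos TV_nonneg)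
      fix a :: "nat \<Rightarrow> real^'n" and v assume a: "\<And>k. a k \<in> ?A" and av: "a \<longlonglongrightarrow> v"
      have "\<exists>u. oneN_function \<Omega> u \<and> a k = ?f u" for k using a[of k] by blast
      then obtain u where u: "\<And>k. oneN_function \<Omega> (u k)" "\<And>k. a k = ?f (u k)" by metis
      have adm: "admissible 1 \<Omega> (u k i) (a k $ i)" for k i
        using u(1)[of k] real_of_ereal_TV[of "u k i"] unfolding admissible_def oneN_function_def u(2)
        by (auto simp: BV0_def)
      obtain r :: "nat \<Rightarrow> nat" and w where w: "\<And>i. admissible 1 \<Omega> (w i) (v $ i)"
        "\<And>i. AE x in lebesgue. (\<lambda>k. u (r k) i x) \<longlonglongrightarrow> w i x"
        using admissible_family_compactness[OF order_refl bnd adm av] by metis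
      have "pN_common w" by (rule common[where u = u, OF _ w(2)]) (use u(1) in \<open>simp add: oneN_function_def\<close>)
      then have "oneN_function \<Omega> w" using w(1) by (simp add: oneN_function_def admissible_def)
      moreover have "?f w $ i \<le> v $ i" for i
      proof -
        have "TV (w i) \<le> ereal (v $ i)" "TV (w i) < \<infinity>" using w(1)[of i] by (auto simp: admissible_def BV0_def)
        then have "ereal (real_of_ereal (TV (w i))) \<le> ereal (v $ i)" by (simp add: real_of_ereal_TV)
        then show ?thesis by simp
      qed
      ultimately show "\<exists>w\<in>?A. \<forall>i. w $ i \<le> v $ i" by blast
    qed
    then show ?thesis using True unfolding Lambda_Phi_def image_image by simp
  next
    case False
    let ?f = "\<lambda>ug :: ('n \<Rightarrow> 'a \<Rightarrow> real) \<times> ('n \<Rightarrow> 'a \<Rightarrow> 'a).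
      (\<chi> i. \<integral>x. norm (snd ug i x) powr p \<partial>lebesgue) :: real^'n"
    let ?A = "?f ` {ug. pN_function_grad p \<Omega> (fst ug) (snd ug)}"
    have "(\<lambda>k. INF w\<in>?A. ereal (\<Phi>k k w)) \<longlonglongrightarrow> (INF w\<in>?A. ereal (\<Phi> w))"
    proof (rule tendsto_INF_of_Gamma_limit[OF _ _ hyps])
      show "?A \<subseteq> Rplus" by (auto simp: Rplus_def)
      fix a :: "nat \<Rightarrow> real^'n" and v assume a: "\<And>k. a k \<in> ?A" and av: "a \<longlonglongrightarrow> v"
      have "\<exists>u g. pN_function_grad p \<Omega> u g \<and> a k = ?f (u, g)" for k using a[of k] by auto
      then obtain u g where u: "\<And>k. pN_function_grad p \<Omega> (u k) (g k)" "\<And>k. a k = ?f (u k, g k)" by metis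
      have adm: "admissible p \<Omega> (u k i) (a k $ i)" for k i
        using u(1)[of k] False unfolding admissible_def pN_function_grad_def u(2)
        by (auto intro!: exI[of _ "g k i"])
      obtain r :: "nat \<Rightarrow> nat" and w where w: "\<And>i. admissible p \<Omega> (w i) (v $ i)"
        "\<And>i. AE x in lebesgue. (\<lambda>k. u (r k) i x) \<longlonglongrightarrow> w i x"
        using admissible_family_compactness[OF p bnd adm av] by metis
      have wc: "pN_common w" by (rule common[where u = u, OF _ w(2)]) (use u(1) in \<open>simp add: pN_function_grad_def\<close>)
      \<comment> \<open>The gradients of the limit functions are not limits of the
        \<open>g k\<close>; they are recovered from admissibility together with their own energy
        bounds.\<close>
      have "\<exists>g. W1p0_grad p \<Omega> (w i) g \<and> (\<integral>x. norm (g x) powr p \<partial>lebesgue) \<le> v $ i" for i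
        using w(1)[of i] False by (auto simp: admissible_def)
      then obtain G where G: "\<And>i. W1p0_grad p \<Omega> (w i) (G i)"
        "\<And>i. (\<integral>x. norm (G i x) powr p \<partial>lebesgue) \<le> v $ i" by metis
      have "pN_function_grad p \<Omega> w G"
        using wc G(1) admissible_integral(2)[OF w(1)] by (simp add: pN_function_grad_def)
      then have "?f (w, G) \<in> ?A" by (intro imageI) simp
      moreover have "\<forall>i. ?f (w, G) $ i \<le> v $ i" using G(2) by simp
      ultimately show "\<exists>w\<in>?A. \<forall>i. w $ i \<le> v $ i" by blast
    qed
    then show ?thesis using False unfolding Lambda_Phi_def image_image by simp
  qed
qed

section \<open>Eigenvalues of sets and their infima over disjoint families\<close>

lemma lambda1_le:
  assumes "admissible p F u c"
  shows "lambda1 p F \<le> ereal c"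
proof (cases "p = 1")
  case True
  then show ?thesis using assms unfolding lambda1_def admissible_def
    by (auto intro: INF_lower2)
next
  case False
  then obtain g where g: "W1p0_grad p F u g" "(\<integral>x. norm (g x) powr p \<partial>lebesgue) \<le> c"
    "(\<integral>x. \<bar>u x\<bar> powr p \<partial>lebesgue) = 1" using assms by (auto simp: admissible_def)
  have "lambda1 p F \<le> ereal (\<integral>x. norm (snd (u, g) x) powr p \<partial>lebesgue)"
    unfolding lambda1_def if_not_P[OF False] by (rule INF_lower) (use g in simp)
  also have "\<dots> \<le> ereal c" using g by simp
  finally show ?thesis .
qed

lemma lambda1_nonneg: "0 \<le> lambda1 p F"
proof (cases "p = 1")
  case True
  then show ?thesis unfolding lambda1_def by (auto intro!: INF_greatest TV_nonneg)
next
  case False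
  show ?thesis unfolding lambda1_def if_not_P[OF False] by (rule INF_greatest) simp
qed

lemma lambda1_less_imp_admissible:
  assumes "lambda1 p F < ereal c"
  obtains u where "admissible p F u c"
proof (cases "p = 1")
  case True
  then have "\<exists>u. u \<in> BV0 F \<and> (\<integral>x. \<bar>u x\<bar> \<partial>lebesgue) = 1 \<and> TV u < ereal c"
    using assms unfolding lambda1_def by (auto simp: INF_less_iff)
  then obtain u where "u \<in> BV0 F" "(\<integral>x. \<bar>u x\<bar> \<partial>lebesgue) = 1" "TV u < ereal c" by blast
  then have "admissible p F u c" using True by (simp add: admissible_def less_imp_le)
  then show ?thesis by (rule that)
next
  case False
  have "\<exists>ug\<in>{(u, g). W1p0_grad p F u g \<and> (\<integral>x. \<bar>u x\<bar> powr p \<partial>lebesgue) = 1}.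
     ereal (\<integral>x. norm (snd ug x) powr p \<partial>lebesgue) < ereal c"
    using assms unfolding lambda1_def if_not_P[OF False] INF_less_iff .
  then obtain u g where "W1p0_grad p F u g" "(\<integral>x. \<bar>u x\<bar> powr p \<partial>lebesgue) = 1"
    "(\<integral>x. norm (g x) powr p \<partial>lebesgue) < c" by auto
  then have "admissible p F u c" using False unfolding admissible_def by (auto intro!: exI[of _ g])
  then show ?thesis by (rule that)
qed

lemma Lcal_Phi_converges:
  fixes \<Omega> :: "'a::euclidean_space set"
    and \<Phi>k :: "nat \<Rightarrow> real^'n::finite \<Rightarrow> real" and \<Phi> :: "real^'n \<Rightarrow> real"
  assumes bnd: "bounded \<Omega>" and hyps: "equicoercive \<Phi>k" "\<forall>v\<in>Rplus. (\<lambda>k. \<Phi>k k v) \<longlonglongrightarrow> \<Phi> v"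
    "Gamma_limit \<Phi>k \<Phi>" "monotone_Phi \<Phi>" and p: "1 \<le> p"
  shows "(\<lambda>k. Lcal_Phi (\<Phi>k k) p \<Omega>) \<longlonglongrightarrow> Lcal_Phi \<Phi> p \<Omega>"
proof -
  let ?f = "\<lambda>E :: 'n \<Rightarrow> 'a set. (\<chi> i. real_of_ereal (lambda1 p (E i))) :: real^'n"
  let ?A = "?f ` {E. Nset \<Omega> E \<and> (\<forall>i. lambda1 p (E i) < \<infinity>)}"
  have real: "ereal (real_of_ereal (lambda1 p E)) = lambda1 p E" if "lambda1 p E < \<infinity>" for E :: "'a set"
    using that lambda1_nonneg[of p E] by (intro ereal_real') auto
  have "(\<lambda>k. INF w\<in>?A. ereal (\<Phi>k k w)) \<longlonglongrightarrow> (INF w\<in>?A. ereal (\<Phi> w))"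
  proof (rule tendsto_INF_of_Gamma_limit[OF _ _ hyps])
    show "?A \<subseteq> Rplus" by (auto simp: Rplus_def intro!: real_of_ereal_pos lambda1_nonneg)
    fix a :: "nat \<Rightarrow> real^'n" and v assume a: "\<And>k. a k \<in> ?A" and av: "a \<longlonglongrightarrow> v"
    have "\<exists>E. Nset \<Omega> E \<and> (\<forall>i. lambda1 p (E i) < \<infinity>) \<and> a k = ?f E" for k using a[of k] by blast
    then obtain E where E: "\<And>k. Nset \<Omega> (E k)" "\<And>k i. lambda1 p (E k i) < \<infinity>" "\<And>k. a k = ?f (E k)" by metis
    \<comment> \<open>The infimum defining each eigenvalue is not known to be attained, so a slack
      of \<open>1 / real (Suc k)\<close> is granted; it vanishes in the limit.\<close>
    define c where "c k = a k + (\<chi> i. 1 / real (Suc k))" for k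
    have "\<exists>u. admissible p (E k i) u (c k $ i)" for k i
    proof (rule lambda1_less_imp_admissible)
      have "lambda1 p (E k i) = ereal (a k $ i)" using real[OF E(2), of k i] by (simp add: E(3))
      also have "\<dots> < ereal (c k $ i)" by (simp add: c_def)
      finally show "lambda1 p (E k i) < ereal (c k $ i)" .
    qed blast
    then obtain u where u: "\<And>k i. admissible p (E k i) (u k i) (c k $ i)" by metis
    have adm: "admissible p \<Omega> (u k i) (c k $ i)" for k i
    proof (rule admissible_support[OF u])
      have "E k i - \<Omega> \<in> null_sets lebesgue" using E(1)[of k] by (simp add: Nset_def)
      from AE_not_in[OF this] admissible_vanishes[OF u[of k i]]
      show "AE x in lebesgue. x \<notin> \<Omega> \<longrightarrow> u k i x = 0" by eventually_elim auto
    qed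
    have "(\<lambda>k. (\<chi> i. 1 / real (Suc k)) :: real^'n) \<longlonglongrightarrow> (\<chi> i. 0)"
      by (intro tendsto_vec_lambda LIMSEQ_inverse_real_of_nat[unfolded inverse_eq_divide])
    from tendsto_add[OF av this] have cv: "c \<longlonglongrightarrow> v"
      by (simp add: c_def[abs_def] zero_vec_def[symmetric])
    obtain r :: "nat \<Rightarrow> nat" and w where w: "\<And>i. admissible p \<Omega> (w i) (v $ i)"
      "\<And>i. AE x in lebesgue. (\<lambda>k. u (r k) i x) \<longlonglongrightarrow> w i x"
      using admissible_family_compactness[OF p bnd adm cv] by metis
    define S where "S i = {x. w i x \<noteq> 0}" for i
    have "Nset \<Omega> S" unfolding Nset_def S_def
    proof (intro conjI allI impI)
      fix i j :: 'n assume ij: "i \<noteq> j"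
      have "AE x in lebesgue. u k i x * u k j x = 0" for k
      proof -
        have "E k i \<inter> E k j \<in> null_sets lebesgue" using E(1)[of k] ij by (auto simp: Nset_def)
        from AE_not_in[OF this] admissible_vanishes[OF u[of k i]] admissible_vanishes[OF u[of k j]]
        show ?thesis by eventually_elim auto
      qed
      from AE_limit_product_zero[where u = "\<lambda>k. u k i" and v = "\<lambda>k. u k j", OF this w(2) w(2)] have "AE x in lebesgue. w i x * w j x = 0" .
      then show "{x. w i x \<noteq> 0} \<inter> {x. w j x \<noteq> 0} \<in> null_sets lebesgue"
        by (intro disjoint_support_sets admissible_measurable[OF w(1)])
    qed (rule admissible_support_set[OF w(1)])+
    \<comment> \<open>\<open>w i\<close> vanishes off its own support by definition, so it is a test
      function for the eigenvalue of \<open>S i\<close>. This is what makes the supports the right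
      limiting sets.\<close>
    moreover have le: "lambda1 p (S i) \<le> ereal (v $ i)" for i
      by (rule lambda1_le[OF admissible_support[OF w(1)]]) (simp add: S_def)
    moreover have fin: "lambda1 p (S i) < \<infinity>" for i using le by (rule le_less_trans) simp
    moreover have "?f S $ i \<le> v $ i" for i
    proof -
      have "ereal (real_of_ereal (lambda1 p (S i))) \<le> ereal (v $ i)" using le real[OF fin] by simp
      then show ?thesis by simp
    qed
    ultimately show "\<exists>w\<in>?A. \<forall>i. w $ i \<le> v $ i" by blast
  qed
  then show ?thesis unfolding Lcal_Phi_def image_image .
qed

theorem mainTheorem19:
  fixes \<Omega> :: "'a::euclidean_space set"
    and \<Phi>k :: "nat \<Rightarrow> real^'n::finite \<Rightarrow> real"
    and \<Phi> :: "real^'n \<Rightarrow> real"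
  assumes "\<Omega> \<noteq> {}" and "bounded \<Omega>" and "open \<Omega>"
    and "\<forall>k. \<forall>v\<in>Rplus. 0 \<le> \<Phi>k k v"
    and "\<forall>v\<in>Rplus. 0 \<le> \<Phi> v"
    and "equicoercive \<Phi>k"
    and "\<forall>v\<in>Rplus. (\<lambda>k. \<Phi>k k v) \<longlonglongrightarrow> \<Phi> v"
    and "Gamma_limit \<Phi>k \<Phi>"
    and "monotone_Phi \<Phi>"
  shows "(\<lambda>k. H_Phi (\<Phi>k k) \<Omega>) \<longlonglongrightarrow> H_Phi \<Phi> \<Omega>
    \<and> (\<forall>p\<ge>1. (\<lambda>k. Lambda_Phi (\<Phi>k k) p \<Omega>) \<longlonglongrightarrow> Lambda_Phi \<Phi> p \<Omega>
              \<and> (\<lambda>k. Lcal_Phi (\<Phi>k k) p \<Omega>) \<longlonglongrightarrow> Lcal_Phi \<Phi> p \<Omega>)"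
  using H_Phi_converges[OF assms(2,6-9)] Lambda_Phi_converges[OF assms(2,6-9)]
    Lcal_Phi_converges[OF assms(2,6-9)] by blast

end
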